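(* Let $\mathbb{A}=\{z\in\mathbb{R}^2: r<|z|<R\}$ and $\mathbb{A}^*=\{z\in\mathbb{R}^2: r_*<|z|<R_*\}$ be planar annuli, with $0\leqslant r<R$ and $0\leqslant r_*<R_*$, and let $1\leqslant p<2$. Then $$\inf_{h\in\mathcal{H}^{1,p}_{\mathrm{Id}}(\mathbb{A},\mathbb{A}^* )}\int_{\mathbb{A}}|Dh(x)|^p\,dx\;=\;\inf_{h\in\mathcal{R}^{1,p}(\mathbb{A},\mathbb{A}^* )}\int_{\mathbb{A}}|Dh(x)|^p\,dx .$$
   Context: $|Dh|$ is the Hilbert–Schmidt norm of the differential matrix: $|Dh|^2=\operatorname{Tr}[D^*h\cdot Dh]$. Annuli with inner radius $0$ (punctured disks) are allowed. - $\mathcal{H}^{1,p}(\mathbb{A},\mathbb{A}^* )$ is the class of orientation-preserving homeomorphisms $h$ from $\mathbb{A}$ onto $\mathbb{A}^*$ which lie in the Sobolev space $W^{1,p}(\mathbb{A},\mathbb{R}^2)$ and preserve the order of the boundary components: $|h(x)|\to r_*$ as $|x|\to r$ and $|h(x)|\to R_*$ as $|x|\to R$. - $\partial_\circ\mathbb{A}=\{x\in\mathbb{R}^2:|x|=R\}$ is the outer boundary, and $\mathcal{H}^{1,p}_{\mathrm{Id}}(\mathbb{A},\mathbb{A}^* )$ is the class of $h\in\mathcal{H}^{1,p}(\mathbb{A},\mathbb{A}^* )$ that are continuous up to $\partial_\circ\mathbb{A}$ and satisfy $h(x)=\frac{R_*}{R}x$ for $x\in\partial_\circ\mathbb{A}$.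 - $\mathcal{R}^{1,p}(\mathbb{A},\mathbb{A}^* )=\{h\in\mathcal{H}^{1,p}(\mathbb{A},\mathbb{A}^* ): h(x)=H(|x|)\frac{x}{|x|}\}$ (for some real-valued function $H$) is the subclass of radial homeomorphisms. *)

theory Defs
  imports "HOL-Complex_Analysis.Complex_Analysis"
begin

section \<open>Sobolev mappings between planar domains\<close>

definition partial_deriv :: "2 \<Rightarrow> (real^2 \<Rightarrow> real) \<Rightarrow> real^2 \<Rightarrow> real" where
  "partial_deriv j f x = frechet_derivative f (at x) (axis j 1)"

primrec C_k :: "nat \<Rightarrow> (real^2 \<Rightarrow> real) \<Rightarrow> bool" where
  "C_k 0 f \<longleftrightarrow> continuous_on UNIV f"
| "C_k (Suc k) f \<longleftrightarrow> (\<forall>x. f differentiable (at x)) \<and> (\<forall>j. C_k k (partial_deriv j f))"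

definition test_functions :: "(real^2) set \<Rightarrow> (real^2 \<Rightarrow> real) set" where
  "test_functions \<Omega> =
     {\<phi>. (\<forall>k. C_k k \<phi>) \<and> (\<exists>K. compact K \<and> K \<subseteq> \<Omega> \<and> (\<forall>x. x \<notin> K \<longrightarrow> \<phi> x = 0))}"

definition locally_integrable_on :: "(real^2) set \<Rightarrow> (real^2 \<Rightarrow> 'a::{banach, second_countable_topology}) \<Rightarrow> bool" where
  "locally_integrable_on \<Omega> f \<longleftrightarrow> (\<forall>K. compact K \<and> K \<subseteq> \<Omega> \<longrightarrow> set_integrable lebesgue K f)"

definition Lp_on :: "real \<Rightarrow> (real^2) set \<Rightarrow> (real^2 \<Rightarrow> 'a::{banach, second_countable_topology}) \<Rightarrow> bool" where
  "Lp_on p \<Omega> f \<longleftrightarrow>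
     set_borel_measurable lebesgue \<Omega> f \<and> set_integrable lebesgue \<Omega> (\<lambda>x. norm (f x) powr p)"

text \<open>The entry \<open>D x $ i $ j\<close> is the weak derivative of the component \<open>h\<^sub>i\<close> in the direction
  \<open>x\<^sub>j\<close>.\<close>

definition has_weak_differential ::
    "(real^2) set \<Rightarrow> (real^2 \<Rightarrow> real^2) \<Rightarrow> (real^2 \<Rightarrow> real^2^2) \<Rightarrow> bool" where
  "has_weak_differential \<Omega> h D \<longleftrightarrow>
     locally_integrable_on \<Omega> h \<and> locally_integrable_on \<Omega> D \<and>
     (\<forall>\<phi> \<in> test_functions \<Omega>. \<forall>i j.
        (LINT x:\<Omega>|lebesgue. h x $ i * partial_deriv j \<phi> x) =
        - (LINT x:\<Omega>|lebesgue. D x $ i $ j * \<phi> x))"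

text \<open>The weak differential is unique up to a null subset of the open set \<open>\<Omega>\<close>, so integrals over
  \<open>\<Omega>\<close> do not depend on the choice.\<close>

definition weak_differential :: "(real^2) set \<Rightarrow> (real^2 \<Rightarrow> real^2) \<Rightarrow> real^2 \<Rightarrow> real^2^2" where
  "weak_differential \<Omega> h = (SOME D. has_weak_differential \<Omega> h D)"

definition Sobolev_W1 :: "real \<Rightarrow> (real^2) set \<Rightarrow> (real^2 \<Rightarrow> real^2) set" where
  "Sobolev_W1 p \<Omega> = {h. Lp_on p \<Omega> h \<and> (\<exists>D. has_weak_differential \<Omega> h D \<and> Lp_on p \<Omega> D)}"

definition hs_norm :: "real^2^2 \<Rightarrow> real" where
  "hs_norm M = sqrt (trace (transpose M ** M))"

definition p_energy :: "real \<Rightarrow> (real^2) set \<Rightarrow> (real^2 \<Rightarrow> real^2) \<Rightarrow> ennreal" where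
  "p_energy p \<Omega> h =
     (\<integral>\<^sup>+x\<in>\<Omega>. ennreal (hs_norm (weak_differential \<Omega> h x) powr p) \<partial>lebesgue)"


section \<open>Orientation\<close>

definition to_complex :: "real^2 \<Rightarrow> complex" where
  "to_complex x = Complex (x $ 1) (x $ 2)"

text \<open>A homeomorphism of planar domains preserves orientation if its local degree is \<open>1\<close> at
  every point, i.e. the image of every positively oriented circle around \<open>a\<close> bounding a disk in
  the domain winds once around \<open>h a\<close>. A condition on the sign of the Jacobian
  would not do: for \<open>p < 2\<close> the Jacobian of a Sobolev homeomorphism may vanish almost
  everywhere.\<close>

definition orientation_preserving_on :: "(real^2) set \<Rightarrow> (real^2 \<Rightarrow> real^2) \<Rightarrow> bool" where
  "orientation_preserving_on \<Omega> h \<longleftrightarrow>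
     (\<forall>a \<in> \<Omega>. \<forall>\<rho> > 0. cball a \<rho> \<subseteq> \<Omega> \<longrightarrow>
        winding_number
          (\<lambda>t. to_complex (h (a + \<rho> *\<^sub>R vector [cos (2 * pi * t), sin (2 * pi * t)])))
          (to_complex (h a)) = 1)"


section \<open>Classes of homeomorphisms between annuli\<close>

definition annulus :: "real \<Rightarrow> real \<Rightarrow> (real^2) set" where
  "annulus r R = {x. r < norm x \<and> norm x < R}"

text \<open>Throughout, \<open>r < R\<close> and \<open>r' < R'\<close> are the radii of the domain and of the target annulus.
  Mappings are total functions, of which only the restriction to the domain annulus matters.\<close>

definition Sobolev_homeos ::
    "real \<Rightarrow> real \<Rightarrow> real \<Rightarrow> real \<Rightarrow> real \<Rightarrow> (real^2 \<Rightarrow> real^2) set" where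
  "Sobolev_homeos p r R r' R' =
     {h. (\<exists>g. homeomorphism (annulus r R) (annulus r' R') h g) \<and>
         orientation_preserving_on (annulus r R) h \<and>
         h \<in> Sobolev_W1 p (annulus r R) \<and>
         ((\<lambda>x. norm (h x)) \<longlongrightarrow> r') (filtercomap norm (at_right r)) \<and>
         ((\<lambda>x. norm (h x)) \<longlongrightarrow> R') (filtercomap norm (at_left R))}"

text \<open>Here \<open>g\<close> is the continuous extension of \<open>h\<close> to the outer boundary \<open>sphere 0 R\<close>.\<close>

definition Sobolev_homeos_Id ::
    "real \<Rightarrow> real \<Rightarrow> real \<Rightarrow> real \<Rightarrow> real \<Rightarrow> (real^2 \<Rightarrow> real^2) set" where
  "Sobolev_homeos_Id p r R r' R' =
     {h \<in> Sobolev_homeos p r R r' R'.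
        \<exists>g. continuous_on (annulus r R \<union> sphere 0 R) g \<and>
            (\<forall>x \<in> annulus r R. g x = h x) \<and>
            (\<forall>x \<in> sphere 0 R. g x = (R' / R) *\<^sub>R x)}"

definition radial_Sobolev_homeos ::
    "real \<Rightarrow> real \<Rightarrow> real \<Rightarrow> real \<Rightarrow> real \<Rightarrow> (real^2 \<Rightarrow> real^2) set" where
  "radial_Sobolev_homeos p r R r' R' =
     {h \<in> Sobolev_homeos p r R r' R'.
        \<exists>H :: real \<Rightarrow> real. \<forall>x \<in> annulus r R. h x = H (norm x) *\<^sub>R (x /\<^sub>R norm x)}"

end

theory Submission
  imports Defs "HOL-Probability.Probability_Measure"
begin

text \<open>
  The two infima are compared in both directions.

  A radial homeomorphism \<open>h x = H (norm x) *\<^sub>R (x /\<^sub>R norm x)\<close> has a factor \<open>H\<close> without zeros, hence of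
  constant sign. Up to that sign it is a radial map with an increasing profile
  (\<open>radial_homeo_eq_profile\<close>), which extends to the outer circle as a multiple of the identity and has
  the same energy. So the infimum over maps with identity boundary values is at most the radial one.

  Conversely let \<open>h\<close> have identity boundary values, and let \<open>H \<rho>\<close> be the mean over \<open>t\<close> of
  \<open>h (\<rho> *\<^sub>R circ t) \<bullet> circ t\<close>. Differentiation in \<open>\<rho>\<close> and integration by parts on the circle show that
  \<open>H' \<rho>\<close> and \<open>H \<rho> / \<rho>\<close> are the circle means of the radial and of the tangential diagonal entry of the
  differential. Therefore the radial map with profile \<open>H\<close> has, on each circle, a differential whose
  norm is at most the mean of the norm of the differential of \<open>h\<close> (\<open>circle_norm_ge_radial\<close>), and
  Jensen's inequality yields the comparison of energies. The profile \<open>H\<close> has the right outer value,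
  but it may drop below \<open>r'\<close> and need not be monotone. A second lower bound takes care of the first
  defect: the boundary values force \<open>h\<close> to map every circle around the origin to a curve winding once around
  the disk of radius \<open>r'\<close>, so its length is at least \<open>2 * pi * r'\<close> and the mean of the norm of the differential is
  at least \<open>r' / \<rho>\<close> (\<open>circle_norm_ge_length\<close>). So replacing \<open>H\<close> by \<open>max H r'\<close> does not cost energy, and
  neither does the passage to the running infimum from the right, whose derivative is either \<open>0\<close> or that
  of \<open>H\<close> (\<open>monotone_minorant\<close>, \<open>monotone_radial_comparison\<close>).

  This argument is carried out for mollifications of \<open>h\<close> on closed subannuli. Mollifying does not
  increase the energy (\<open>mollification\<close>) and turns \<open>H\<close> into a continuously differentiable function, so
  that its monotone minorant is Lipschitz and differentiable off a countable set of radii. The energy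
  is compared with circle means by averaging over rotations (\<open>nn_integral_rotation_average\<close>). Adding a
  small multiple of an affine function makes the profile strictly increasing and corrects its end values
  (\<open>radial_approximation\<close>). The affine correction and the collars left out by the subannulus have small
  energy because \<open>norm x powr (- p)\<close> is integrable near the origin for \<open>p < 2\<close>.

  The energy refers to an arbitrarily chosen weak differential. It is identified with classical
  formulas by the uniqueness of weak differentials (\<open>weak_differential_unique\<close>) and by the fact that
  the pointwise derivative of a locally Lipschitz map is its weak differential
  (\<open>has_weak_differential_if_locally_lipschitz\<close>).
\<close>

no_notation fps_nth (infixl "$" 75)

section \<open>Smooth functions and bumps\<close>

lemma partial_deriv_eq:
  "(f has_derivative f') (at x) \<Longrightarrow> partial_deriv j f x = f' (axis j 1)"
  unfolding partial_deriv_def by (metis frechet_derivative_at)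

lemma C_k_Suc_imp_C_k: "C_k (Suc k) f \<Longrightarrow> C_k k f"
proof (induction k arbitrary: f)
  case 0
  then show ?case
    by (auto simp: continuous_on_eq_continuous_at differentiable_imp_continuous_within)
next
  case (Suc k)
  then show ?case by (metis C_k.simps(2))
qed

lemma C_k_const: "C_k k (\<lambda>x. c)"
proof (induction k arbitrary: c)
  case (Suc k)
  have "partial_deriv j (\<lambda>x. c) = (\<lambda>x. 0)" for j
    by (rule ext, subst partial_deriv_eq[OF has_derivative_const]) simp
  with Suc show ?case by simp
qed simp

lemma C_k_coord: "C_k k (\<lambda>x. x $ i)"
proof (cases k)
  case (Suc m)
  have D: "((\<lambda>x::real^2. x $ i) has_derivative (\<lambda>v. v $ i)) (at x)" for x
    by (rule bounded_linear_imp_has_derivative[OF bounded_linear_vec_nth])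
  have "partial_deriv j (\<lambda>x. x $ i) = (\<lambda>x. axis j 1 $ i)" for j
    by (rule ext, subst partial_deriv_eq[OF D]) simp
  with Suc D show ?thesis by (auto simp: C_k_const differentiable_def)
qed (auto intro: continuous_intros)

lemma C_k_add: "C_k k f \<Longrightarrow> C_k k g \<Longrightarrow> C_k k (\<lambda>x. f x + g x)"
proof (induction k arbitrary: f g)
  case 0
  then show ?case by (auto intro: continuous_intros)
next
  case (Suc k)
  have "partial_deriv j (\<lambda>x. f x + g x) = (\<lambda>x. partial_deriv j f x + partial_deriv j g x)" for j
  proof
    fix x
    obtain f' g' where D: "(f has_derivative f') (at x)" "(g has_derivative g') (at x)"
      using Suc.prems unfolding C_k.simps differentiable_def by blast
    show "partial_deriv j (\<lambda>x. f x + g x) x = partial_deriv j f x + partial_deriv j g x"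
      by (simp only: partial_deriv_eq[OF has_derivative_add[OF D]] partial_deriv_eq[OF D(1)] partial_deriv_eq[OF D(2)])
  qed
  with Suc show ?case by auto
qed

lemma C_k_mult: "C_k k f \<Longrightarrow> C_k k g \<Longrightarrow> C_k k (\<lambda>x. f x * g x)"
proof (induction k arbitrary: f g)
  case 0
  then show ?case by (auto intro: continuous_intros)
next
  case (Suc k)
  have "partial_deriv j (\<lambda>x. f x * g x) = (\<lambda>x. f x * partial_deriv j g x + partial_deriv j f x * g x)" for j
  proof
    fix x
    obtain f' g' where D: "(f has_derivative f') (at x)" "(g has_derivative g') (at x)"
      using Suc.prems unfolding C_k.simps differentiable_def by blast
    show "partial_deriv j (\<lambda>x. f x * g x) x = f x * partial_deriv j g x + partial_deriv j f x * g x"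
      by (simp only: partial_deriv_eq[OF has_derivative_mult[OF D]] partial_deriv_eq[OF D(1)] partial_deriv_eq[OF D(2)])
  qed
  moreover have "C_k k f" "C_k k g"
    using Suc.prems C_k_Suc_imp_C_k by blast+
  ultimately show ?case
    using Suc by (auto intro!: C_k_add Suc.IH)
qed

text \<open>The whole sequence of successive derivatives of the outer function is carried along, because the
  chain rule turns the \<open>n\<close>-th derivative composed with \<open>q\<close> into the next one.\<close>

lemma C_k_compose:
  assumes \<psi>: "\<And>n s. (\<psi> n has_real_derivative \<psi> (Suc n) s) (at s)"
    and q: "\<And>k. C_k k q"
  shows "C_k k (\<lambda>x. \<psi> n (q x))"
proof (induction k arbitrary: n)
  case 0
  have "continuous_on UNIV (\<psi> n)"
    using \<psi> by (auto simp: continuous_on_eq_continuous_at intro: DERIV_isCont)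
  moreover have "continuous_on UNIV q" using q[of 0] by simp
  ultimately show ?case
    using continuous_on_compose[of UNIV q "\<psi> n"] by (auto simp: o_def intro: continuous_on_subset)
next
  case (Suc k)
  have D: "((\<lambda>x. \<psi> n (q x)) has_derivative (\<lambda>v. q' v * \<psi> (Suc n) (q x))) (at x)"
    if "(q has_derivative q') (at x)" for x q'
    using DERIV_compose_FDERIV[OF \<psi> that] .
  have q1: "q differentiable (at x)" for x
    using q[of 1] by simp
  have "partial_deriv j (\<lambda>x. \<psi> n (q x)) = (\<lambda>x. partial_deriv j q x * \<psi> (Suc n) (q x))" for j
  proof
    fix x
    obtain q' where q': "(q has_derivative q') (at x)"
      using q1 by (meson differentiable_def)
    show "partial_deriv j (\<lambda>x. \<psi> n (q x)) x = partial_deriv j q x * \<psi> (Suc n) (q x)"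
      by (simp only: partial_deriv_eq[OF D[OF q']] partial_deriv_eq[OF q'])
  qed
  moreover have "C_k k (partial_deriv j q)" for j
    using q[of "Suc k"] by simp
  moreover have "(\<lambda>x. \<psi> n (q x)) differentiable (at x)" for x
    using D q1[of x] unfolding differentiable_def by blast
  ultimately show ?case
    by (simp add: C_k_mult Suc)
qed

text \<open>For \<open>P = 1\<close> this is the classical smooth function that is flat at \<open>0\<close>. The polynomial factor in
  \<open>1 / s\<close> makes the family closed under differentiation.\<close>

definition flat_exp :: "real poly \<Rightarrow> real \<Rightarrow> real" where
  "flat_exp P s = (if s > 0 then poly P (1 / s) * exp (- (1 / s)) else 0)"

lemma flat_exp_tendsto_0: "((\<lambda>s. poly P (1 / s) * exp (- (1 / s))) \<longlongrightarrow> 0) (at_right (0::real))"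
proof -
  have "((\<lambda>y. \<Sum>i\<le>degree P. coeff P i * (y ^ i / exp y)) \<longlongrightarrow> (\<Sum>i\<le>degree P. coeff P i * 0)) at_top"
    by (intro tendsto_sum tendsto_mult tendsto_const tendsto_power_div_exp_0)
  then have "((\<lambda>y::real. poly P y * exp (- y)) \<longlongrightarrow> 0) at_top"
    by (simp add: poly_altdef sum_distrib_right exp_minus divide_inverse mult.assoc)
  then show ?thesis
    using filterlim_compose[OF _ filterlim_inverse_at_top_right] by (simp add: divide_inverse)
qed

lemma flat_exp_has_derivative:
  "(flat_exp P has_real_derivative flat_exp ([:0, 0, 1:] * (P - pderiv P)) s) (at s)"
proof -
  consider "s > 0" | "s < 0" | "s = 0" by linarith
  then show ?thesis
  proof cases
    case 1
    have "((\<lambda>s. poly P (1 / s) * exp (- (1 / s))) has_real_derivative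
        flat_exp ([:0, 0, 1:] * (P - pderiv P)) s) (at s)"
      using 1 by (auto intro!: derivative_eq_intros poly_DERIV[THEN DERIV_chain2]
          simp: flat_exp_def field_simps power2_eq_square)
    then show ?thesis
      by (rule has_field_derivative_transform_within_open[of _ _ _ "{0<..}"])
        (use 1 in \<open>auto simp: flat_exp_def\<close>)
  next
    case 2
    have "((\<lambda>s. 0) has_real_derivative flat_exp ([:0, 0, 1:] * (P - pderiv P)) s) (at s)"
      using 2 by (simp add: flat_exp_def)
    then show ?thesis
      by (rule has_field_derivative_transform_within_open[of _ _ _ "{..<0}"])
        (use 2 in \<open>auto simp: flat_exp_def\<close>)
  next
    case 3
    have "((\<lambda>h. flat_exp P h / h) \<longlongrightarrow> 0) (at_right 0)"
    proof (rule Lim_transform_eventually[OF flat_exp_tendsto_0[of "pCons 0 P"]])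
      show "\<forall>\<^sub>F s in at_right 0. poly (pCons 0 P) (1 / s) * exp (- (1 / s)) = flat_exp P s / s"
        using eventually_at_right_less[of 0] by eventually_elim (simp add: flat_exp_def)
    qed
    moreover have "((\<lambda>h. flat_exp P h / h) \<longlongrightarrow> 0) (at_left 0)"
      by (rule tendsto_eventually)
        (auto simp: eventually_at_filter flat_exp_def)
    ultimately have "((\<lambda>h. flat_exp P h / h) \<longlongrightarrow> 0) (at 0)"
      by (simp add: filterlim_split_at)
    then show ?thesis
      using 3 by (simp add: DERIV_def) (simp add: flat_exp_def)
  qed
qed

lemma C_k_flat_exp:
  assumes "\<And>k. C_k k q"
  shows "C_k k (\<lambda>x. flat_exp 1 (q x))"
proof -
  define \<psi> where "\<psi> n = flat_exp (((\<lambda>P. [:0, 0, 1:] * (P - pderiv P)) ^^ n) 1)" for n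
  have "C_k k (\<lambda>x. \<psi> 0 (q x))"
  proof (rule C_k_compose[OF _ assms])
    show "(\<psi> n has_real_derivative \<psi> (Suc n) s) (at s)" for n s
      unfolding \<psi>_def funpow.simps o_apply by (rule flat_exp_has_derivative)
  qed
  then show ?thesis by (simp add: \<psi>_def)
qed

text \<open>The parameter \<open>n\<close> sharpens the bump: as it grows, the bump tends to the indicator of the open box.\<close>

definition bump :: "real^2 \<Rightarrow> real^2 \<Rightarrow> real \<Rightarrow> real^2 \<Rightarrow> real" where
  "bump a b n y = (\<Prod>j\<in>UNIV. flat_exp 1 (n * ((y $ j - a $ j) * (b $ j - y $ j))))"

lemma flat_exp_one_bounds: "0 \<le> flat_exp 1 s" "flat_exp 1 s \<le> 1" "s > 0 \<Longrightarrow> 0 < flat_exp 1 s" "s \<le> 0 \<Longrightarrow> flat_exp 1 s = 0"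
  by (auto simp: flat_exp_def)

lemma bump_nonneg: "0 \<le> bump a b n y"
  unfolding bump_def by (intro prod_nonneg) (auto simp: flat_exp_one_bounds)

lemma bump_le_1: "bump a b n y \<le> 1"
  unfolding bump_def by (intro prod_le_1) (auto simp: flat_exp_one_bounds)

lemma bump_pos: "n > 0 \<Longrightarrow> y \<in> box a b \<Longrightarrow> 0 < bump a b n y"
  unfolding bump_def by (intro prod_pos flat_exp_one_bounds) (auto simp: mem_box_cart)

lemma bump_eq_0:
  assumes "n > 0" "box a b \<noteq> {}" "y \<notin> box a b"
  shows "bump a b n y = 0"
proof -
  obtain j where j: "\<not> (a $ j < y $ j \<and> y $ j < b $ j)"
    using assms by (auto simp: mem_box_cart)
  have "a $ j < b $ j" using assms(2) by (auto simp: interval_ne_empty_cart)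
  then have "(y $ j - a $ j) * (b $ j - y $ j) \<le> 0"
    using j by (auto simp: mult_le_0_iff)
  then have "flat_exp 1 (n * ((y $ j - a $ j) * (b $ j - y $ j))) = 0"
    using assms(1) by (auto intro!: flat_exp_one_bounds(4) simp: mult_le_0_iff zero_le_mult_iff)
  then show ?thesis unfolding bump_def by (intro prod_zero) auto
qed

lemma C_k_bump: "C_k k (bump a b n)"
proof -
  have "C_k k (\<lambda>x. flat_exp 1 (n * ((x $ j + (- (a $ j))) * (b $ j + (-1) * x $ j))))" for j k
    by (intro C_k_flat_exp C_k_mult C_k_add C_k_const C_k_coord)
  then have "C_k k (\<lambda>x. flat_exp 1 (n * ((x $ 1 + (- (a $ 1))) * (b $ 1 + (-1) * x $ 1))) *
       flat_exp 1 (n * ((x $ 2 + (- (a $ 2))) * (b $ 2 + (-1) * x $ 2))))"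
    by (intro C_k_mult)
  moreover have "bump a b n = (\<lambda>x. flat_exp 1 (n * ((x $ 1 + (- (a $ 1))) * (b $ 1 + (-1) * x $ 1))) *
       flat_exp 1 (n * ((x $ 2 + (- (a $ 2))) * (b $ 2 + (-1) * x $ 2))))"
    by (simp add: bump_def fun_eq_iff UNIV_2)
  ultimately show ?thesis by simp
qed

lemma bump_test_function:
  assumes "n > 0" "box a b \<noteq> {}" "cbox a b \<subseteq> \<Omega>"
  shows "bump a b n \<in> test_functions \<Omega>"
proof -
  have "\<forall>x. x \<notin> cbox a b \<longrightarrow> bump a b n x = 0"
    using bump_eq_0[OF assms(1,2)] box_subset_cbox by blast
  then show ?thesis
    unfolding test_functions_def mem_Collect_eq
    by (intro conjI allI exI[of _ "cbox a b"]) (simp_all add: C_k_bump assms(3) compact_cbox)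
qed

lemma bump_tendsto_indicator:
  assumes "box a b \<noteq> {}"
  shows "(\<lambda>n. bump a b (real (Suc n)) y) \<longlonglongrightarrow> indicator (box a b) y"
proof (cases "y \<in> box a b")
  case False
  then show ?thesis using bump_eq_0[OF _ assms] by simp
next
  case True
  have *: "(\<lambda>n. flat_exp 1 (real (Suc n) * q)) \<longlonglongrightarrow> 1" if "q > 0" for q :: real
  proof -
    have "(\<lambda>n. exp (- (inverse (real (Suc n)) * (1 / q)))) \<longlonglongrightarrow> exp (- (0 * (1 / q)))"
      by (intro tendsto_intros LIMSEQ_inverse_real_of_nat)
    then show ?thesis using that by (simp add: flat_exp_def divide_inverse mult.commute add_pos_nonneg)
  qed
  have "(\<lambda>n. bump a b (real (Suc n)) y) \<longlonglongrightarrow> (\<Prod>j\<in>(UNIV::2 set). 1)"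
    unfolding bump_def by (intro tendsto_prod *) (use True in \<open>auto simp: mem_box_cart\<close>)
  then show ?thesis using True by simp
qed

section \<open>Uniqueness of weak differentials\<close>

lemma bump_borel: "bump a b n \<in> borel_measurable borel"
proof -
  have "continuous_on UNIV (bump a b n)" using C_k_bump[of 0] by simp
  then show ?thesis by (rule borel_measurable_continuous_onI)
qed

text \<open>Fundamental lemma of the calculus of variations.\<close>
text \<open>The bumps are bounded by \<open>1\<close>, so dominated convergence carries the vanishing of the weak
  pairings over to their limit, the indicator of the box.\<close>

lemma integral_box_eq_0_if_weakly_0:
  fixes f :: "real^2 \<Rightarrow> real"
  assumes int: "set_integrable lebesgue (cbox a b) f" and sub: "cbox a b \<subseteq> \<Omega>"
    and ne: "box a b \<noteq> {}" and \<Omega>: "\<Omega> \<in> sets lebesgue"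
    and weak: "\<And>\<phi>. \<phi> \<in> test_functions \<Omega> \<Longrightarrow> (LINT x:\<Omega>|lebesgue. f x * \<phi> x) = 0"
  shows "(LINT x:box a b|lebesgue. f x) = 0"
proof -
  let ?g = "\<lambda>x. indicator (cbox a b) x *\<^sub>R f x"
  have g: "integrable lebesgue ?g" using int unfolding set_integrable_def .
  have "(\<lambda>n. LINT x|lebesgue. ?g x * bump a b (real (Suc n)) x) \<longlonglongrightarrow> (LINT x|lebesgue. ?g x * indicator (box a b) x)"
  proof (rule integral_dominated_convergence[where w = "\<lambda>x. norm (?g x)"])
    show "integrable lebesgue (\<lambda>x. norm (?g x))" using g by simp
    show "AE x in lebesgue. norm (?g x * bump a b (real (Suc n)) x) \<le> norm (?g x)" for n
      by (intro AE_I2) (auto simp: abs_mult bump_nonneg bump_le_1 mult_left_le indicator_def)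
    show "AE x in lebesgue. (\<lambda>n. ?g x * bump a b (real (Suc n)) x) \<longlonglongrightarrow> ?g x * indicator (box a b) x"
      by (intro AE_I2 tendsto_mult tendsto_const bump_tendsto_indicator ne)
    have [measurable]: "bump a b n \<in> borel_measurable lebesgue" for n
      by (rule measurable_completion[of "bump a b n" lborel borel]) (simp add: bump_borel)
    show "(\<lambda>x. ?g x * bump a b (real (Suc n)) x) \<in> borel_measurable lebesgue" for n
      using g by measurable
    have [measurable]: "box a b \<in> sets lebesgue" by simp
    show "(\<lambda>x. ?g x * indicator (box a b) x) \<in> borel_measurable lebesgue"
      using borel_measurable_integrable[OF g] by measurable
  qed
  moreover have "(LINT x|lebesgue. ?g x * bump a b (real (Suc n)) x) = 0" for n
  proof -
    have "(LINT x:\<Omega>|lebesgue. f x * bump a b (real (Suc n)) x) = 0"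
      by (intro weak bump_test_function ne sub) simp
    moreover have "indicator \<Omega> x *\<^sub>R (f x * bump a b (real (Suc n)) x) = ?g x * bump a b (real (Suc n)) x" for x
    proof (cases "x \<in> box a b")
      case True
      then have "x \<in> cbox a b" "x \<in> \<Omega>" using sub box_subset_cbox by blast+
      then show ?thesis by simp
    next
      case False
      then show ?thesis using bump_eq_0[OF _ ne] by simp
    qed
    ultimately show ?thesis unfolding set_lebesgue_integral_def by (simp only:)
  qed
  moreover have "?g x * indicator (box a b) x = indicator (box a b) x *\<^sub>R f x" for x
    using box_subset_cbox[of a b] by (auto simp: indicator_def)
  ultimately have "(\<lambda>n. 0) \<longlonglongrightarrow> (LINT x|lebesgue. indicator (box a b) x *\<^sub>R f x)"
    by (simp only:)
  then show ?thesis
    unfolding set_lebesgue_integral_def by (simp only: LIMSEQ_const_iff)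
qed

text \<open>Boxes generate the Borel sets and are closed under intersection; hence the integral over every
  Borel set vanishes. Passing to a Borel representative reduces the statement for Lebesgue
  measurable functions to that uniqueness principle.\<close>

lemma AE_0_if_integral_boxes_0:
  fixes g :: "real^2 \<Rightarrow> real"
  assumes g: "integrable lebesgue g"
    and box0: "\<And>a b. (LINT x:box a b|lebesgue. g x) = 0"
  shows "AE x in lebesgue. g x = 0"
proof -
  obtain g' where [measurable]: "g' \<in> borel_measurable lborel" and ae: "AE x in lborel. g x = g' x"
    using completion_ex_borel_measurable_real[OF borel_measurable_integrable[OF g]] by blast
  have ae': "AE x in lebesgue. g x = g' x" using ae AE_completion by blast
  have [measurable]: "g \<in> borel_measurable lebesgue" using g by simp
  have g'leb[measurable]: "g' \<in> borel_measurable lebesgue"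
    by (rule measurable_completion[OF \<open>g' \<in> borel_measurable lborel\<close>])
  have "integrable lebesgue g'"
    by (rule integrable_cong_AE_imp[OF g g'leb ae'])
  then have g': "integrable lborel g'" using integrable_completion[of g' lborel] by simp
  have eq: "(LINT x:S|lborel. g' x) = (LINT x:S|lebesgue. g x)" if S: "S \<in> sets borel" for S
  proof -
    have [measurable]: "S \<in> sets lborel" "S \<in> sets lebesgue" using S by auto
    have "(LINT x:S|lborel. g' x) = (LINT x:S|lebesgue. g' x)"
      unfolding set_lebesgue_integral_def by (subst integral_completion) auto
    also have "\<dots> = (LINT x:S|lebesgue. g x)"
      unfolding set_lebesgue_integral_def
      by (rule integral_cong_AE) (use ae' in \<open>auto elim: eventually_mono\<close>)
    finally show ?thesis .
  qed
  have intS: "set_integrable lborel S g'" if "S \<in> sets borel" for S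
    using g' that unfolding set_integrable_def by (intro integrable_mult_indicator) auto
  let ?E = "range (\<lambda>(a, b). box a b) :: (real^2) set set"
  have zero: "(LINT x:S|lborel. g' x) = 0" if "S \<in> sigma_sets UNIV ?E" for S
  proof (rule sigma_sets_induct_disjoint[of ?E UNIV S "\<lambda>S. (LINT x:S|lborel. g' x) = 0", OF _ _ that])
    show "Int_stable ?E" by (auto simp: Int_stable_def Int_interval[symmetric] box_Int_box)
    show "?E \<subseteq> Pow UNIV" by auto
    show "(LINT x:A|lborel. g' x) = 0" if "A \<in> ?E" for A
      using that box0 by (auto simp: eq)
    show "(LINT x:{}|lborel. g' x) = 0" by (simp add: set_lebesgue_integral_def)
    have UN0: "(LINT x:(\<Union>i. A i)|lborel. g' x) = 0"
      if dj: "disjoint_family A" and A: "range A \<subseteq> sets borel" and 0: "\<And>i::nat. (LINT x:A i|lborel. g' x) = 0" for A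
    proof -
      have "(LINT x:(\<Union>i. A i)|lborel. g' x) = (\<Sum>i. (LINT x:A i|lborel. g' x))"
        by (rule lebesgue_integral_countable_add) (use A dj intS[of "\<Union>i. A i"] in \<open>auto simp: disjoint_family_on_def\<close>)
      then show ?thesis using 0 by simp
    qed
    have sets: "sigma_sets UNIV ?E = sets borel" by (subst borel_eq_box) simp
    show "(LINT x:(\<Union>i. A i)|lborel. g' x) = 0"
      if "disjoint_family A" "range A \<subseteq> sigma_sets UNIV ?E" "\<And>i. (LINT x:A i|lborel. g' x) = 0" for A :: "nat \<Rightarrow> _"
      using UN0 that by (simp add: sets)
    have univ: "(LINT x:UNIV|lborel. g' x) = 0"
    proof -
      have One: "(One::real^2) \<bullet> i = 1" if "i \<in> Basis" for i
        using inner_sum_left_Basis[OF that, of "\<lambda>_. 1"] by simp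
      have "(\<lambda>n. LINT x:box (- (real n *\<^sub>R One)) (real n *\<^sub>R One)|lborel. g' x) \<longlonglongrightarrow> (LINT x:(\<Union>n. box (- (real n *\<^sub>R One)) (real n *\<^sub>R One))|lborel. g' x)"
        by (rule set_integral_cont_up)
          (auto simp: UN_box_eq_UNIV incseq_def intS subset_box One)
      then show ?thesis by (simp add: eq box0 UN_box_eq_UNIV LIMSEQ_const_iff)
    qed
    show "(LINT x:UNIV - A|lborel. g' x) = 0"
      if A: "A \<in> sigma_sets UNIV ?E" "(LINT x:A|lborel. g' x) = 0" for A
    proof -
      have [measurable]: "A \<in> sets borel" using A by (simp add: sets)
      have "(LINT x:A \<union> (UNIV - A)|lborel. g' x) = (LINT x:A|lborel. g' x) + (LINT x:UNIV - A|lborel. g' x)"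
        by (rule set_integral_Un) (auto intro!: intS)
      then show ?thesis using A univ by simp
    qed
  qed
  have sets: "sigma_sets UNIV ?E = sets borel" by (subst borel_eq_box) simp
  have "AE x in lborel. g' x = 0"
    by (rule density_unique_real[OF g', of "\<lambda>_. 0"])
      (use zero sets in \<open>auto simp: set_lebesgue_integral_def\<close>)
  then have "AE x in lebesgue. g' x = 0" using AE_completion by blast
  with ae' show ?thesis by eventually_elim simp
qed

text \<open>The fundamental lemma of the calculus of variations: an open set is a countable union of closed
  boxes, and on each of them the previous two lemmas apply.\<close>

lemma AE_0_if_weakly_0:
  fixes f :: "real^2 \<Rightarrow> real"
  assumes \<Omega>: "open \<Omega>" and f: "locally_integrable_on \<Omega> f"
    and weak: "\<And>\<phi>. \<phi> \<in> test_functions \<Omega> \<Longrightarrow> (LINT x:\<Omega>|lebesgue. f x * \<phi> x) = 0"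
  shows "AE x in lebesgue. x \<in> \<Omega> \<longrightarrow> f x = 0"
proof -
  have cb: "AE x in lebesgue. x \<in> cbox a b \<longrightarrow> f x = 0" if ab: "cbox a b \<subseteq> \<Omega>" for a b
  proof -
    have int: "set_integrable lebesgue (cbox a' b') f" if "cbox a' b' \<subseteq> \<Omega>" for a' b'
      using f that unfolding locally_integrable_on_def by (simp add: compact_cbox)
    have "AE x in lebesgue. indicator (box a b) x *\<^sub>R f x = 0"
    proof (rule AE_0_if_integral_boxes_0)
      show "integrable lebesgue (\<lambda>x. indicator (box a b) x *\<^sub>R f x)"
        using set_integrable_subset[OF int[OF ab]] box_subset_cbox[of a b] unfolding set_integrable_def by auto
      fix c d :: "real^2"
      obtain u v where uv: "box a b \<inter> box c d = box u v"
        using box_Int_box[of a b c d] by blast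
      have "(LINT x:box c d|lebesgue. indicator (box a b) x *\<^sub>R f x) = (LINT x:box u v|lebesgue. f x)"
        unfolding set_lebesgue_integral_def uv[symmetric]
        by (intro Bochner_Integration.integral_cong) (auto simp: indicator_def)
      also have "\<dots> = 0"
      proof (cases "box u v = {}")
        case False
        have "cbox u v \<subseteq> cbox a b"
          using uv False by (metis Int_lower1 closure_box closure_minimal closed_cbox box_subset_cbox order_trans)
        then have sub: "cbox u v \<subseteq> \<Omega>" using ab by blast
        have "\<Omega> \<in> sets lebesgue" using borel_open[OF \<Omega>] by auto
        then show ?thesis
          by (rule integral_box_eq_0_if_weakly_0[OF int[OF sub] sub False _ weak])
      qed (simp add: set_lebesgue_integral_def)
      finally show "(LINT x:box c d|lebesgue. indicator (box a b) x *\<^sub>R f x) = 0" .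
    qed
    moreover have "AE x in lebesgue. x \<notin> cbox a b - box a b"
      by (rule AE_not_in) (use negligible_frontier_interval negligible_iff_null_sets in blast)
    ultimately show ?thesis by eventually_elim (auto simp: indicator_def)
  qed
  obtain \<D> where \<D>: "countable \<D>" "\<D> \<subseteq> Pow \<Omega>" "\<And>X. X \<in> \<D> \<Longrightarrow> \<exists>a b. X = cbox a b" "\<Union>\<D> = \<Omega>"
    using open_countable_Union_open_cbox[OF \<Omega>] by metis
  have "AE x in lebesgue. \<forall>X\<in>\<D>. x \<in> X \<longrightarrow> f x = 0"
    unfolding AE_ball_countable[OF \<D>(1)]
  proof
    fix X assume X: "X \<in> \<D>"
    then obtain a b where "X = cbox a b" using \<D>(3) by blast
    moreover have "X \<subseteq> \<Omega>" using X \<D>(2) by blast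
    ultimately show "AE x in lebesgue. x \<in> X \<longrightarrow> f x = 0" using cb by simp
  qed
  then show ?thesis by eventually_elim (use \<D>(4) in auto)
qed

lemma test_function_continuous: "\<phi> \<in> test_functions \<Omega> \<Longrightarrow> continuous_on UNIV \<phi>"
  unfolding test_functions_def mem_Collect_eq by (metis C_k.simps(1))

lemma test_function_support:
  assumes "\<phi> \<in> test_functions \<Omega>"
  obtains K where "compact K" "K \<subseteq> \<Omega>" "\<And>x. x \<notin> K \<Longrightarrow> \<phi> x = 0"
  using assms unfolding test_functions_def by blast

lemma set_integrable_times_continuous_compact_support:
  fixes f :: "real^2 \<Rightarrow> real"
  assumes f: "locally_integrable_on \<Omega> f" and \<phi>: "continuous_on UNIV \<phi>"
    and K: "compact K" "K \<subseteq> \<Omega>" "\<And>x. x \<notin> K \<Longrightarrow> \<phi> x = 0"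
  shows "set_integrable lebesgue \<Omega> (\<lambda>x. f x * \<phi> x)"
proof -
  obtain B where B: "\<And>x. x \<in> K \<Longrightarrow> norm (\<phi> x) \<le> B"
    using compact_continuous_image[OF continuous_on_subset[OF \<phi> subset_UNIV] K(1)]
    by (metis bounded_iff compact_imp_bounded imageI)
  have fK: "integrable lebesgue (\<lambda>x. indicator K x *\<^sub>R f x)"
    using f K unfolding locally_integrable_on_def set_integrable_def by blast
  have [measurable]: "\<phi> \<in> borel_measurable lebesgue"
    by (rule measurable_completion[of \<phi> lborel borel]) (simp add: borel_measurable_continuous_onI \<phi>)
  have "integrable lebesgue (\<lambda>x. (indicator K x *\<^sub>R f x) * \<phi> x)"
  proof (rule Bochner_Integration.integrable_bound[OF integrable_mult_right[OF fK, of B]])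
    show "(\<lambda>x. (indicator K x *\<^sub>R f x) * \<phi> x) \<in> borel_measurable lebesgue"
      using borel_measurable_integrable[OF fK] by measurable
    have "norm ((indicator K x *\<^sub>R f x) * \<phi> x) \<le> norm (B * (indicator K x *\<^sub>R f x))" for x
    proof (cases "x \<in> K")
      case True
      have "\<bar>\<phi> x\<bar> \<le> \<bar>B\<bar>" using B[OF True] by simp
      then show ?thesis using True by (simp add: abs_mult mult.commute mult_right_mono)
    qed simp
    then show "AE x in lebesgue. norm ((indicator K x *\<^sub>R f x) * \<phi> x) \<le> norm (B * (indicator K x *\<^sub>R f x))"
      by (intro AE_I2) blast
  qed
  moreover have "(indicator K x *\<^sub>R f x) * \<phi> x = indicator \<Omega> x *\<^sub>R (f x * \<phi> x)" for x
    using K(2,3) by (cases "x \<in> K") auto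
  ultimately show ?thesis unfolding set_integrable_def by (simp only:)
qed

lemma locally_integrable_on_component:
  fixes E :: "real^2 \<Rightarrow> real^2^2"
  assumes "locally_integrable_on \<Omega> E"
  shows "locally_integrable_on \<Omega> (\<lambda>x. E x $ i $ j)"
  unfolding locally_integrable_on_def
proof (intro allI impI)
  fix K assume "compact K \<and> K \<subseteq> \<Omega>"
  then have "integrable lebesgue (\<lambda>x. indicator K x *\<^sub>R E x)"
    using assms unfolding locally_integrable_on_def set_integrable_def by blast
  then have "integrable lebesgue (\<lambda>x. (indicator K x *\<^sub>R E x) $ i $ j)"
    by (intro integrable_bounded_linear[OF bounded_linear_vec_nth])
  then show "set_integrable lebesgue K (\<lambda>x. E x $ i $ j)"
    unfolding set_integrable_def by simp
qed

text \<open>Uniqueness makes the energy computable from any weak differential at hand, whereas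
  \<open>weak_differential\<close> is only given by a choice operator.\<close>

lemma weak_differential_unique:
  assumes \<Omega>: "open \<Omega>" and D: "has_weak_differential \<Omega> h D" "has_weak_differential \<Omega> h D'"
  shows "AE x in lebesgue. x \<in> \<Omega> \<longrightarrow> D x = D' x"
proof -
  have li: "locally_integrable_on \<Omega> (\<lambda>x. D x $ i $ j)" "locally_integrable_on \<Omega> (\<lambda>x. D' x $ i $ j)" for i j
    using D unfolding has_weak_differential_def by (auto intro: locally_integrable_on_component)
  have "AE x in lebesgue. x \<in> \<Omega> \<longrightarrow> D x $ i $ j - D' x $ i $ j = 0" for i j
  proof (rule AE_0_if_weakly_0[OF \<Omega>])
    show "locally_integrable_on \<Omega> (\<lambda>x. D x $ i $ j - D' x $ i $ j)"
      using li[of i j] unfolding locally_integrable_on_def by (auto intro: set_integral_diff)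
    fix \<phi> assume \<phi>: "\<phi> \<in> test_functions \<Omega>"
    obtain K where K: "compact K" "K \<subseteq> \<Omega>" "\<And>x. x \<notin> K \<Longrightarrow> \<phi> x = 0"
      using test_function_support[OF \<phi>] by blast
    note int = set_integrable_times_continuous_compact_support[OF _ test_function_continuous[OF \<phi>] K]
    have eq: "(LINT x:\<Omega>|lebesgue. D x $ i $ j * \<phi> x) = (LINT x:\<Omega>|lebesgue. D' x $ i $ j * \<phi> x)"
    proof -
      have "(LINT x:\<Omega>|lebesgue. h x $ i * partial_deriv j \<phi> x) = - (LINT x:\<Omega>|lebesgue. E x $ i $ j * \<phi> x)"
        if "has_weak_differential \<Omega> h E" for E
        using that \<phi> unfolding has_weak_differential_def by blast
      from this[OF D(1)] this[OF D(2)] show ?thesis by simp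
    qed
    have "(LINT x:\<Omega>|lebesgue. (D x $ i $ j - D' x $ i $ j) * \<phi> x) =
        (LINT x:\<Omega>|lebesgue. D x $ i $ j * \<phi> x) - (LINT x:\<Omega>|lebesgue. D' x $ i $ j * \<phi> x)"
      using set_integral_diff(2)[OF int[OF li(1)] int[OF li(2)]] by (simp add: left_diff_distrib)
    then show "(LINT x:\<Omega>|lebesgue. (D x $ i $ j - D' x $ i $ j) * \<phi> x) = 0"
      using eq by simp
  qed
  then have "AE x in lebesgue. \<forall>i\<in>UNIV. \<forall>j\<in>UNIV. x \<in> \<Omega> \<longrightarrow> D x $ i $ j - D' x $ i $ j = 0"
    by (intro AE_finite_allI finite)
  then show ?thesis by eventually_elim (simp add: vec_eq_iff)
qed

section \<open>Weak differentials of locally Lipschitz maps\<close>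

lemma lborel_integral_translate:
  fixes u :: "real^2 \<Rightarrow> real"
  assumes "integrable lborel u"
  shows "integrable lborel (\<lambda>x. u (c + x))" "(LINT x|lborel. u (c + x)) = (LINT x|lborel. u x)"
proof -
  have m: "(+) c \<in> borel_measurable lborel" "u \<in> borel_measurable borel"
    using borel_measurable_integrable[OF assms] by simp_all
  show "integrable lborel (\<lambda>x. u (c + x))"
    using integrable_distr[OF m(1), of u] assms by (simp add: lborel_distr_plus)
  show "(LINT x|lborel. u (c + x)) = (LINT x|lborel. u x)"
    using integral_distr[OF m] by (simp add: lborel_distr_plus)
qed

text \<open>Translation invariance of Lebesgue measure makes the integral of every difference quotient vanish;
  the quotients are bounded with supports in a common ball, so dominated convergence applies.\<close>

lemma integral_derivative_eq_0:
  fixes u w :: "real^2 \<Rightarrow> real"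
  assumes lip: "\<And>x y. norm (x - y) \<le> \<delta> \<Longrightarrow> \<bar>u x - u y\<bar> \<le> L * norm (x - y)" and "\<delta> > 0"
    and cont: "continuous_on UNIV u"
    and K: "compact K" "\<And>x. x \<notin> K \<Longrightarrow> u x = 0"
    and w: "w \<in> borel_measurable lebesgue"
    and deriv: "AE x in lebesgue. ((\<lambda>t. u (t *\<^sub>R e + x)) has_real_derivative w x) (at 0)"
    and e: "norm e = 1"
  shows "(LINT x|lebesgue. w x) = 0"
proof -
  obtain B where B: "\<And>x. x \<in> K \<Longrightarrow> norm x \<le> B"
    using compact_imp_bounded[OF K(1)] bounded_iff by blast
  have [measurable]: "u \<in> borel_measurable borel"
    using cont by (rule borel_measurable_continuous_onI)
  have "integrable lborel (\<lambda>x. indicator K x *\<^sub>R u x)"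
    by (intro borel_integrable_compact K continuous_on_subset[OF cont]) simp
  moreover have "indicator K x *\<^sub>R u x = u x" for x
    using K(2)[of x] by (cases "x \<in> K") auto
  ultimately have u: "integrable lborel u" by (simp only:)
  define t where "t n = min \<delta> 1 / real (Suc n)" for n
  have t: "0 < t n" "t n \<le> \<delta>" "t n \<le> 1" for n
  proof -
    show "0 < t n" using \<open>\<delta> > 0\<close> by (simp add: t_def)
    have "min \<delta> 1 / real (Suc n) \<le> min \<delta> 1 / 1"
      using \<open>\<delta> > 0\<close> by (intro divide_left_mono) auto
    then have "t n \<le> min \<delta> 1" by (simp add: t_def)
    then show "t n \<le> \<delta>" "t n \<le> 1" by auto
  qed
  have t0: "t \<longlonglongrightarrow> 0"
    using LIMSEQ_Suc[OF lim_const_over_n[of "min \<delta> 1"]] unfolding t_def .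
  define q where "q n x = (u (t n *\<^sub>R e + x) - u x) / t n" for n x
  have q_meas: "q n \<in> borel_measurable lborel" for n
    unfolding q_def by measurable
  have "(\<lambda>n. LINT x|lebesgue. q n x) \<longlonglongrightarrow> (LINT x|lebesgue. w x)"
  proof (rule integral_dominated_convergence[where w = "\<lambda>x. indicator (cball 0 (B + 1)) x *\<^sub>R \<bar>L\<bar>"])
    show "w \<in> borel_measurable lebesgue" by fact
    show "q n \<in> borel_measurable lebesgue" for n
      by (rule measurable_completion[OF q_meas])
    have "integrable lborel (\<lambda>x::real^2. indicator (cball 0 (B + 1)) x *\<^sub>R \<bar>L\<bar>)"
      by (intro borel_integrable_compact continuous_on_const compact_cball)
    then show "integrable lebesgue (\<lambda>x::real^2. indicator (cball 0 (B + 1)) x *\<^sub>R \<bar>L\<bar>)"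
      by (subst integrable_completion) auto
    show "AE x in lebesgue. norm (q n x) \<le> indicator (cball 0 (B + 1)) x *\<^sub>R \<bar>L\<bar>" for n
    proof (rule AE_I2)
      fix x :: "real^2"
      show "norm (q n x) \<le> indicator (cball 0 (B + 1)) x *\<^sub>R \<bar>L\<bar>"
      proof (cases "norm x \<le> B + 1")
        case True
        have "\<bar>u (t n *\<^sub>R e + x) - u x\<bar> \<le> L * t n"
          using lip[of "t n *\<^sub>R e + x" x] t[of n] e by simp
        also have "\<dots> \<le> \<bar>L\<bar> * t n"
          using t[of n] by (intro mult_right_mono) auto
        finally show ?thesis
          using True t[of n] by (simp add: q_def divide_le_eq)
      next
        case False
        have "norm x \<le> norm (t n *\<^sub>R e + x) + t n"
          using norm_triangle_ineq4[of "t n *\<^sub>R e + x" "t n *\<^sub>R e"] e t[of n] by simp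
        then have "t n *\<^sub>R e + x \<notin> K" "x \<notin> K"
          using False B t(3)[of n] by force+
        then show ?thesis using K(2) by (simp add: q_def)
      qed
    qed
    show "AE x in lebesgue. (\<lambda>n. q n x) \<longlonglongrightarrow> w x"
      using deriv
    proof eventually_elim
      case (elim x)
      then have "((\<lambda>h. (u (h *\<^sub>R e + x) - u x) / h) \<longlongrightarrow> w x) (at 0)"
        by (simp add: DERIV_def)
      moreover have "filterlim t (at 0) sequentially"
        using t0 t(1) by (auto simp: filterlim_at intro!: eventuallyI) (metis less_irrefl)
      ultimately show ?case
        unfolding q_def by (rule filterlim_compose)
    qed
  qed
  moreover have "(LINT x|lebesgue. q n x) = 0" for n
  proof -
    have "(LINT x|lebesgue. q n x) = (LINT x|lborel. q n x)"
      by (rule integral_completion[OF q_meas])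
    also have "\<dots> = ((LINT x|lborel. u (t n *\<^sub>R e + x)) - (LINT x|lborel. u x)) / t n"
      unfolding q_def using u lborel_integral_translate(1)[OF u] by simp
    finally show ?thesis using lborel_integral_translate(2)[OF u] by simp
  qed
  ultimately show ?thesis by (simp add: LIMSEQ_const_iff)
qed

lemma partial_deriv_test_function:
  assumes \<phi>: "\<phi> \<in> test_functions \<Omega>"
  shows "\<phi> differentiable (at x)"
    and "continuous_on UNIV (partial_deriv j \<phi>)"
    and "(\<phi> has_derivative (\<lambda>v. \<Sum>j\<in>UNIV. v $ j * partial_deriv j \<phi> x)) (at x)"
    and "compact K \<Longrightarrow> (\<And>x. x \<notin> K \<Longrightarrow> \<phi> x = 0) \<Longrightarrow> y \<notin> K \<Longrightarrow> partial_deriv j \<phi> y = 0"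
proof -
  have "C_k 1 \<phi>" using \<phi> unfolding test_functions_def by blast
  then show d: "\<phi> differentiable (at x)" and "continuous_on UNIV (partial_deriv j \<phi>)" for x j by auto
  obtain f where f: "(\<phi> has_derivative f) (at x)" using d by (auto simp: differentiable_def)
  have "f v = (\<Sum>j\<in>UNIV. v $ j * partial_deriv j \<phi> x)" for v
  proof -
    have "f v = f (\<Sum>j\<in>UNIV. v $ j *s axis j 1)" by (simp add: basis_expansion)
    also have "\<dots> = (\<Sum>j\<in>UNIV. v $ j * f (axis j 1))"
      using has_derivative_linear[OF f] by (simp add: linear_sum linear_cmul scalar_mult_eq_scaleR)
    finally show ?thesis using partial_deriv_eq[OF f] by simp
  qed
  then have "f = (\<lambda>v. \<Sum>j\<in>UNIV. v $ j * partial_deriv j \<phi> x)" by blast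
  with f show "(\<phi> has_derivative (\<lambda>v. \<Sum>j\<in>UNIV. v $ j * partial_deriv j \<phi> x)) (at x)" by simp
  show "partial_deriv j \<phi> y = 0" if K: "compact K" "\<And>x. x \<notin> K \<Longrightarrow> \<phi> x = 0" "y \<notin> K" for y j
  proof -
    have "(\<phi> has_derivative (\<lambda>_. 0)) (at y)"
      by (rule has_derivative_transform_within_open[of "\<lambda>_. 0" _ _ _ "- K"])
        (use K compact_imp_closed in auto)
    then show ?thesis by (simp add: partial_deriv_eq)
  qed
qed

lemma test_function_lipschitz:
  assumes \<phi>: "\<phi> \<in> test_functions \<Omega>"
  obtains M where "0 \<le> M" "\<And>x y. \<bar>\<phi> x - \<phi> y\<bar> \<le> M * norm (x - y)" "\<And>x. \<bar>\<phi> x\<bar> \<le> M"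
proof -
  obtain K where K: "compact K" "\<And>x. x \<notin> K \<Longrightarrow> \<phi> x = 0"
    using test_function_support[OF \<phi>] by metis
  have bdd: "\<exists>B. \<forall>x. \<bar>f x\<bar> \<le> B" if "continuous_on UNIV f" "\<And>x. x \<notin> K \<Longrightarrow> f x = 0" for f :: "real^2 \<Rightarrow> real"
  proof -
    have "bounded (f ` K)"
      by (intro compact_imp_bounded compact_continuous_image continuous_on_subset[OF that(1)] K) simp
    then obtain B where "\<forall>x\<in>K. \<bar>f x\<bar> \<le> B" by (auto simp: bounded_iff)
    then have "\<bar>f x\<bar> \<le> max B 0" for x using that(2)[of x] by (cases "x \<in> K") force+
    then show ?thesis by blast
  qed
  obtain B0 where B0: "\<And>x. \<bar>\<phi> x\<bar> \<le> B0"
    using bdd[OF test_function_continuous[OF \<phi>]] K by blast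
  have "\<exists>B. \<forall>x. \<bar>partial_deriv j \<phi> x\<bar> \<le> B" for j
    by (rule bdd) (use partial_deriv_test_function[OF \<phi>] K in auto)
  then obtain B where B: "\<And>j x. \<bar>partial_deriv j \<phi> x\<bar> \<le> B j" by metis
  have B_nonneg: "0 \<le> B j" for j using B[of j 0] by linarith
  have "\<bar>\<phi> x - \<phi> y\<bar> \<le> (\<Sum>j\<in>UNIV. B j) * norm (x - y)" for x y
  proof -
    have "norm (\<phi> x - \<phi> y) \<le> (\<Sum>j\<in>UNIV. B j) * norm (x - y)"
    proof (rule differentiable_bound[OF convex_UNIV])
      show "(\<phi> has_derivative (\<lambda>v. \<Sum>j\<in>UNIV. v $ j * partial_deriv j \<phi> x)) (at x within UNIV)" for x
        using partial_deriv_test_function(3)[OF \<phi>] by simp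
      show "onorm (\<lambda>v. \<Sum>j\<in>UNIV. v $ j * partial_deriv j \<phi> x) \<le> (\<Sum>j\<in>UNIV. B j)" for x
      proof (rule onorm_le)
        fix v :: "real^2"
        have "norm (\<Sum>j\<in>UNIV. v $ j * partial_deriv j \<phi> x) \<le> (\<Sum>j\<in>UNIV. \<bar>v $ j\<bar> * \<bar>partial_deriv j \<phi> x\<bar>)"
          by (rule order_trans[OF norm_sum]) (simp add: abs_mult)
        also have "\<dots> \<le> (\<Sum>j\<in>UNIV. norm v * B j)"
          by (intro sum_mono mult_mono component_le_norm_cart B) auto
        finally show "norm (\<Sum>j\<in>UNIV. v $ j * partial_deriv j \<phi> x) \<le> (\<Sum>j\<in>UNIV. B j) * norm v"
          by (simp add: sum_distrib_left mult.commute)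
      qed
    qed auto
    then show ?thesis by simp
  qed
  moreover have "(\<Sum>j\<in>UNIV. B j) * norm (x - y) \<le> max B0 (\<Sum>j\<in>UNIV. B j) * norm (x - y)" for x y :: "real^2"
    by (intro mult_right_mono) auto
  ultimately have "\<bar>\<phi> x - \<phi> y\<bar> \<le> max B0 (\<Sum>j\<in>UNIV. B j) * norm (x - y)" for x y
    using order_trans by blast
  moreover have "\<bar>\<phi> x\<bar> \<le> max B0 (\<Sum>j\<in>UNIV. B j)" for x using B0[of x] by simp
  moreover have "0 \<le> max B0 (\<Sum>j\<in>UNIV. B j)" using B0[of 0] by linarith
  ultimately show ?thesis using that by blast
qed

text \<open>The previous integral identity is applied to the product of a component of \<open>h\<close> with the test
  function: it is Lipschitz at small distances, and the product rule gives its derivative at almost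
  every point.\<close>

lemma has_weak_differential_if_locally_lipschitz:
  fixes h :: "real^2 \<Rightarrow> real^2" and D :: "real^2 \<Rightarrow> real^2^2"
  assumes \<Omega>: "open \<Omega>"
    and lip: "\<And>K. compact K \<Longrightarrow> K \<subseteq> \<Omega> \<Longrightarrow>
        \<exists>\<delta>>0. \<exists>L\<ge>0. \<forall>x\<in>K. \<forall>y. norm (y - x) \<le> \<delta> \<longrightarrow> norm (h y - h x) \<le> L * norm (y - x)"
    and deriv: "AE x in lebesgue. x \<in> \<Omega> \<longrightarrow> (h has_derivative (\<lambda>v. D x *v v)) (at x)"
    and D_meas: "(\<lambda>x. indicator \<Omega> x *\<^sub>R D x) \<in> borel_measurable lebesgue"
    and D_bdd: "\<And>K. compact K \<Longrightarrow> K \<subseteq> \<Omega> \<Longrightarrow> \<exists>B. \<forall>x\<in>K. norm (D x) \<le> B"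
  shows "has_weak_differential \<Omega> h D"
  unfolding has_weak_differential_def
proof (intro conjI ballI allI)
  have cont: "continuous_on \<Omega> h"
  proof (clarsimp simp: continuous_on_eq_continuous_at[OF \<Omega>])
    fix x assume x: "x \<in> \<Omega>"
    obtain \<delta> L where \<delta>: "\<delta> > 0" "L \<ge> 0" "\<And>y. norm (y - x) \<le> \<delta> \<Longrightarrow> norm (h y - h x) \<le> L * norm (y - x)"
      using lip[of "{x}"] x by auto
    have "((\<lambda>y. h y - h x) \<longlongrightarrow> 0) (at x)"
    proof (rule Lim_null_comparison)
      have "\<forall>\<^sub>F y in at x. dist y x < \<delta>" using \<delta>(1) eventually_at by blast
      then show "\<forall>\<^sub>F y in at x. norm (h y - h x) \<le> L * norm (y - x)"
        by eventually_elim (simp add: \<delta>(3) dist_norm)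
      show "((\<lambda>y. L * norm (y - x)) \<longlongrightarrow> 0) (at x)" by (auto intro!: tendsto_eq_intros)
    qed
    then show "isCont h x" by (simp add: isCont_def LIM_zero_cancel)
  qed
  show hli: "locally_integrable_on \<Omega> h"
    unfolding locally_integrable_on_def set_integrable_def
  proof (intro allI impI)
    fix K assume K: "compact K \<and> K \<subseteq> \<Omega>"
    then have "integrable lborel (\<lambda>x. indicator K x *\<^sub>R h x)"
      by (intro borel_integrable_compact continuous_on_subset[OF cont]) auto
    then show "integrable lebesgue (\<lambda>x. indicator K x *\<^sub>R h x)"
      by (subst integrable_completion) auto
  qed
  show Dli: "locally_integrable_on \<Omega> D"
    unfolding locally_integrable_on_def set_integrable_def
  proof (intro allI impI)
    fix K assume K: "compact K \<and> K \<subseteq> \<Omega>"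
    then obtain B where B: "\<forall>x\<in>K. norm (D x) \<le> B" using D_bdd by blast
    have "integrable lborel (\<lambda>x. indicator K x *\<^sub>R B)"
      using K by (intro borel_integrable_compact) auto
    then have i: "integrable lebesgue (\<lambda>x. indicator K x *\<^sub>R B)"
      by (subst integrable_completion) auto
    have [measurable]: "K \<in> sets lebesgue" using K by (simp add: compact_imp_closed)
    have eq: "indicator K x *\<^sub>R (indicator \<Omega> x *\<^sub>R D x) = indicator K x *\<^sub>R D x" for x
      using K by (auto simp: indicator_def)
    show "integrable lebesgue (\<lambda>x. indicator K x *\<^sub>R D x)"
    proof (rule Bochner_Integration.integrable_bound[OF i])
      have "(\<lambda>x. indicator K x *\<^sub>R (indicator \<Omega> x *\<^sub>R D x)) \<in> borel_measurable lebesgue"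
        using D_meas by measurable
      then show "(\<lambda>x. indicator K x *\<^sub>R D x) \<in> borel_measurable lebesgue" by (simp only: eq)
      show "AE x in lebesgue. norm (indicator K x *\<^sub>R D x) \<le> norm (indicator K x *\<^sub>R B)"
        by (intro AE_I2) (use B in \<open>force simp: indicator_def\<close>)
    qed
  qed
  fix \<phi> i j assume \<phi>: "\<phi> \<in> test_functions \<Omega>"
  obtain K where K: "compact K" "K \<subseteq> \<Omega>" "\<And>x. x \<notin> K \<Longrightarrow> \<phi> x = 0"
    using test_function_support[OF \<phi>] by blast
  obtain M where M: "0 \<le> M" "\<And>x y. \<bar>\<phi> x - \<phi> y\<bar> \<le> M * norm (x - y)" "\<And>x. \<bar>\<phi> x\<bar> \<le> M"
    using test_function_lipschitz[OF \<phi>] by metis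
  obtain \<delta> L where \<delta>: "\<delta> > 0" "L \<ge> 0"
      "\<And>x y. x \<in> K \<Longrightarrow> norm (y - x) \<le> \<delta> \<Longrightarrow> norm (h y - h x) \<le> L * norm (y - x)"
    using lip[OF K(1,2)] by blast
  have "bounded (h ` K)"
    by (intro compact_imp_bounded compact_continuous_image continuous_on_subset[OF cont] K)
  then obtain A where A: "\<And>x. x \<in> K \<Longrightarrow> norm (h x) \<le> A" by (auto simp: bounded_iff)
  note dp = partial_deriv_test_function[OF \<phi>]
  note p0 = dp(4)[OF K(1,3)]
  define u where "u x = h x $ i * \<phi> x" for x
  define w where "w x = indicator \<Omega> x *\<^sub>R (h x $ i * partial_deriv j \<phi> x + D x $ i $ j * \<phi> x)" for x
  have int1: "set_integrable lebesgue \<Omega> (\<lambda>x. h x $ i * partial_deriv j \<phi> x)"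
  proof (rule set_integrable_times_continuous_compact_support[OF _ dp(2) K(1,2) p0])
    show "locally_integrable_on \<Omega> (\<lambda>x. h x $ i)"
      unfolding locally_integrable_on_def set_integrable_def
    proof (intro allI impI)
      fix K assume K: "compact K \<and> K \<subseteq> \<Omega>"
      then have "integrable lebesgue (\<lambda>x. (indicator K x *\<^sub>R h x) $ i)"
        using hli unfolding locally_integrable_on_def set_integrable_def
        by (intro integrable_bounded_linear[OF bounded_linear_vec_nth]) blast
      then show "integrable lebesgue (\<lambda>x. indicator K x *\<^sub>R h x $ i)" by simp
    qed
  qed
  have int2: "set_integrable lebesgue \<Omega> (\<lambda>x. D x $ i $ j * \<phi> x)"
    by (rule set_integrable_times_continuous_compact_support[OF locally_integrable_on_component[OF Dli]
        test_function_continuous[OF \<phi>] K])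
  have w_int: "integrable lebesgue w"
    using set_integral_add(1)[OF int1 int2] unfolding set_integrable_def w_def .
  have ulip1: "\<bar>u x - u y\<bar> \<le> ((A + L * \<delta>) * M + M * L) * norm (x - y)" if "norm (x - y) \<le> \<delta>" "x \<in> K" for x y
  proof -
    have hy: "norm (h y - h x) \<le> L * norm (x - y)"
      using \<delta>(3)[OF that(2), of y] that(1) by (simp add: norm_minus_commute)
    have "\<bar>h y $ i - h x $ i\<bar> \<le> L * norm (x - y)"
      using component_le_norm_cart[of "h y - h x" i] hy by simp
    moreover have "norm (h y) \<le> A + L * \<delta>"
    proof -
      have "norm (h y) \<le> norm (h x) + norm (h y - h x)" using norm_triangle_ineq[of "h x" "h y - h x"] by simp
      also have "\<dots> \<le> A + L * \<delta>"
        using A[OF that(2)] hy mult_left_mono[OF that(1) \<delta>(2)] by linarith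
      finally show ?thesis .
    qed
    then have "\<bar>h y $ i\<bar> \<le> A + L * \<delta>" using component_le_norm_cart[of "h y" i] by simp
    moreover have "u x - u y = h y $ i * (\<phi> x - \<phi> y) + \<phi> x * (h x $ i - h y $ i)"
      unfolding u_def by (simp add: algebra_simps)
    then have "\<bar>u x - u y\<bar> \<le> \<bar>h y $ i\<bar> * \<bar>\<phi> x - \<phi> y\<bar> + \<bar>\<phi> x\<bar> * \<bar>h x $ i - h y $ i\<bar>"
      by (metis abs_mult abs_triangle_ineq)
    ultimately have "\<bar>u x - u y\<bar> \<le> (A + L * \<delta>) * (M * norm (x - y)) + M * (L * norm (x - y))"
      using M by (smt (verit, best) mult_mono abs_ge_zero abs_minus_commute)
    then show ?thesis by (simp add: algebra_simps)
  qed
  have A_nonneg: "0 \<le> A" if "x \<in> K" for x using A[OF that] norm_ge_zero order_trans by blast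
  define L' where "L' = (A + L * \<delta>) * M + M * L"
  have ulip: "\<bar>u x - u y\<bar> \<le> \<bar>L'\<bar> * norm (x - y)" if "norm (x - y) \<le> \<delta>" for x y
  proof -
    have "\<bar>u x - u y\<bar> \<le> L' * norm (x - y)" if "x \<in> K \<or> y \<in> K"
      using ulip1[of x y] ulip1[of y x] that \<open>norm (x - y) \<le> \<delta>\<close> unfolding L'_def
      by (auto simp: norm_minus_commute abs_minus_commute)
    moreover have "u x = 0" "u y = 0" if "\<not> (x \<in> K \<or> y \<in> K)"
      using that K(3) by (auto simp: u_def)
    moreover have "L' * norm (x - y) \<le> \<bar>L'\<bar> * norm (x - y)" "0 \<le> \<bar>L'\<bar> * norm (x - y)"
      by (intro mult_right_mono mult_nonneg_nonneg; simp)+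
    ultimately show ?thesis by (cases "x \<in> K \<or> y \<in> K") auto
  qed
  have u_cont: "continuous_on UNIV u"
  proof (rule continuous_at_imp_continuous_on, rule ballI)
    fix x
    have "((\<lambda>y. u y - u x) \<longlongrightarrow> 0) (at x)"
    proof (rule Lim_null_comparison)
      have "\<forall>\<^sub>F y in at x. dist y x < \<delta>" using \<delta>(1) eventually_at by blast
      then show "\<forall>\<^sub>F y in at x. norm (u y - u x) \<le> \<bar>L'\<bar> * norm (y - x)"
        by eventually_elim (simp add: ulip dist_norm)
      show "((\<lambda>y. \<bar>L'\<bar> * norm (y - x)) \<longlongrightarrow> 0) (at x)" by (auto intro!: tendsto_eq_intros)
    qed
    then show "isCont u x" by (simp add: isCont_def LIM_zero_cancel)
  qed
  have "(LINT x|lebesgue. w x) = 0"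
  proof (rule integral_derivative_eq_0[OF ulip \<delta>(1) u_cont K(1)])
    show "u x = 0" if "x \<notin> K" for x using that K(3) by (simp add: u_def)
    show "w \<in> borel_measurable lebesgue" using w_int by simp
    show "norm (axis j 1 :: real^2) = 1" by simp
    show "AE x in lebesgue. ((\<lambda>t. u (t *\<^sub>R axis j 1 + x)) has_real_derivative w x) (at 0)"
      using deriv
    proof eventually_elim
      case (elim x)
      have line: "((\<lambda>t. t *\<^sub>R axis j 1 + x) has_derivative (\<lambda>t. t *\<^sub>R axis j 1)) (at (0::real))"
        by (auto intro!: derivative_eq_intros)
      show ?case
      proof (cases "x \<in> \<Omega>")
        case True
        have h': "((\<lambda>y. h y $ i) has_derivative (\<lambda>v. (D x *v v) $ i)) (at x)"
          using bounded_linear.has_derivative[OF bounded_linear_vec_nth elim[rule_format, OF True]] .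
        have "(u has_derivative (\<lambda>v. h x $ i * (\<Sum>j\<in>UNIV. v $ j * partial_deriv j \<phi> x) + (D x *v v) $ i * \<phi> x)) (at x)"
          unfolding u_def by (rule has_derivative_mult[OF h' dp(3)])
        then have "((\<lambda>t. u (t *\<^sub>R axis j 1 + x)) has_derivative
            (\<lambda>t. h x $ i * (\<Sum>k\<in>UNIV. (t *\<^sub>R axis j 1) $ k * partial_deriv k \<phi> x) + (D x *v (t *\<^sub>R axis j 1)) $ i * \<phi> x)) (at 0)"
          using has_derivative_compose[OF line, of u "\<lambda>v. h x $ i * (\<Sum>j\<in>UNIV. v $ j * partial_deriv j \<phi> x) + (D x *v v) $ i * \<phi> x"]
          by simp
        moreover have "h x $ i * (\<Sum>k\<in>UNIV. (t *\<^sub>R axis j 1) $ k * partial_deriv k \<phi> x) + (D x *v (t *\<^sub>R axis j 1)) $ i * \<phi> x = w x * t" for t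
        proof -
          have "(\<Sum>k\<in>UNIV. (t *\<^sub>R axis j 1) $ k * partial_deriv k \<phi> x) = t * partial_deriv j \<phi> x"
            by (simp add: axis_def if_distrib if_distribR cong: if_cong)
          moreover have "(D x *v (t *\<^sub>R axis j 1)) $ i = t * D x $ i $ j"
            by (simp add: matrix_vector_mult_def axis_def if_distrib if_distribR cong: if_cong)
          moreover have "w x = h x $ i * partial_deriv j \<phi> x + D x $ i $ j * \<phi> x"
            using True by (simp add: w_def)
          ultimately show ?thesis by (simp only: algebra_simps)
        qed
        ultimately show ?thesis unfolding has_field_derivative_def by simp
      next
        case False
        then have "x \<in> - K" using K(2) by blast
        moreover have "(u has_derivative (\<lambda>_. 0)) (at x)"
          by (rule has_derivative_transform_within_open[of "\<lambda>_. 0" _ _ _ "- K"])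
            (use K \<open>x \<in> - K\<close> compact_imp_closed in \<open>auto simp: u_def\<close>)
        then have "((\<lambda>t. u (t *\<^sub>R axis j 1 + x)) has_derivative (\<lambda>_. 0)) (at 0)"
          using has_derivative_compose[OF line, of u "\<lambda>_. 0"] by simp
        then show ?thesis using False by (simp add: has_field_derivative_def w_def lambda_zero)
      qed
    qed
  qed
  moreover have "(LINT x|lebesgue. w x) = (LINT x:\<Omega>|lebesgue. h x $ i * partial_deriv j \<phi> x) + (LINT x:\<Omega>|lebesgue. D x $ i $ j * \<phi> x)"
    using set_integral_add(2)[OF int1 int2] unfolding w_def set_lebesgue_integral_def .
  ultimately show "(LINT x:\<Omega>|lebesgue. h x $ i * partial_deriv j \<phi> x) = - (LINT x:\<Omega>|lebesgue. D x $ i $ j * \<phi> x)"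
    by simp
qed

section \<open>Monotone minorants on an interval\<close>

lemma countable_if_subsingleton: "(\<And>x y. x \<in> S \<Longrightarrow> y \<in> S \<Longrightarrow> x = y) \<Longrightarrow> countable S"
  by (metis countable_empty countable_insert_eq equals0I singletonI subsetI subset_singletonD insertI1 countable_subset)

text \<open>An interval of constancy has at most one left and one right endpoint, and it contains a rational
  number, which identifies it.\<close>

lemma countable_flat_endpoints:
  fixes G :: "real \<Rightarrow> real"
  assumes "mono G"
  shows "countable {x. (\<exists>t>x. G t = G x) \<and> (\<forall>s<x. G s < G x)}" (is "countable ?N1")
    and "countable {x. (\<exists>s<x. G s = G x) \<and> (\<forall>t>x. G x < G t)}" (is "countable ?N2")
proof -
  have "?N1 \<subseteq> (\<Union>q\<in>\<rat>. {x. x < q \<and> G q = G x \<and> (\<forall>s<x. G s < G x)})"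
  proof clarsimp
    fix x t assume xt: "x < t" "G t = G x"
    obtain q where "q \<in> \<rat>" "x < q" "q < t" using Rats_dense_in_real[OF xt(1)] by blast
    moreover then have "G q = G x" using xt monoD[OF assms, of x q] monoD[OF assms, of q t] by simp
    ultimately show "\<exists>q\<in>\<rat>. x < q \<and> G q = G x" by blast
  qed
  moreover have "countable {x. x < q \<and> G q = G x \<and> (\<forall>s<x. G s < G x)}" for q
    by (rule countable_if_subsingleton) (metis (mono_tags, lifting) less_irrefl linorder_neqE_linordered_idom mem_Collect_eq)
  ultimately show "countable ?N1" by (meson countable_UN countable_rat countable_subset)
  have "?N2 \<subseteq> (\<Union>q\<in>\<rat>. {x. q < x \<and> G q = G x \<and> (\<forall>t>x. G x < G t)})"
  proof clarsimp
    fix x s assume xs: "s < x" "G s = G x"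
    obtain q where "q \<in> \<rat>" "s < q" "q < x" using Rats_dense_in_real[OF xs(1)] by blast
    moreover then have "G q = G x" using xs monoD[OF assms, of s q] monoD[OF assms, of q x] by simp
    ultimately show "\<exists>q\<in>\<rat>. q < x \<and> G q = G x" by blast
  qed
  moreover have "countable {x. q < x \<and> G q = G x \<and> (\<forall>t>x. G x < G t)}" for q
    by (rule countable_if_subsingleton) (metis (mono_tags, lifting) less_irrefl linorder_neqE_linordered_idom mem_Collect_eq)
  ultimately show "countable ?N2" by (meson countable_UN countable_rat countable_subset)
qed

text \<open>The function \<open>G\<close> is the maximum of \<open>c\<close> and of the running infimum of \<open>H\<close> over \<open>{\<rho>..b}\<close>. A point
  that is not an endpoint of an interval of constancy of \<open>G\<close> is either interior to such an interval,
  where the derivative is \<open>0\<close>, or a point of strict increase. In the latter case the infimum is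
  attained at the point itself, and the graph of \<open>G\<close> is squeezed onto that of \<open>H\<close> to first
  order.\<close>

lemma monotone_minorant:
  fixes H H' :: "real \<Rightarrow> real"
  assumes ab: "a \<le> b"
    and deriv: "\<And>\<rho>. \<rho> \<in> {a..b} \<Longrightarrow> (H has_real_derivative H' \<rho>) (at \<rho>)"
    and lip: "\<And>\<rho>. \<rho> \<in> {a..b} \<Longrightarrow> \<bar>H' \<rho>\<bar> \<le> L"
  obtains G N where "mono G" "\<And>s t. \<bar>G s - G t\<bar> \<le> L * \<bar>s - t\<bar>"
    "\<And>\<rho>. \<rho> \<le> a \<Longrightarrow> G \<rho> = G a" "\<And>\<rho>. b \<le> \<rho> \<Longrightarrow> G \<rho> = max (H b) c"
    "G a \<le> max (H a) c" "\<And>\<rho>. c \<le> G \<rho>" "countable N"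
    "\<And>\<rho>. a < \<rho> \<Longrightarrow> \<rho> < b \<Longrightarrow> \<rho> \<notin> N \<Longrightarrow>
       \<exists>g. (G has_real_derivative g) (at \<rho>) \<and> (g = 0 \<and> G \<rho> \<le> max (H \<rho>) c \<or> g = H' \<rho> \<and> G \<rho> = H \<rho>)"
proof -
  have L: "0 \<le> L" using lip[of a] ab by force
  have H_cont: "continuous_on {a..b} H"
    using deriv by (intro DERIV_continuous_on[of _ _ H']) (auto intro: has_field_derivative_at_within)
  have H_lip: "\<bar>H s - H t\<bar> \<le> L * \<bar>s - t\<bar>" if "s \<in> {a..b}" "t \<in> {a..b}" for s t
    using field_differentiable_bound[of "{a..b}" H H' L s t] that deriv lip
    by (auto intro: has_field_derivative_at_within)
  define F where "F \<rho> = max (Inf (H ` {\<rho>..b})) c" for \<rho>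
  have F_attained: "\<exists>u\<in>{\<rho>..b}. F \<rho> = max (H u) c" if \<rho>: "\<rho> \<in> {a..b}" for \<rho>
  proof -
    have "continuous_on {\<rho>..b} H" "{\<rho>..b} \<noteq> {}" using H_cont \<rho> by (auto intro: continuous_on_subset)
    then obtain u where u: "u \<in> {\<rho>..b}" "\<forall>v\<in>{\<rho>..b}. H u \<le> H v"
      using continuous_attains_inf[of "{\<rho>..b}" H] by auto
    then have "Inf (H ` {\<rho>..b}) = H u" by (intro cInf_eq_minimum) auto
    then show ?thesis using u by (auto simp: F_def)
  qed
  have bdd: "bdd_below (H ` {\<rho>..b})" if "\<rho> \<in> {a..b}" for \<rho>
  proof -
    have "compact (H ` {\<rho>..b})"
      using H_cont that by (intro compact_continuous_image) (auto intro: continuous_on_subset)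
    then show ?thesis by (simp add: bounded_imp_bdd_below compact_imp_bounded)
  qed
  have F_le: "F \<rho> \<le> max (H u) c" if "\<rho> \<in> {a..b}" "u \<in> {\<rho>..b}" for \<rho> u
    unfolding F_def using that by (intro max.mono cInf_lower bdd) auto
  have F_mono: "F s \<le> F t" if st: "s \<in> {a..b}" "t \<in> {a..b}" "s \<le> t" for s t
  proof -
    obtain u where "u\<in>{t..b}" "F t = max (H u) c" using F_attained st by blast
    then show ?thesis using F_le[of s u] st by auto
  qed
  have F_lip: "F t - F s \<le> L * (t - s)" if st: "s \<in> {a..b}" "t \<in> {a..b}" "s \<le> t" for s t
  proof -
    obtain u where u: "u\<in>{s..b}" "F s = max (H u) c" using F_attained st by blast
    show ?thesis
    proof (cases "t \<le> u")
      case True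
      then show ?thesis using F_le[of t u] u st L by (auto intro: order_trans[of _ 0])
    next
      case False
      have "F t \<le> max (H t) c" using F_le[of t t] st by auto
      moreover have "H t \<le> H u + L * (t - u)" using H_lip[of t u] False u st by auto
      moreover have "L * (t - u) \<le> L * (t - s)" "0 \<le> L * (t - s)"
        using L u st by (auto intro: mult_left_mono)
      ultimately show ?thesis using u(2) by linarith
    qed
  qed
  define cl where "cl \<rho> = max a (min \<rho> b)" for \<rho>
  define G where "G \<rho> = F (cl \<rho>)" for \<rho>
  have cl: "cl \<rho> \<in> {a..b}" for \<rho> using ab by (auto simp: cl_def)
  have G_eq: "G \<rho> = F \<rho>" if "\<rho> \<in> {a..b}" for \<rho> using that by (simp add: G_def cl_def)
  have G_mono: "mono G"
    by (intro monoI, unfold G_def, intro F_mono cl) (auto simp: cl_def)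
  have G_lip': "\<bar>G s - G t\<bar> \<le> L * \<bar>s - t\<bar>" if "s \<le> t" for s t
  proof -
    have "cl s \<le> cl t" "cl t - cl s \<le> t - s" using that ab by (auto simp: cl_def)
    then have "G t - G s \<le> L * (t - s)"
      unfolding G_def using F_lip[OF cl cl, of s t] L by (meson mult_left_mono order_trans)
    moreover have "G s \<le> G t" using G_mono that by (simp add: monoD)
    ultimately show ?thesis using that by simp
  qed
  have G_lip: "\<bar>G s - G t\<bar> \<le> L * \<bar>s - t\<bar>" for s t
    using G_lip'[of s t] G_lip'[of t s] by (cases "s \<le> t") (auto simp: abs_minus_commute)
  have G_cont: "isCont G x" for x
  proof -
    have "((\<lambda>y. G y - G x) \<longlongrightarrow> 0) (at x)"
    proof (rule Lim_null_comparison)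
      show "\<forall>\<^sub>F y in at x. norm (G y - G x) \<le> L * \<bar>y - x\<bar>" using G_lip by simp
      show "((\<lambda>y. L * \<bar>y - x\<bar>) \<longlongrightarrow> 0) (at x)" by (auto intro!: tendsto_eq_intros)
    qed
    then show ?thesis by (simp add: isCont_def LIM_zero_cancel)
  qed
  have c_le: "c \<le> G \<rho>" for \<rho> by (simp add: G_def F_def)
  define N where "N = {x. (\<exists>t>x. G t = G x) \<and> (\<forall>s<x. G s < G x)} \<union> {x. (\<exists>s<x. G s = G x) \<and> (\<forall>t>x. G x < G t)}"
  show ?thesis
  proof (rule that[OF G_mono G_lip])
    show "G \<rho> = G a" if "\<rho> \<le> a" for \<rho> using that ab by (simp add: G_def cl_def)
    show "G \<rho> = max (H b) c" if "b \<le> \<rho>" for \<rho>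
    proof -
      have "F b = max (H b) c" using F_attained[of b] ab by auto
      then show ?thesis using that ab by (simp add: G_def cl_def)
    qed
    show "G a \<le> max (H a) c" using F_le[of a a] ab by (simp add: G_eq)
    show "c \<le> G \<rho>" for \<rho> by (rule c_le)
    show "countable N" unfolding N_def using countable_flat_endpoints[OF G_mono] by simp
    fix x assume x: "a < x" "x < b" "x \<notin> N"
    have GH: "G t \<le> max (H u) c" if "t \<in> {a..b}" "u \<in> {t..b}" for t u
      using F_le[OF that] G_eq that by simp
    have le: "G s \<le> G t" if "s \<le> t" for s t using G_mono that by (simp add: monoD)
    have "(\<exists>s<x. \<exists>t>x. G s = G t) \<or> (\<forall>s<x. G s < G x) \<and> (\<forall>t>x. G x < G t)"
    proof -
      have s: "G s < G x \<longleftrightarrow> G s \<noteq> G x" if "s < x" for s using le[of s x] that by auto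
      have t: "G x < G t \<longleftrightarrow> G t \<noteq> G x" if "x < t" for t using le[of x t] that by auto
      have "(\<exists>t>x. G t = G x) \<longleftrightarrow> (\<exists>s<x. G s = G x)"
        using x(3) s t unfolding N_def by auto
      then show ?thesis
      proof (cases "\<exists>s<x. G s = G x")
        case True
        then obtain s where "s < x" "G s = G x" by blast
        moreover obtain t where "x < t" "G t = G x"
          using True \<open>(\<exists>t>x. G t = G x) \<longleftrightarrow> (\<exists>s<x. G s = G x)\<close> by blast
        ultimately show ?thesis by force
      next
        case False
        then show ?thesis
          using s t \<open>(\<exists>t>x. G t = G x) \<longleftrightarrow> (\<exists>s<x. G s = G x)\<close> by blast
      qed
    qed
    then show "\<exists>g. (G has_real_derivative g) (at x) \<and> (g = 0 \<and> G x \<le> max (H x) c \<or> g = H' x \<and> G x = H x)"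
    proof
      assume "\<exists>s<x. \<exists>t>x. G s = G t"
      then obtain s t where st: "s < x" "x < t" "G s = G t" by blast
      have flat: "G y = G x" if "y \<in> {s<..<t}" for y
        using le[of s y] le[of y t] le[of s x] le[of x t] st that by auto
      have "(G has_real_derivative 0) (at x)"
      proof (rule has_field_derivative_transform_within_open[OF DERIV_const[of "G x"], where S = "{s<..<t}"])
        show "G x = G y" if "y \<in> {s<..<t}" for y using flat[OF that] by (rule sym)
      qed (use st in auto)
      moreover have "G x \<le> max (H x) c" using GH[of x x] x by auto
      ultimately show ?thesis by blast
    next
      assume "(\<forall>s<x. G s < G x) \<and> (\<forall>t>x. G x < G t)"
      then have less: "s < x \<Longrightarrow> G s < G x" "x < t \<Longrightarrow> G x < G t" for s t by auto
      have Gc: "c < G x" using less(1)[OF x(1)] c_le[of a] by simp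
      obtain u where u: "u \<in> {x..b}" "F x = max (H u) c" using F_attained[of x] x by auto
      (* A minimiser beyond x would make G constant up to it. *)
      have "u = x"
      proof (rule ccontr)
        assume "u \<noteq> x"
        then have "G x < G u" using u by (intro less) auto
        moreover have "G u \<le> max (H u) c" using GH[of u u] u x by auto
        moreover have "G x = max (H u) c" using u(2) G_eq[of x] x by simp
        ultimately show False by linarith
      qed
      then have Gx: "G x = H x" using u(2) G_eq[of x] x Gc by (simp add: max_def split: if_splits)
      define D where "D = H' x"
      have HD: "(H has_real_derivative D) (at x)" unfolding D_def using deriv x by simp
      have D: "0 \<le> D"
      proof (rule ccontr)
        assume "\<not> 0 \<le> D"
        then obtain d where d: "d > 0" "\<And>h. 0 < h \<Longrightarrow> h < d \<Longrightarrow> H (x + h) < H x"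
          using DERIV_neg_dec_right[OF HD] by auto
        define h where "h = min (d / 2) (b - x)"
        have h: "0 < h" "h < d" "x + h \<le> b" using d(1) x by (auto simp: h_def)
        have "G x < G (x + h)" using h by (intro less) auto
        moreover have "G (x + h) \<le> max (H (x + h)) c" using GH[of "x + h" "x + h"] h x by auto
        ultimately show False using d(2)[OF h(1,2)] Gx Gc by auto
      qed
      have "(G has_derivative (*) D) (at x)"
        unfolding has_derivative_at_alt
      proof (intro conjI allI impI bounded_linear_mult_right)
        fix e :: real assume e: "0 < e"
        obtain d0 where d0: "d0 > 0" "\<And>y. \<bar>y - x\<bar> < d0 \<Longrightarrow> \<bar>H y - H x - D * (y - x)\<bar> \<le> e * \<bar>y - x\<bar>"
          using HD e unfolding has_field_derivative_def has_derivative_at_alt by auto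
        define \<eta> where "\<eta> = min (d0 / 2) (b - x)"
        have \<eta>: "0 < \<eta>" "\<eta> < d0" "x + \<eta> \<le> b" using d0(1) x by (auto simp: \<eta>_def)
        have "G x < G (x + \<eta>)" using \<eta> by (intro less) auto
        then have "\<forall>\<^sub>F y in at x. G y < G (x + \<eta>)"
          using order_tendstoD(2)[OF G_cont[of x, unfolded isCont_def]] by blast
        then obtain d1 where d1: "d1 > 0" "\<And>y. y \<noteq> x \<Longrightarrow> \<bar>y - x\<bar> < d1 \<Longrightarrow> G y < G (x + \<eta>)"
          unfolding eventually_at by (auto simp: dist_real_def)
        have "\<forall>\<^sub>F y in at x. c < H y"
          using DERIV_isCont[OF HD] Gc Gx unfolding isCont_def by (metis order_tendstoD(1))
        then obtain d2 where d2: "d2 > 0" "\<And>y. y \<noteq> x \<Longrightarrow> \<bar>y - x\<bar> < d2 \<Longrightarrow> c < H y"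
          unfolding eventually_at by (auto simp: dist_real_def)
        define d where "d = Min {d0, d1, d2, x - a, b - x}"
        have d: "d > 0" "d \<le> d0" "d \<le> d1" "d \<le> d2" "d \<le> x - a" "d \<le> b - x"
          using d0 d1 d2 x by (auto simp: d_def)
        have "\<bar>G y - G x - D * (y - x)\<bar> \<le> e * \<bar>y - x\<bar>" if y: "\<bar>y - x\<bar> < d" for y
        proof (cases "y = x")
          case False
          have yab: "y \<in> {a..b}" using y d by auto
          have "G y \<le> max (H y) c" using GH[of y y] yab by auto
          then have up: "G y \<le> H y" using d2(2)[OF False] y d by simp
          obtain u where u: "u \<in> {y..b}" "G y = max (H u) c"
            using F_attained[OF yab] G_eq[OF yab] by metis
          have uab: "u \<in> {a..b}" using u yab by auto
          have Hy: "\<bar>H y - H x - D * (y - x)\<bar> \<le> e * \<bar>y - x\<bar>" using d0(2) y d by simp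
          have "H x + D * (y - x) - e * \<bar>y - x\<bar> \<le> G y"
          proof (cases "x < y")
            case True
            (* The minimiser u for a point y close to x stays within distance eta of x, where
               H is close to its linearisation, because G y lies below G (x + eta). *)
            have "u < x + \<eta>"
            proof (rule ccontr)
              assume "\<not> u < x + \<eta>"
              then have "G (x + \<eta>) \<le> max (H u) c" using u \<eta> x by (intro GH) auto
              moreover have "G y < G (x + \<eta>)" using d1(2)[OF False] y d by simp
              ultimately show False using u(2) by linarith
            qed
            then have "\<bar>H u - H x - D * (u - x)\<bar> \<le> e * \<bar>u - x\<bar>"
              using d0(2)[of u] \<eta> u True by simp
            then have Hu: "H x + (D - e) * (u - x) \<le> H u"
              using u True by (simp add: algebra_simps)
            have "H x + (D - e) * (y - x) \<le> G y"
            proof (cases "e \<le> D")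
              case ed: True
              have "(D - e) * (y - x) \<le> (D - e) * (u - x)" using u ed by (intro mult_left_mono) auto
              then show ?thesis using Hu u(2) by linarith
            next
              case False
              then have "(D - e) * (y - x) \<le> 0" using True by (simp add: mult_le_0_iff)
              then show ?thesis using less(2)[OF True] Gx by linarith
            qed
            then show ?thesis using True by (simp add: algebra_simps)
          next
            case yx: False
            then have "y < x" using False by simp
            have "u < x"
            proof (rule ccontr)
              assume "\<not> u < x"
              then have "G x \<le> max (H u) c" using u x by (intro GH) auto
              then show False using less(1)[OF \<open>y < x\<close>] u(2) by simp
            qed
            then have "\<bar>H u - H x - D * (u - x)\<bar> \<le> e * \<bar>u - x\<bar>"
              using d0(2)[of u] u y d by auto
            then have Hu: "H x - (D + e) * (x - u) \<le> H u"
              using \<open>u < x\<close> by (simp add: algebra_simps)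
            have "(D + e) * (x - u) \<le> (D + e) * (x - y)"
              using u D e by (intro mult_left_mono) auto
            then have "H x - (D + e) * (x - y) \<le> G y" using Hu u(2) by linarith
            then show ?thesis using \<open>y < x\<close> by (simp add: algebra_simps)
          qed
          then show ?thesis using up Hy Gx by linarith
        qed (use Gx in simp)
        then show "\<exists>d>0. \<forall>y. norm (y - x) < d \<longrightarrow> norm (G y - G x - D * (y - x)) \<le> e * norm (y - x)"
          using d(1) by auto
      qed
      then have "(G has_real_derivative H' x) (at x)" unfolding has_field_derivative_def D_def .
      then show ?thesis using Gx by blast
    qed
  qed
qed

section \<open>Circle means of continuously differentiable maps\<close>

definition circ :: "real \<Rightarrow> real^2" where "circ t = vector [cos (2 * pi * t), sin (2 * pi * t)]"
definition circ_perp :: "real \<Rightarrow> real^2" where "circ_perp t = vector [- sin (2 * pi * t), cos (2 * pi * t)]"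

lemma circ_nth: "circ t $ 1 = cos (2 * pi * t)" "circ t $ 2 = sin (2 * pi * t)"
    "circ_perp t $ 1 = - sin (2 * pi * t)" "circ_perp t $ 2 = cos (2 * pi * t)"
  by (simp_all add: circ_def circ_perp_def)

lemma has_vector_derivative_vec2:
  fixes f :: "real \<Rightarrow> real^2"
  assumes "((\<lambda>t. f t $ 1) has_real_derivative d $ 1) (at t within S)"
    and "((\<lambda>t. f t $ 2) has_real_derivative d $ 2) (at t within S)"
  shows "(f has_vector_derivative d) (at t within S)"
proof -
  have "((\<lambda>t. f t $ i) has_derivative (\<lambda>s. s * d $ i)) (at t within S)" for i
    using assms exhaust_2[of i] unfolding has_field_derivative_def by (auto simp: mult_commute_abs)
  then show ?thesis
    unfolding has_vector_derivative_def has_derivative_componentwise_within[of f]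
    by (auto simp: Basis_vec_def inner_axis)
qed

lemma circ_deriv: "(circ has_vector_derivative (2 * pi) *\<^sub>R circ_perp t) (at t within S)"
  by (rule has_vector_derivative_vec2) (auto simp: circ_nth intro!: derivative_eq_intros)

lemma circ_perp_deriv: "(circ_perp has_vector_derivative - ((2 * pi) *\<^sub>R circ t)) (at t within S)"
  by (rule has_vector_derivative_vec2) (auto simp: circ_nth intro!: derivative_eq_intros)

lemma continuous_on_circ: "continuous_on S circ" "continuous_on S circ_perp"
  using circ_deriv circ_perp_deriv
  by (auto intro!: continuous_at_imp_continuous_on has_vector_derivative_continuous)

lemma norm_vec2: "norm (x::real^2) = sqrt ((x $ 1)\<^sup>2 + (x $ 2)\<^sup>2)"
  by (simp add: norm_vec_def L2_set_def sum_2)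

lemma norm_circ [simp]: "norm (circ t) = 1"
  by (simp add: norm_vec2 circ_nth)

lemma inner_vec2: "(x::real^2) \<bullet> y = x $ 1 * y $ 1 + x $ 2 * y $ 2"
  by (simp add: inner_vec_def sum_2)

lemma norm_mat2: "(norm (M::real^2^2))\<^sup>2 = (M $ 1 $ 1)\<^sup>2 + (M $ 1 $ 2)\<^sup>2 + (M $ 2 $ 1)\<^sup>2 + (M $ 2 $ 2)\<^sup>2"
  unfolding power2_norm_eq_inner by (simp add: inner_vec_def sum_2 power2_eq_square)

text \<open>The frame \<open>circ\<close>, \<open>circ_perp\<close> is orthonormal, and the Hilbert--Schmidt norm can be
  computed in any orthonormal frame.\<close>

lemma matrix_circ_frame_bounds:
  fixes M :: "real^2^2"
  shows "((M *v circ t) \<bullet> circ t)\<^sup>2 + ((M *v circ_perp t) \<bullet> circ_perp t)\<^sup>2 \<le> (norm M)\<^sup>2"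
    and "norm (M *v circ_perp t) \<le> norm M"
proof -
  define c s where "c = cos (2 * pi * t)" and "s = sin (2 * pi * t)"
  have cs: "c\<^sup>2 + s\<^sup>2 = 1" by (simp add: c_def s_def)
  define m1 m2 m3 m4 where m: "m1 = M $ 1 $ 1" "m2 = M $ 1 $ 2" "m3 = M $ 2 $ 1" "m4 = M $ 2 $ 2"
  have Mv: "(M *v x) $ 1 = m1 * x $ 1 + m2 * x $ 2" "(M *v x) $ 2 = m3 * x $ 1 + m4 * x $ 2" for x
    by (simp_all add: matrix_vector_mult_def sum_2 m)
  have N: "(norm M)\<^sup>2 = m1\<^sup>2 + m2\<^sup>2 + m3\<^sup>2 + m4\<^sup>2" by (simp add: norm_mat2 m)
  have n: "circ t $ 1 = c" "circ t $ 2 = s" "circ_perp t $ 1 = - s" "circ_perp t $ 2 = c"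
    by (simp_all add: circ_nth c_def s_def)
  have "((m1 * c + m2 * s) * c + (m3 * c + m4 * s) * s)\<^sup>2 + ((m1 * (-s) + m2 * c) * (-s) + (m3 * (-s) + m4 * c) * c)\<^sup>2
      + ((m1 * c + m2 * s) * (-s) + (m3 * c + m4 * s) * c)\<^sup>2 + ((m1 * (-s) + m2 * c) * c + (m3 * (-s) + m4 * c) * s)\<^sup>2
      = (m1\<^sup>2 + m2\<^sup>2 + m3\<^sup>2 + m4\<^sup>2) * (c\<^sup>2 + s\<^sup>2)\<^sup>2"
    by (simp add: power2_eq_square algebra_simps)
  then show "((M *v circ t) \<bullet> circ t)\<^sup>2 + ((M *v circ_perp t) \<bullet> circ_perp t)\<^sup>2 \<le> (norm M)\<^sup>2"
    unfolding N inner_vec2 Mv n using cs by (smt (verit) mult_cancel_left1 one_power2 zero_le_power2 mult.right_neutral)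
  have "(m1 * (-s) + m2 * c)\<^sup>2 + (m3 * (-s) + m4 * c)\<^sup>2 + (m1 * c + m2 * s)\<^sup>2 + (m3 * c + m4 * s)\<^sup>2
     = (m1\<^sup>2 + m2\<^sup>2 + m3\<^sup>2 + m4\<^sup>2) * (c\<^sup>2 + s\<^sup>2)"
    by (simp add: power2_eq_square algebra_simps)
  moreover have "a + b \<le> n" if "a + b + c + d = n * 1" "0 \<le> c" "0 \<le> d" for a b c d n :: real
    using that by simp
  ultimately have "(m1 * (-s) + m2 * c)\<^sup>2 + (m3 * (-s) + m4 * c)\<^sup>2 \<le> (norm M)\<^sup>2"
    unfolding N cs using zero_le_power2 by blast
  then have "(norm (M *v circ_perp t))\<^sup>2 \<le> (norm M)\<^sup>2"
    unfolding norm_vec2 Mv n by simp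
  then show "norm (M *v circ_perp t) \<le> norm M" by (rule power2_le_imp_le) simp
qed

lemma bounded_linear_to_complex: "bounded_linear to_complex"
  unfolding linear_conv_bounded_linear[symmetric]
  by (rule linearI) (simp_all add: to_complex_def complex_eq_iff)

lemma norm_to_complex [simp]: "norm (to_complex x) = norm x"
  by (simp add: to_complex_def norm_vec2 cmod_def)

locale C1_map =
  fixes v :: "real^2 \<Rightarrow> real^2" and M :: "real^2 \<Rightarrow> real^2^2"
  assumes deriv: "\<And>x. (v has_derivative (\<lambda>z. M x *v z)) (at x)"
    and cont_M: "continuous_on UNIV M"
begin

definition circle_mean :: "real \<Rightarrow> real" where
  "circle_mean \<rho> = integral {0..1} (\<lambda>t. v (\<rho> *\<^sub>R circ t) \<bullet> circ t)"

definition circle_mean_deriv :: "real \<Rightarrow> real" where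
  "circle_mean_deriv \<rho> = integral {0..1} (\<lambda>t. (M (\<rho> *\<^sub>R circ t) *v circ t) \<bullet> circ t)"

lemma cont_v: "continuous_on S v"
  by (intro continuous_at_imp_continuous_on ballI has_derivative_continuous[OF deriv])

lemma cont_v_compose: "continuous_on S f \<Longrightarrow> continuous_on S (\<lambda>x. v (f x))"
  using continuous_on_compose2[OF cont_v[of UNIV]] by blast

lemma cont_M_compose: "continuous_on S f \<Longrightarrow> continuous_on S (\<lambda>x. M (f x))"
  using continuous_on_compose2[OF cont_M] by blast

lemma cont_circ_compose: "continuous_on S f \<Longrightarrow> continuous_on S (\<lambda>x. circ (f x))"
    "continuous_on S f \<Longrightarrow> continuous_on S (\<lambda>x. circ_perp (f x))"
  using continuous_on_compose2[OF continuous_on_circ(1)[of UNIV]] continuous_on_compose2[OF continuous_on_circ(2)[of UNIV]] by blast+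

lemma cont_matrix_vector:
  fixes A :: "_ \<Rightarrow> real^2^2"
  shows "continuous_on S A \<Longrightarrow> continuous_on S f \<Longrightarrow> continuous_on S (\<lambda>x. A x *v f x)"
  unfolding matrix_vector_mult_def by (intro continuous_intros)

lemmas cont_intros = cont_v_compose cont_M_compose cont_circ_compose cont_matrix_vector continuous_intros

lemma circle_mean_has_derivative:
  "(circle_mean has_real_derivative circle_mean_deriv \<rho>) (at \<rho>)"
proof -
  have "((\<lambda>\<rho>. integral (cbox 0 1) (\<lambda>t. v (\<rho> *\<^sub>R circ t) \<bullet> circ t)) has_field_derivative
      integral (cbox 0 1) (\<lambda>t. (M (\<rho> *\<^sub>R circ t) *v circ t) \<bullet> circ t)) (at \<rho> within UNIV)"
  proof (rule leibniz_rule_field_derivative)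
    fix \<rho> t :: real
    have "((\<lambda>\<rho>. v (\<rho> *\<^sub>R circ t) \<bullet> circ t) has_derivative (\<lambda>s. (M (\<rho> *\<^sub>R circ t) *v (s *\<^sub>R circ t)) \<bullet> circ t)) (at \<rho>)"
      by (intro has_derivative_inner_left has_derivative_compose[OF _ deriv, of _ "\<lambda>s. s *\<^sub>R circ t"])
        (auto intro!: derivative_eq_intros)
    then show "((\<lambda>\<rho>. v (\<rho> *\<^sub>R circ t) \<bullet> circ t) has_field_derivative (M (\<rho> *\<^sub>R circ t) *v circ t) \<bullet> circ t) (at \<rho> within UNIV)"
      unfolding has_field_derivative_def by (simp add: matrix_vector_mult_scaleR mult_commute_abs)
  next
    fix \<rho> :: real
    show "(\<lambda>t. v (\<rho> *\<^sub>R circ t) \<bullet> circ t) integrable_on cbox 0 1"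
      by (intro integrable_continuous cont_intros)
  next
    show "continuous_on (UNIV \<times> cbox 0 1) (\<lambda>(\<rho>, t). (M (\<rho> *\<^sub>R circ t) *v circ t) \<bullet> circ t)"
      unfolding split_beta by (intro cont_intros)
  qed auto
  then show ?thesis unfolding circle_mean_def[abs_def] circle_mean_deriv_def by simp
qed

lemma circle_path_deriv:
  "((\<lambda>t. v (\<rho> *\<^sub>R circ t)) has_vector_derivative M (\<rho> *\<^sub>R circ t) *v ((2 * pi * \<rho>) *\<^sub>R circ_perp t)) (at t within S)"
proof -
  have "((\<lambda>t. \<rho> *\<^sub>R circ t) has_derivative (\<lambda>s. s *\<^sub>R ((2 * pi * \<rho>) *\<^sub>R circ_perp t))) (at t within S)"
    using bounded_linear.has_vector_derivative[OF bounded_linear_scaleR_right circ_deriv, of \<rho>]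
    unfolding has_vector_derivative_def by (simp add: mult.commute mult.left_commute)
  from has_derivative_compose[OF this deriv] show ?thesis
    unfolding has_vector_derivative_def by (simp add: matrix_vector_mult_scaleR)
qed

text \<open>Integration by parts on the circle: \<open>circ_perp\<close> has derivative \<open>- ((2 * pi) *\<^sub>R circ t)\<close>,
  so the mean of the radial component of \<open>v\<close> is \<open>\<rho>\<close> times the mean of the tangential diagonal entry
  of its differential.\<close>

lemma circle_mean_tangential:
  "circle_mean \<rho> = \<rho> * integral {0..1} (\<lambda>t. (M (\<rho> *\<^sub>R circ t) *v circ_perp t) \<bullet> circ_perp t)"
proof -
  define f where "f t = (M (\<rho> *\<^sub>R circ t) *v circ_perp t) \<bullet> circ_perp t" for t
  define g where "g t = v (\<rho> *\<^sub>R circ t) \<bullet> circ t" for t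
  have "((\<lambda>t. 2 * pi * (\<rho> * f t - g t)) has_integral (v (\<rho> *\<^sub>R circ 1) \<bullet> circ_perp 1 - v (\<rho> *\<^sub>R circ 0) \<bullet> circ_perp 0)) {0..1}"
  proof (rule fundamental_theorem_of_calculus)
    fix t :: real
    have "((\<lambda>t. v (\<rho> *\<^sub>R circ t) \<bullet> circ_perp t) has_vector_derivative
       v (\<rho> *\<^sub>R circ t) \<bullet> (- ((2 * pi) *\<^sub>R circ t)) + (M (\<rho> *\<^sub>R circ t) *v ((2 * pi * \<rho>) *\<^sub>R circ_perp t)) \<bullet> circ_perp t) (at t within {0..1})"
      by (rule bounded_bilinear.has_vector_derivative[OF bounded_bilinear_inner circle_path_deriv circ_perp_deriv])
    then show "((\<lambda>t. v (\<rho> *\<^sub>R circ t) \<bullet> circ_perp t) has_vector_derivative 2 * pi * (\<rho> * f t - g t)) (at t within {0..1})"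
      by (simp add: f_def g_def matrix_vector_mult_scaleR algebra_simps)
  qed simp
  moreover have "circ 1 = circ 0" "circ_perp 1 = circ_perp 0"
    by (simp_all add: circ_def circ_perp_def)
  ultimately have "((\<lambda>t. 2 * pi * (\<rho> * f t - g t)) has_integral 0) {0..1}" by simp
  then have "integral {0..1} (\<lambda>t. 2 * pi * (\<rho> * f t - g t)) = 0" by (rule integral_unique)
  moreover have "f integrable_on {0..1}" "g integrable_on {0..1}"
    unfolding f_def g_def by (intro integrable_continuous_real cont_intros)+
  ultimately show ?thesis
    unfolding circle_mean_def f_def[symmetric] g_def[symmetric] by (simp add: integral_diff integrable_on_mult_right)
qed

definition circle_norm :: "real \<Rightarrow> real" where
  "circle_norm \<rho> = integral {0..1} (\<lambda>t. norm (M (\<rho> *\<^sub>R circ t)))"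

text \<open>The left-hand side is the norm of the differential of the radial map with profile
  \<open>circle_mean\<close>. Both of its entries are means over the circle, so this is the triangle
  inequality for an integral with values in the plane.\<close>

lemma circle_norm_ge_radial:
  assumes "\<rho> > 0"
  shows "sqrt ((circle_mean_deriv \<rho>)\<^sup>2 + (circle_mean \<rho> / \<rho>)\<^sup>2) \<le> circle_norm \<rho>"
proof -
  define f where "f t = (M (\<rho> *\<^sub>R circ t) *v circ t) \<bullet> circ t" for t
  define g where "g t = (M (\<rho> *\<^sub>R circ t) *v circ_perp t) \<bullet> circ_perp t" for t
  have fg: "continuous_on {0..1} f" "continuous_on {0..1} g"
    unfolding f_def g_def by (intro cont_intros)+
  then have i: "f integrable_on {0..1}" "g integrable_on {0..1}" by (auto intro: integrable_continuous_real)
  have "((\<lambda>t. of_real (f t) + \<i> * of_real (g t)) has_integral (of_real (integral {0..1} f) + \<i> * of_real (integral {0..1} g))) {0..1}"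
    by (intro has_integral_add has_integral_mult_right has_integral_of_real integrable_integral i)
  then have eq: "integral {0..1} (\<lambda>t. Complex (f t) (g t)) = Complex (integral {0..1} f) (integral {0..1} g)"
    by (auto simp: Complex_eq dest: integral_unique)
  have "cmod (integral {0..1} (\<lambda>t. Complex (f t) (g t))) \<le> circle_norm \<rho>"
    unfolding circle_norm_def
  proof (rule integral_norm_bound_integral)
    show "(\<lambda>t. Complex (f t) (g t)) integrable_on {0..1}"
      unfolding Complex_eq by (intro integrable_continuous_real continuous_intros fg)
    show "(\<lambda>t. norm (M (\<rho> *\<^sub>R circ t))) integrable_on {0..1}"
      by (intro integrable_continuous_real cont_intros)
    fix t
    show "cmod (Complex (f t) (g t)) \<le> norm (M (\<rho> *\<^sub>R circ t))"
      unfolding cmod_def f_def g_def by (rule real_le_lsqrt) (auto simp: matrix_circ_frame_bounds)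
  qed
  moreover have "integral {0..1} f = circle_mean_deriv \<rho>" "integral {0..1} g = circle_mean \<rho> / \<rho>"
    using assms circle_mean_tangential[of \<rho>] by (simp_all add: circle_mean_deriv_def f_def[abs_def] g_def[abs_def])
  ultimately show ?thesis by (simp add: eq cmod_def)
qed

text \<open>A closed curve that winds once around \<open>0\<close> and keeps distance at least \<open>c\<close> from it has length at least
  \<open>2 * pi * c\<close>, since \<open>2 * pi * \<i>\<close> is its integral of \<open>1 / w\<close>.\<close>

lemma circle_norm_ge_length:
  assumes \<rho>: "\<rho> > 0" and c: "c > 0" and ge: "\<And>t. c \<le> norm (v (\<rho> *\<^sub>R circ t))"
    and wn: "winding_number (\<lambda>t. to_complex (v (\<rho> *\<^sub>R circ t))) 0 = 1"
  shows "c / \<rho> \<le> circle_norm \<rho>"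
proof -
  define \<gamma> where "\<gamma> t = to_complex (v (\<rho> *\<^sub>R circ t))" for t
  define \<gamma>' where "\<gamma>' t = to_complex (M (\<rho> *\<^sub>R circ t) *v ((2 * pi * \<rho>) *\<^sub>R circ_perp t))" for t
  have d: "(\<gamma> has_vector_derivative \<gamma>' t) (at t)" for t
    unfolding \<gamma>_def \<gamma>'_def by (rule bounded_linear.has_vector_derivative[OF bounded_linear_to_complex circle_path_deriv])
  have \<gamma>'c: "continuous_on {0..1} \<gamma>'"
    unfolding \<gamma>'_def by (intro bounded_linear.continuous_on[OF bounded_linear_to_complex] cont_intros)
  have \<gamma>c: "continuous_on {0..1} \<gamma>"
    using d by (auto intro!: continuous_at_imp_continuous_on has_vector_derivative_continuous)
  have vp: "valid_path \<gamma>"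
    unfolding valid_path_def using d \<gamma>'c
    by (intro C1_differentiable_imp_piecewise) (auto simp: C1_differentiable_on_def)
  have ne: "\<gamma> t \<noteq> 0" for t
    using ge[of t] c unfolding \<gamma>_def by (metis norm_to_complex norm_zero not_less)
  then have "0 \<notin> path_image \<gamma>" by (auto simp: path_image_def)
  from winding_number_valid_path[OF vp this]
  have "1 = 1 / (2 * pi * \<i>) * contour_integral \<gamma> (\<lambda>w. 1 / w)"
    using wn unfolding \<gamma>_def by simp
  then have "contour_integral \<gamma> (\<lambda>w. 1 / w) = 2 * pi * \<i>" by (simp add: field_simps)
  moreover have "contour_integral \<gamma> (\<lambda>w. 1 / w) = integral {0..1} (\<lambda>t. 1 / \<gamma> t * \<gamma>' t)"
    unfolding contour_integral_integral using vector_derivative_at[OF d] by simp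
  ultimately have "2 * pi = cmod (integral {0..1} (\<lambda>t. 1 / \<gamma> t * \<gamma>' t))"
    by (simp add: norm_mult)
  also have "\<dots> \<le> integral {0..1} (\<lambda>t. (2 * pi * \<rho> / c) * norm (M (\<rho> *\<^sub>R circ t)))"
  proof (rule integral_norm_bound_integral)
    show "(\<lambda>t. 1 / \<gamma> t * \<gamma>' t) integrable_on {0..1}"
      by (intro integrable_continuous_real continuous_intros \<gamma>c \<gamma>'c) (use ne in auto)
    show "(\<lambda>t. (2 * pi * \<rho> / c) * norm (M (\<rho> *\<^sub>R circ t))) integrable_on {0..1}"
      by (intro integrable_continuous_real cont_intros)
    fix t
    have "cmod (\<gamma>' t) = 2 * pi * \<rho> * norm (M (\<rho> *\<^sub>R circ t) *v circ_perp t)"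
      using \<rho> by (simp add: \<gamma>'_def matrix_vector_mult_scaleR)
    also have "\<dots> \<le> 2 * pi * \<rho> * norm (M (\<rho> *\<^sub>R circ t))"
      using \<rho> by (intro mult_left_mono matrix_circ_frame_bounds) auto
    finally have "cmod (\<gamma>' t) \<le> 2 * pi * \<rho> * norm (M (\<rho> *\<^sub>R circ t))" .
    moreover have "c \<le> cmod (\<gamma> t)" using ge by (simp add: \<gamma>_def)
    ultimately have "cmod (\<gamma>' t) / cmod (\<gamma> t) \<le> (2 * pi * \<rho> * norm (M (\<rho> *\<^sub>R circ t))) / c"
      using c \<rho> by (intro frac_le) auto
    then show "cmod (1 / \<gamma> t * \<gamma>' t) \<le> (2 * pi * \<rho> / c) * norm (M (\<rho> *\<^sub>R circ t))"
      by (simp add: norm_mult norm_divide)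
  qed
  also have "\<dots> = (2 * pi * \<rho> / c) * circle_norm \<rho>"
    unfolding circle_norm_def by simp
  finally show ?thesis using \<rho> c by (simp add: field_simps)
qed

end

section \<open>Mollification\<close>

lemma powr_above_tangent:
  fixes A t p :: real
  assumes "0 \<le> A" "0 \<le> t" "1 \<le> p"
  shows "A powr p + p * A powr (p - 1) * (t - A) \<le> t powr p"
proof -
  consider "A = 0" | "A > 0" "t = 0" | "A > 0" "t > 0" using assms by linarith
  then show ?thesis
  proof cases
    case 1
    then show ?thesis by simp
  next
    case 2
    have "p * A powr (p - 1) * A = p * A powr p"
      using powr_mult_base[of A "p - 1"] 2 by (simp add: mult.commute mult.left_commute)
    moreover have "1 * A powr p \<le> p * A powr p" using assms(3) by (intro mult_right_mono) auto
    ultimately show ?thesis using 2 by (simp add: algebra_simps)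
  next
    case pos: 3
  have "((\<lambda>x. x powr p) has_real_derivative p * A powr (p - 1)) (at A within {0<..})"
    using pos by (auto intro!: derivative_eq_intros)
  then have "t powr p - A powr p \<ge> p * A powr (p - 1) * (t - A)"
    using pos by (intro convex_on_imp_above_tangent[OF powr_convex[OF assms(3)]]) (auto simp: interior_open)
  then show ?thesis by simp
  qed
qed

text \<open>Jensen's inequality for the power function, obtained by integrating the tangent line at the mean.
  The case of an infinite right-hand side is included.\<close>

lemma powr_integral_le:
  fixes f :: "'a \<Rightarrow> real"
  assumes N: "prob_space N" and f: "integrable N f" "\<And>x. 0 \<le> f x" and p: "1 \<le> p"
  shows "ennreal ((\<integral>x. f x \<partial>N) powr p) \<le> (\<integral>\<^sup>+x. ennreal (f x powr p) \<partial>N)"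
proof (cases "(\<integral>\<^sup>+x. ennreal (f x powr p) \<partial>N) = \<infinity>")
  case False
  interpret prob_space N by fact
  have [measurable]: "f \<in> borel_measurable N" using f by simp
  have int: "integrable N (\<lambda>x. f x powr p)"
    using False by (intro integrableI_nonneg) (auto simp: less_top)
  define A where "A = (\<integral>x. f x \<partial>N)"
  have A: "0 \<le> A" unfolding A_def using f by simp
  have "A powr p = (\<integral>x. A powr p + p * A powr (p - 1) * (f x - A) \<partial>N)"
    using f by (simp add: prob_space A_def[symmetric])
  also have "\<dots> \<le> (\<integral>x. f x powr p \<partial>N)"
    using f A p by (intro integral_mono int powr_above_tangent) auto
  finally have "ennreal (A powr p) \<le> ennreal (\<integral>x. f x powr p \<partial>N)" by (rule ennreal_leI)
  also have "\<dots> = (\<integral>\<^sup>+x. ennreal (f x powr p) \<partial>N)"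
    by (rule nn_integral_eq_integral[symmetric, OF int]) simp
  finally show ?thesis unfolding A_def .
qed simp

lemma nn_integral_reflect_translate:
  fixes f :: "real^2 \<Rightarrow> ennreal"
  assumes [measurable]: "f \<in> borel_measurable borel"
  shows "(\<integral>\<^sup>+y. f (x - y) \<partial>lborel) = (\<integral>\<^sup>+y. f y \<partial>lborel)"
    and "(\<integral>\<^sup>+y. f (y - x) \<partial>lborel) = (\<integral>\<^sup>+y. f y \<partial>lborel)"
proof -
  have "(\<integral>\<^sup>+y. f y \<partial>lborel) = (\<integral>\<^sup>+y. f y \<partial>density (distr lborel borel (\<lambda>y. x + (-1) *\<^sub>R y)) (\<lambda>_. ennreal (\<bar>- 1\<bar> ^ DIM(real^2))))"
    by (subst lborel_affine[of "-1" x, symmetric]) simp_all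
  also have "\<dots> = (\<integral>\<^sup>+y. f (x - y) \<partial>lborel)"
    by (subst nn_integral_density) (simp_all add: nn_integral_distr)
  finally show "(\<integral>\<^sup>+y. f (x - y) \<partial>lborel) = (\<integral>\<^sup>+y. f y \<partial>lborel)" ..
  have "(\<integral>\<^sup>+y. f y \<partial>lborel) = (\<integral>\<^sup>+y. f y \<partial>distr lborel borel ((+) (- x)))"
    by (simp add: lborel_distr_plus)
  also have "\<dots> = (\<integral>\<^sup>+y. f (y - x) \<partial>lborel)"
    by (subst nn_integral_distr) simp_all
  finally show "(\<integral>\<^sup>+y. f (y - x) \<partial>lborel) = (\<integral>\<^sup>+y. f y \<partial>lborel)" ..
qed

definition mollifier :: "real \<Rightarrow> real^2 \<Rightarrow> real" where
  "mollifier w z = bump (- vec w) (vec w) 1 z / (LINT z|lborel. bump (- vec w) (vec w) 1 z)"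

lemma box_vec_ne: "0 < w \<Longrightarrow> box (x - vec w) (x + vec w) \<noteq> ({} :: (real^2) set)"
  by (simp add: interval_ne_empty_cart)

lemma bump_integral_pos:
  assumes ne: "box a b \<noteq> {}"
  shows "integrable lborel (bump a b 1)" "0 < (LINT z|lborel. bump a b 1 z)"
proof -
  have c: "continuous_on UNIV (bump a b 1)" using C_k_bump[of 0] by simp
  have eq: "indicator (cbox a b) z *\<^sub>R bump a b 1 z = bump a b 1 z" for z
    using bump_eq_0[OF _ ne, of 1 z] box_subset_cbox[of a b] by (cases "z \<in> cbox a b") auto
  have "integrable lborel (\<lambda>z. indicator (cbox a b) z *\<^sub>R bump a b 1 z)"
    by (intro borel_integrable_compact continuous_on_subset[OF c]) auto
  then show int: "integrable lborel (bump a b 1)" by (simp only: eq)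
  show "0 < (LINT z|lborel. bump a b 1 z)"
  proof (rule ccontr)
    assume "\<not> 0 < (LINT z|lborel. bump a b 1 z)"
    then have "(LINT z|lborel. bump a b 1 z) = 0"
      by (simp add: antisym bump_nonneg integral_nonneg_AE not_less)
    then have "AE z in lborel. bump a b 1 z = 0"
      using integral_nonneg_eq_0_iff_AE[OF int] bump_nonneg by simp
    then have "AE z in lborel. z \<notin> box a b"
      by eventually_elim (use bump_pos[of 1 _ a b] in force)
    then have "emeasure lborel (box a b) = 0"
      by (subst (asm) AE_iff_measurable[OF _ refl]) auto
    moreover have "\<And>i. i \<in> Basis \<Longrightarrow> a \<bullet> i < b \<bullet> i" using ne by (simp add: box_ne_empty)
    moreover from this have "0 < (\<Prod>i\<in>Basis. (b - a) \<bullet> i)"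
      by (intro prod_pos) (simp add: inner_diff_left)
    moreover from calculation(2) have "emeasure lborel (box a b) = ennreal (\<Prod>i\<in>Basis. (b - a) \<bullet> i)"
      by (intro emeasure_lborel_box) (simp add: less_imp_le)
    ultimately show False by (metis ennreal_eq_0_iff not_less)
  qed
qed

lemma mollifier_props:
  assumes w: "w > 0"
  shows "0 \<le> mollifier w z"
    and "z \<notin> box (- vec w) (vec w) \<Longrightarrow> mollifier w z = 0"
    and "mollifier w \<in> test_functions UNIV"
    and "cbox (x - vec w) (x + vec w) \<subseteq> \<Omega> \<Longrightarrow> (\<lambda>y. mollifier w (x - y)) \<in> test_functions \<Omega>"
    and "(\<integral>\<^sup>+z. ennreal (mollifier w z) \<partial>lborel) = 1"
proof -
  let ?C = "LINT z|lborel. bump (- vec w) (vec w) 1 z"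
  have ne: "box (- vec w) (vec w) \<noteq> ({} :: (real^2) set)" using box_vec_ne[OF w, of 0] by simp
  note C = bump_integral_pos[OF ne]
  show "0 \<le> mollifier w z" unfolding mollifier_def using C bump_nonneg by simp
  show "z \<notin> box (- vec w) (vec w) \<Longrightarrow> mollifier w z = 0"
    unfolding mollifier_def using bump_eq_0[OF _ ne] by simp
  have scale: "(\<lambda>y. c * \<psi> y) \<in> test_functions \<Omega>" if "\<psi> \<in> test_functions \<Omega>" for \<psi> c \<Omega>
    using that unfolding test_functions_def by (auto intro!: C_k_mult C_k_const)
  have "(\<lambda>y. (1 / ?C) * bump (- vec w) (vec w) 1 y) \<in> test_functions UNIV"
    by (intro scale bump_test_function ne) auto
  then show "mollifier w \<in> test_functions UNIV"
    unfolding mollifier_def[abs_def] by simp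
  have refl: "bump (- vec w) (vec w) 1 (x - y) = bump (x - vec w) (x + vec w) 1 y" for y
    unfolding bump_def by (intro prod.cong refl arg_cong[of _ _ "flat_exp 1"]) (simp add: algebra_simps)
  show "(\<lambda>y. mollifier w (x - y)) \<in> test_functions \<Omega>" if "cbox (x - vec w) (x + vec w) \<subseteq> \<Omega>"
  proof -
    have "(\<lambda>y. (1 / ?C) * bump (x - vec w) (x + vec w) 1 y) \<in> test_functions \<Omega>"
      by (intro scale bump_test_function box_vec_ne w that) auto
    then show ?thesis unfolding mollifier_def refl by simp
  qed
  have "integrable lborel (mollifier w)" unfolding mollifier_def[abs_def] using C(1) by simp
  then have "(\<integral>\<^sup>+z. ennreal (mollifier w z) \<partial>lborel) = ennreal (LINT z|lborel. mollifier w z)"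
    by (intro nn_integral_eq_integral) (auto simp: mollifier_def bump_nonneg C less_imp_le)
  also have "(LINT z|lborel. mollifier w z) = 1" unfolding mollifier_def using C by simp
  finally show "(\<integral>\<^sup>+z. ennreal (mollifier w z) \<partial>lborel) = 1" by simp
qed

text \<open>The derivative falls on the smooth kernel.\<close>

lemma convolution_has_derivative:
  fixes g :: "real^2 \<Rightarrow> real"
  assumes \<phi>: "\<phi> \<in> test_functions UNIV" and g: "continuous_on (cbox a b) g"
  shows "((\<lambda>x. integral (cbox a b) (\<lambda>y. \<phi> (x - y) * g y)) has_derivative
      (\<lambda>z. \<Sum>j\<in>UNIV. z $ j * integral (cbox a b) (\<lambda>y. partial_deriv j \<phi> (x - y) * g y))) (at x)"
    and "continuous_on UNIV (\<lambda>x. integral (cbox a b) (\<lambda>y. partial_deriv j \<phi> (x - y) * g y))"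
proof -
  note dp = partial_deriv_test_function[OF \<phi>]
  define L where "L x y z = (\<Sum>j\<in>UNIV. z $ j * (partial_deriv j \<phi> (x - y) * g y))" for x y z
  have L: "bounded_linear (L x y)" for x y
    unfolding L_def by (intro bounded_linear_sum bounded_linear_mult_const bounded_linear_vec_nth)
  define B where "B x y = Blinfun (L x y)" for x y
  have B: "blinfun_apply (B x y) = L x y" for x y
    unfolding B_def by (rule bounded_linear_Blinfun_apply[OF L])
  have pc: "continuous_on S (\<lambda>z. partial_deriv j \<phi> (f z))" if "continuous_on S f" for S f j
    using continuous_on_compose2[OF dp(2) that] by simp
  have gc: "continuous_on (UNIV \<times> cbox a b) (\<lambda>z. g (snd z))"
    by (rule continuous_on_compose2[OF g]) (auto intro: continuous_intros)
  have gc2: "continuous_on (cbox a b) (\<lambda>y. \<phi> (x - y))" "continuous_on (cbox a b) (\<lambda>y. partial_deriv j \<phi> (x - y))" for x j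
    by (auto intro!: continuous_on_compose2[OF test_function_continuous[OF \<phi>]] pc continuous_intros)
  have Bc: "continuous_on (UNIV \<times> cbox a b) (\<lambda>(x, y). B x y)"
  proof (rule continuous_on_blinfun_componentwise)
    fix i :: "real^2"
    show "continuous_on (UNIV \<times> cbox a b) (\<lambda>z. blinfun_apply (case z of (x, y) \<Rightarrow> B x y) i)"
      unfolding split_beta B L_def
      by (intro continuous_intros pc gc)
  qed
  have "((\<lambda>x. integral (cbox a b) (\<lambda>y. \<phi> (x - y) * g y)) has_derivative
      blinfun_apply (integral (cbox a b) (B x))) (at x within UNIV)"
  proof (rule leibniz_rule[OF _ _ Bc])
    fix x t
    have "((\<lambda>x. \<phi> (x - t)) has_derivative (\<lambda>v. \<Sum>j\<in>UNIV. v $ j * partial_deriv j \<phi> (x - t))) (at x)"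
    proof (rule has_derivative_compose[OF _ dp(3), of "\<lambda>x. x - t" "\<lambda>v. v" x UNIV])
      show "((\<lambda>x. x - t) has_derivative (\<lambda>v. v)) (at x)" by (auto intro!: derivative_eq_intros)
    qed
    then have "((\<lambda>x. \<phi> (x - t) * g t) has_derivative (\<lambda>v. (\<Sum>j\<in>UNIV. v $ j * partial_deriv j \<phi> (x - t)) * g t)) (at x)"
      by (rule has_derivative_mult_left)
    then show "((\<lambda>x. \<phi> (x - t) * g t) has_derivative blinfun_apply (B x t)) (at x within UNIV)"
      unfolding B L_def[abs_def] by (simp add: sum_distrib_right mult.assoc)
  next
    show "(\<lambda>y. \<phi> (x - y) * g y) integrable_on cbox a b" for x
      by (intro integrable_continuous continuous_intros gc2 g)
  qed auto
  moreover have "blinfun_apply (integral (cbox a b) (B x)) z = (\<Sum>j\<in>UNIV. z $ j * integral (cbox a b) (\<lambda>y. partial_deriv j \<phi> (x - y) * g y))" for z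
  proof -
    have "continuous_on (cbox a b) (B x)"
    proof -
      have "continuous_on (cbox a b) (\<lambda>y. case (x, y) of (x, y) \<Rightarrow> B x y)"
        by (rule continuous_on_compose2[OF Bc]) (auto intro!: continuous_intros)
      then show ?thesis by simp
    qed
    then have "blinfun_apply (integral (cbox a b) (B x)) z = integral (cbox a b) (\<lambda>y. L x y z)"
      by (subst blinfun_apply_integral) (auto simp: B intro: integrable_continuous)
    also have "\<dots> = (\<Sum>j\<in>UNIV. integral (cbox a b) (\<lambda>y. z $ j * (partial_deriv j \<phi> (x - y) * g y)))"
      unfolding L_def by (intro integral_sum integrable_continuous continuous_intros gc2 g) auto
    finally show ?thesis by simp
  qed
  then have "blinfun_apply (integral (cbox a b) (B x)) = (\<lambda>z. \<Sum>j\<in>UNIV. z $ j * integral (cbox a b) (\<lambda>y. partial_deriv j \<phi> (x - y) * g y))"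
    by (rule ext)
  ultimately show "((\<lambda>x. integral (cbox a b) (\<lambda>y. \<phi> (x - y) * g y)) has_derivative
      (\<lambda>z. \<Sum>j\<in>UNIV. z $ j * integral (cbox a b) (\<lambda>y. partial_deriv j \<phi> (x - y) * g y))) (at x)"
    by simp
  show "continuous_on UNIV (\<lambda>x. integral (cbox a b) (\<lambda>y. partial_deriv j \<phi> (x - y) * g y))"
    by (rule integral_continuous_on_param, unfold split_beta) (intro continuous_intros pc gc)
qed

lemma norm_le_if_mem_cbox:
  fixes y x :: "real^2"
  assumes "y \<in> cbox (x - vec w) (x + vec w)"
  shows "norm (y - x) \<le> 2 * w"
proof -
  have "\<bar>(y - x) $ i\<bar> \<le> w" for i
    using assms[unfolded mem_box_cart, rule_format, of i] by auto
  then have "(\<Sum>i\<in>UNIV. \<bar>(y - x) $ i\<bar>) \<le> (\<Sum>i\<in>(UNIV::2 set). w)" by (intro sum_mono)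
  then show ?thesis using norm_le_l1_cart[of "y - x"] by simp
qed

text \<open>The map \<open>v\<close> is the convolution of \<open>h\<close> with a narrow kernel. Its differential moves the derivative
  to the kernel, and translates of the kernel are admissible test functions; hence on \<open>K\<close> it equals
  the convolution of the weak differential. Averaging against a probability density does not
  increase the energy, by Jensen's inequality and Tonelli's theorem.\<close>

lemma mollification:
  fixes h :: "real^2 \<Rightarrow> real^2" and D :: "real^2 \<Rightarrow> real^2^2"
  assumes \<Omega>: "open \<Omega>" and h: "continuous_on \<Omega> h" and D: "has_weak_differential \<Omega> h D"
    and K: "compact K" "K \<subseteq> \<Omega>" "K \<noteq> {}" and \<kappa>: "\<kappa> > 0" and p: "1 \<le> p"
  obtains v M where "C1_map v M" "\<And>x. x \<in> K \<Longrightarrow> norm (v x - h x) \<le> \<kappa>"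
    "(\<integral>\<^sup>+x\<in>K. ennreal (norm (M x) powr p) \<partial>lborel) \<le> (\<integral>\<^sup>+x\<in>\<Omega>. ennreal (norm (D x) powr p) \<partial>lebesgue)"
proof -
  obtain e where e: "e > 0" "{x. infdist x K \<le> e} \<subseteq> \<Omega>"
    using compact_in_open_separated[OF K(3,1) \<Omega> K(2)] by blast
  define K' where "K' = {x. infdist x K \<le> e}"
  have K': "compact K'" "K' \<subseteq> \<Omega>"
    unfolding K'_def using compact_infdist_le[OF K(3,1) e(1)] e(2) by auto
  have K'I: "y \<in> K'" if "x \<in> K" "norm (y - x) \<le> e" for x y
    unfolding K'_def using infdist_le[OF that(1), of y] that(2) by (simp add: dist_norm)
  have h_K': "continuous_on K' h" using h K'(2) continuous_on_subset by blast
  have "bounded (h ` K')" by (intro compact_imp_bounded compact_continuous_image h_K' K')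
  then obtain B where B: "\<And>x. x \<in> K' \<Longrightarrow> norm (h x) \<le> B" "B > 0" unfolding bounded_pos by auto
  (* Extending h from K' to a continuous map of the plane makes the convolution C1 everywhere;
     on K only values of h in K' enter. *)
  obtain h' where h': "continuous_on UNIV h'" "\<And>x. x \<in> K' \<Longrightarrow> h' x = h x"
    by (rule Tietze[OF h_K', of UNIV B]) (use B K'(1) that in \<open>auto simp: compact_imp_closed\<close>)
  have "uniformly_continuous_on K' h" by (rule compact_uniformly_continuous[OF h_K' K'(1)])
  then obtain \<delta> where \<delta>: "\<delta> > 0" "\<And>x y. x \<in> K' \<Longrightarrow> y \<in> K' \<Longrightarrow> dist y x < \<delta> \<Longrightarrow> dist (h y) (h x) < \<kappa>"
    using \<kappa> unfolding uniformly_continuous_on_def by meson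
  define w where "w = min e \<delta> / 3"
  have w: "w > 0" "2 * w \<le> e" "2 * w < \<delta>" using e(1) \<delta>(1) by (auto simp: w_def)
  define \<phi> where "\<phi> = mollifier w"
  note mp = mollifier_props[OF w(1), folded \<phi>_def]
  note dp = partial_deriv_test_function[OF mp(3)]
  have \<phi>_cont: "continuous_on UNIV \<phi>" by (rule test_function_continuous[OF mp(3)])
  have cK': "cbox (x - vec w) (x + vec w) \<subseteq> K'" if "x \<in> K" for x
    using K'I[OF that] norm_le_if_mem_cbox w(2) by (meson order_trans subsetI)
  have mem: "x - y \<in> cbox (- vec w) (vec w) \<longleftrightarrow> y \<in> cbox (x - vec w) (x + vec w)" for x y :: "real^2"
    by (auto simp: mem_box_cart algebra_simps)
  have \<phi>0: "\<phi> (x - y) = 0" "partial_deriv j \<phi> (x - y) = 0" if "x \<in> K" "y \<notin> K'" for x y j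
  proof -
    have "x - y \<notin> cbox (- vec w) (vec w)" using that cK' mem by blast
    moreover have 0: "\<phi> z = 0" if "z \<notin> cbox (- vec w) (vec w)" for z
      using that mp(2) box_subset_cbox by blast
    ultimately show "\<phi> (x - y) = 0" "partial_deriv j \<phi> (x - y) = 0"
      using dp(4)[OF compact_cbox 0] by blast+
  qed
  obtain a b where ab: "K' \<subseteq> cbox a b"
    using bounded_subset_cbox_symmetric[OF compact_imp_bounded[OF K'(1)]] by metis
  define v where "v x = (\<chi> i. integral (cbox a b) (\<lambda>y. \<phi> (x - y) * h' y $ i))" for x
  define M where "M x = (\<chi> i j. integral (cbox a b) (\<lambda>y. partial_deriv j \<phi> (x - y) * h' y $ i))" for x
  have h'_comp: "continuous_on S (\<lambda>y. h' y $ i)" for i S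
    by (intro continuous_intros continuous_on_subset[OF h'(1)]) auto

  have C1: "C1_map v M"
  proof
    show "(v has_derivative (\<lambda>z. M x *v z)) (at x)" for x
      unfolding has_derivative_componentwise_within[of v]
    proof
      fix u :: "real^2" assume "u \<in> Basis"
      then obtain i where u: "u = axis i 1" by (auto simp: Basis_vec_def)
      have "(M x *v z) \<bullet> u = (\<Sum>j\<in>UNIV. z $ j * integral (cbox a b) (\<lambda>y. partial_deriv j \<phi> (x - y) * h' y $ i))" for z
        unfolding u by (simp add: inner_axis matrix_vector_mult_def M_def mult.commute)
      moreover have "v x \<bullet> u = integral (cbox a b) (\<lambda>y. \<phi> (x - y) * h' y $ i)" for x
        unfolding u by (simp add: inner_axis v_def)
      ultimately show "((\<lambda>x. v x \<bullet> u) has_derivative (\<lambda>z. (M x *v z) \<bullet> u)) (at x)"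
        using convolution_has_derivative(1)[OF mp(3) h'_comp[of _ i]] by simp
    qed
    show "continuous_on UNIV M"
      unfolding M_def by (intro continuous_on_vec_lambda convolution_has_derivative(2)[OF mp(3) h'_comp])
  qed
  have int_eq: "integral (cbox a b) F = (LINT y|lebesgue. F y)" "integrable lebesgue F"
    if "continuous_on UNIV F" "\<And>y. y \<notin> K' \<Longrightarrow> F y = 0" for F :: "real^2 \<Rightarrow> real"
  proof -
    have si: "set_integrable lebesgue (cbox a b) F"
      by (intro absolutely_integrable_continuous continuous_on_subset[OF that(1)]) simp
    have "indicator (cbox a b) y *\<^sub>R F y = F y" for y
      using that(2)[of y] ab by (cases "y \<in> K'") auto
    then show "integral (cbox a b) F = (LINT y|lebesgue. F y)" "integrable lebesgue F"
      using set_lebesgue_integral_eq_integral(2)[OF si] si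
      unfolding set_lebesgue_integral_def set_integrable_def by (simp_all only:)
  qed
  have \<phi>c: "continuous_on UNIV (\<lambda>y. \<phi> (x - y))" "continuous_on UNIV (\<lambda>y. partial_deriv j \<phi> (x - y))" for x j
    by (auto intro!: continuous_on_compose2[OF \<phi>_cont] continuous_on_compose2[OF dp(2)] continuous_intros)
  have [measurable]: "\<phi> \<in> borel_measurable borel" by (rule borel_measurable_continuous_onI[OF \<phi>_cont])
  have \<phi>_one: "(\<integral>\<^sup>+y. ennreal (\<phi> (x - y)) \<partial>lborel) = 1" "(\<integral>\<^sup>+y. ennreal (\<phi> (y - x)) \<partial>lborel) = 1" for x
    using nn_integral_reflect_translate[of "\<lambda>z. ennreal (\<phi> z)" x] mp(5) by simp_all
  have \<phi>_leb[measurable]: "(\<lambda>y. \<phi> (x - y)) \<in> borel_measurable lebesgue" for x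
    by (rule measurable_completion) simp
  have \<phi>_int: "(LINT y|lebesgue. \<phi> (x - y)) = 1" if "x \<in> K" for x
  proof -
    have "ennreal (LINT y|lebesgue. \<phi> (x - y)) = (\<integral>\<^sup>+y. ennreal (\<phi> (x - y)) \<partial>lebesgue)"
      by (intro nn_integral_eq_integral[symmetric] int_eq(2) \<phi>c AE_I2 mp(1) \<phi>0(1) that)
    then have "ennreal (LINT y|lebesgue. \<phi> (x - y)) = 1"
      by (simp add: nn_integral_completion \<phi>_one)
    then show ?thesis by simp
  qed
  have close: "norm (v x - h x) \<le> \<kappa>" if x: "x \<in> K" for x
  proof -
    have xK': "x \<in> K'" using K'I[OF x, of x] e(1) by simp
    have ci: "continuous_on UNIV (\<lambda>y. \<phi> (x - y) *\<^sub>R (h' y - h x))"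
      by (intro continuous_intros \<phi>c h')
    have iS: "f integrable_on cbox a b" if "continuous_on UNIV f" for f :: "real^2 \<Rightarrow> 'b::euclidean_space"
      by (intro integrable_continuous continuous_on_subset[OF that]) simp
    have one: "integral (cbox a b) (\<lambda>y. \<phi> (x - y)) = 1"
      using int_eq(1)[OF \<phi>c(1)] \<phi>0(1)[OF x] \<phi>_int[OF x] by simp
    have "v x - h x = integral (cbox a b) (\<lambda>y. \<phi> (x - y) *\<^sub>R (h' y - h x))"
    proof (rule vec_eq_iff[THEN iffD2], rule allI)
      fix i
      have "integral (cbox a b) (\<lambda>y. \<phi> (x - y) *\<^sub>R (h' y - h x)) $ i = integral (cbox a b) (\<lambda>y. (\<phi> (x - y) *\<^sub>R (h' y - h x)) $ i)"
        by (rule integral_component_eq_cart[OF iS[OF ci], symmetric])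
      also have "\<dots> = integral (cbox a b) (\<lambda>y. \<phi> (x - y) * h' y $ i - \<phi> (x - y) * h x $ i)"
        by (simp add: right_diff_distrib)
      also have "\<dots> = integral (cbox a b) (\<lambda>y. \<phi> (x - y) * h' y $ i) - integral (cbox a b) (\<lambda>y. \<phi> (x - y) * h x $ i)"
        by (intro integral_diff iS continuous_intros \<phi>c h'_comp)
      also have "\<dots> = (v x - h x) $ i"
        using one by (simp add: v_def)
      finally show "(v x - h x) $ i = integral (cbox a b) (\<lambda>y. \<phi> (x - y) *\<^sub>R (h' y - h x)) $ i" ..
    qed
    also have "norm \<dots> \<le> integral (cbox a b) (\<lambda>y. \<phi> (x - y) * \<kappa>)"
    proof (rule integral_norm_bound_integral[OF iS[OF ci]])
      show "(\<lambda>y. \<phi> (x - y) * \<kappa>) integrable_on cbox a b" by (intro iS continuous_intros \<phi>c)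
      fix y
      show "norm (\<phi> (x - y) *\<^sub>R (h' y - h x)) \<le> \<phi> (x - y) * \<kappa>"
      proof (cases "y \<in> cbox (x - vec w) (x + vec w)")
        case True
        then have y: "y \<in> K'" "norm (y - x) < \<delta>" using cK'[OF x] norm_le_if_mem_cbox[OF True] w(3) by auto
        then have "norm (h' y - h x) \<le> \<kappa>"
          using \<delta>(2)[OF xK' y(1)] h'(2)[OF y(1)] by (simp add: dist_norm)
        then show ?thesis using mp(1)[of "x - y"] by (simp add: mult_left_mono)
      next
        case False
        then have "\<phi> (x - y) = 0" using mem mp(2) box_subset_cbox by blast
        then show ?thesis by simp
      qed
    qed
    also have "\<dots> = \<kappa>" using one by simp
    finally show ?thesis .
  qed
  (* Near K only the values of D on the compact set K' enter, where D is integrable. *)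
  define D1 where "D1 y = indicator K' y *\<^sub>R D y" for y
  have D1: "integrable lebesgue D1"
    using D K' unfolding D1_def has_weak_differential_def locally_integrable_on_def set_integrable_def by blast
  have [measurable]: "D1 \<in> borel_measurable lebesgue" using D1 by simp
  obtain C where C: "\<And>z. \<bar>\<phi> z\<bar> \<le> C"
    using test_function_lipschitz[OF mp(3)] by metis
  have \<phi>D1: "integrable lebesgue (\<lambda>y. \<phi> (x - y) *\<^sub>R D1 y)" for x
  proof (rule Bochner_Integration.integrable_bound)
    show "integrable lebesgue (\<lambda>y. C *\<^sub>R D1 y)" using D1 by simp
    have "norm (\<phi> (x - y) *\<^sub>R D1 y) \<le> norm (C *\<^sub>R D1 y)" for y
      using C[of "x - y"] by (simp add: mult_right_mono order_trans[OF _ abs_ge_self])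
    then show "AE y in lebesgue. norm (\<phi> (x - y) *\<^sub>R D1 y) \<le> norm (C *\<^sub>R D1 y)" by simp
  qed simp
  have M_eq: "M x = (LINT y|lebesgue. \<phi> (x - y) *\<^sub>R D1 y)" if x: "x \<in> K" for x
  proof -
    have "M x $ i $ j = (LINT y|lebesgue. \<phi> (x - y) *\<^sub>R D1 y) $ i $ j" for i j
    proof -
      define \<psi> where "\<psi> y = \<phi> (x - y)" for y
      have "\<psi> \<in> test_functions \<Omega>"
        unfolding \<psi>_def[abs_def] by (rule mp(4)) (use cK'[OF x] K'(2) in blast)
      then have weak: "(LINT y:\<Omega>|lebesgue. h y $ i * partial_deriv j \<psi> y) = - (LINT y:\<Omega>|lebesgue. D y $ i $ j * \<psi> y)"
        using D unfolding has_weak_differential_def by blast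
      have "(\<psi> has_derivative (\<lambda>v. \<Sum>j\<in>UNIV. (- v) $ j * partial_deriv j \<phi> (x - y))) (at y)" for y
        unfolding \<psi>_def[abs_def]
        by (rule has_derivative_compose[OF _ dp(3), of "\<lambda>y. x - y" "\<lambda>v. - v" y UNIV])
          (auto intro!: derivative_eq_intros)
      from partial_deriv_eq[OF this, of j]
      have pd: "partial_deriv j \<psi> y = - partial_deriv j \<phi> (x - y)" for y
        by (simp add: axis_def if_distrib if_distribR sum_negf cong: if_cong)
      have "M x $ i $ j = (LINT y|lebesgue. partial_deriv j \<phi> (x - y) * h' y $ i)"
        unfolding M_def using int_eq(1)[of "\<lambda>y. partial_deriv j \<phi> (x - y) * h' y $ i"] \<phi>0(2)[OF x]
        by (simp add: continuous_on_mult \<phi>c h'_comp)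
      also have "\<dots> = - (LINT y:\<Omega>|lebesgue. h y $ i * partial_deriv j \<psi> y)"
        unfolding set_lebesgue_integral_def Bochner_Integration.integral_minus[symmetric]
      proof (intro Bochner_Integration.integral_cong refl)
        fix y
        show "partial_deriv j \<phi> (x - y) * h' y $ i = - (indicator \<Omega> y *\<^sub>R (h y $ i * partial_deriv j \<psi> y))"
          using \<phi>0(2)[OF x, of y] h'(2)[of y] K'(2) by (cases "y \<in> K'") (auto simp: pd)
      qed
      also have "\<dots> = (LINT y:\<Omega>|lebesgue. D y $ i $ j * \<psi> y)" using weak by simp
      also have "\<dots> = (LINT y|lebesgue. (\<phi> (x - y) *\<^sub>R D1 y) $ i $ j)"
        unfolding set_lebesgue_integral_def
      proof (intro Bochner_Integration.integral_cong refl)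
        fix y
        show "indicator \<Omega> y *\<^sub>R (D y $ i $ j * \<psi> y) = (\<phi> (x - y) *\<^sub>R D1 y) $ i $ j"
          using \<phi>0(1)[OF x, of y] K'(2) by (cases "y \<in> K'") (auto simp: D1_def \<psi>_def)
      qed
      also have "\<dots> = (LINT y|lebesgue. (\<phi> (x - y) *\<^sub>R D1 y) $ i) $ j"
        by (intro integral_bounded_linear[OF bounded_linear_vec_nth] integrable_bounded_linear[OF bounded_linear_vec_nth] \<phi>D1)
      also have "(LINT y|lebesgue. (\<phi> (x - y) *\<^sub>R D1 y) $ i) = (LINT y|lebesgue. \<phi> (x - y) *\<^sub>R D1 y) $ i"
        by (intro integral_bounded_linear[OF bounded_linear_vec_nth] \<phi>D1)
      finally show ?thesis .
    qed
    then show ?thesis by (simp add: vec_eq_iff)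
  qed
  define g where "g y = ennreal (norm (D1 y) powr p)" for y
  have g_meas: "g \<in> borel_measurable lebesgue" unfolding g_def by measurable
  (* Tonelli's theorem is applied to a Borel representative. *)
  then obtain g' where g'[measurable]: "g' \<in> borel_measurable lborel" and gg': "AE y in lborel. g y = g' y"
    using completion_ex_borel_measurable[OF g_meas] by blast
  have gg'_leb: "AE y in lebesgue. g y = g' y" using gg' AE_completion by blast
  have M_powr: "ennreal (norm (M x) powr p) \<le> (\<integral>\<^sup>+y. ennreal (\<phi> (x - y)) * g' y \<partial>lborel)" if x: "x \<in> K" for x
  proof -
    define N where "N = density lebesgue (\<lambda>y. ennreal (\<phi> (x - y)))"
    have N: "prob_space N"
      by (rule prob_spaceI) (simp add: N_def emeasure_density nn_integral_completion \<phi>_one)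
    have int: "integrable N (\<lambda>y. norm (D1 y))"
      unfolding N_def
    proof (subst integrable_density)
      show "integrable lebesgue (\<lambda>y. \<phi> (x - y) *\<^sub>R norm (D1 y))"
        using integrable_norm[OF \<phi>D1[of x]] mp(1) by simp
    qed (auto simp: mp(1))
    have "norm (M x) \<le> (LINT y|lebesgue. norm (\<phi> (x - y) *\<^sub>R D1 y))"
      unfolding M_eq[OF x] by (rule integral_norm_bound)
    also have "\<dots> = (LINT y|N. norm (D1 y))"
      unfolding N_def by (subst integral_density) (auto simp: mp(1))
    finally have "norm (M x) powr p \<le> (LINT y|N. norm (D1 y)) powr p"
      using p by (intro powr_mono2) auto
    then have "ennreal (norm (M x) powr p) \<le> ennreal ((LINT y|N. norm (D1 y)) powr p)" by (rule ennreal_leI)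
    also have "\<dots> \<le> (\<integral>\<^sup>+y. ennreal (norm (D1 y) powr p) \<partial>N)"
      by (rule powr_integral_le[OF N int _ p]) simp
    also have "\<dots> = (\<integral>\<^sup>+y. ennreal (\<phi> (x - y)) * g y \<partial>lebesgue)"
      unfolding N_def g_def by (subst nn_integral_density) auto
    also have "\<dots> = (\<integral>\<^sup>+y. ennreal (\<phi> (x - y)) * g' y \<partial>lebesgue)"
      by (rule nn_integral_cong_AE) (use gg'_leb in \<open>auto elim: eventually_mono\<close>)
    finally show ?thesis by (simp add: nn_integral_completion)
  qed
  have "(\<integral>\<^sup>+x\<in>K. ennreal (norm (M x) powr p) \<partial>lborel) \<le> (\<integral>\<^sup>+x. (\<integral>\<^sup>+y. ennreal (\<phi> (x - y)) * g' y \<partial>lborel) \<partial>lborel)"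
    by (intro nn_integral_mono) (auto simp: indicator_def M_powr)
  also have "\<dots> = (\<integral>\<^sup>+y. (\<integral>\<^sup>+x. ennreal (\<phi> (x - y)) * g' y \<partial>lborel) \<partial>lborel)"
    by (rule lborel_pair.Fubini'[symmetric]) measurable
  also have "\<dots> = (\<integral>\<^sup>+y. g' y \<partial>lborel)"
    by (simp add: nn_integral_multc \<phi>_one)
  also have "\<dots> = (\<integral>\<^sup>+y. g y \<partial>lebesgue)"
    by (subst nn_integral_cong_AE[OF gg'_leb]) (simp add: nn_integral_completion)
  also have "\<dots> \<le> (\<integral>\<^sup>+x\<in>\<Omega>. ennreal (norm (D x) powr p) \<partial>lebesgue)"
    by (intro nn_integral_mono) (use K'(2) in \<open>auto simp: g_def D1_def indicator_def\<close>)
  finally show ?thesis using that[OF C1 close] by blast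
qed

section \<open>Radial maps\<close>

definition radial_map :: "(real \<Rightarrow> real) \<Rightarrow> real^2 \<Rightarrow> real^2" where
  "radial_map G x = G (norm x) *\<^sub>R (x /\<^sub>R norm x)"

text \<open>For \<open>x \<noteq> 0\<close> this is the symmetric matrix with eigenvalue \<open>k\<close> in the direction of \<open>x\<close> and
  eigenvalue \<open>l\<close> in the orthogonal direction.\<close>

definition radial_matrix :: "real \<Rightarrow> real \<Rightarrow> real^2 \<Rightarrow> real^2^2" where
  "radial_matrix k l x = (\<chi> i j. (k - l) * (x $ i * x $ j / (norm x)\<^sup>2) + (if i = j then l else 0))"

lemma norm_radial_map: "x \<noteq> 0 \<Longrightarrow> norm (radial_map G x) = \<bar>G (norm x)\<bar>"
  by (simp add: radial_map_def abs_mult)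

lemma radial_matrix_mult: "radial_matrix k l x *v v = l *\<^sub>R v + ((k - l) * (x \<bullet> v) / (norm x)\<^sup>2) *\<^sub>R x"
proof -
  have "(radial_matrix k l x *v v) $ i = (l *\<^sub>R v + ((k - l) * (x \<bullet> v) / (norm x)\<^sup>2) *\<^sub>R x) $ i" for i
    using exhaust_2[of i]
    by (auto simp: radial_matrix_def matrix_vector_mult_def sum_2 inner_vec2 divide_inverse algebra_simps)
  then show ?thesis by (simp add: vec_eq_iff)
qed

lemma norm_radial_matrix:
  assumes "x \<noteq> 0"
  shows "norm (radial_matrix k l x) = sqrt (k\<^sup>2 + l\<^sup>2)"
proof -
  define c s where "c = x $ 1 / norm x" and "s = x $ 2 / norm x"
  have n2: "(x $ 1)\<^sup>2 + (x $ 2)\<^sup>2 = (norm x)\<^sup>2" by (simp add: norm_vec2)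
  have "c\<^sup>2 + s\<^sup>2 = ((x $ 1)\<^sup>2 + (x $ 2)\<^sup>2) / (norm x)\<^sup>2"
    by (simp add: c_def s_def power_divide add_divide_distrib)
  then have cs: "c\<^sup>2 + s\<^sup>2 = 1" unfolding n2 using assms by simp
  have xx: "x $ 1 * x $ 1 / (norm x)\<^sup>2 = c\<^sup>2" "x $ 1 * x $ 2 / (norm x)\<^sup>2 = c * s" "x $ 2 * x $ 1 / (norm x)\<^sup>2 = c * s" "x $ 2 * x $ 2 / (norm x)\<^sup>2 = s\<^sup>2"
    by (simp_all add: c_def s_def power2_eq_square)
  have "(norm (radial_matrix k l x))\<^sup>2 = ((k - l) * c\<^sup>2 + l)\<^sup>2 + ((k - l) * (c * s))\<^sup>2 + ((k - l) * (c * s))\<^sup>2 + ((k - l) * s\<^sup>2 + l)\<^sup>2"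
    unfolding norm_mat2 by (simp add: radial_matrix_def xx del: times_divide_eq_right)
  also have "\<dots> = (k - l)\<^sup>2 * (c\<^sup>2 + s\<^sup>2)\<^sup>2 + 2 * l * (k - l) * (c\<^sup>2 + s\<^sup>2) + 2 * l\<^sup>2"
    by (simp add: power2_eq_square algebra_simps)
  also have "\<dots> = k\<^sup>2 + l\<^sup>2" unfolding cs by (simp add: power2_eq_square algebra_simps)
  finally show ?thesis by (metis norm_ge_zero real_sqrt_unique)
qed

lemma radial_map_has_derivative:
  assumes x: "x \<noteq> 0" and G: "(G has_real_derivative k) (at (norm x))"
  shows "(radial_map G has_derivative (\<lambda>v. radial_matrix k (G (norm x) / norm x) x *v v)) (at x)"
proof -
  have n: "(norm has_derivative (\<lambda>v. x \<bullet> v / norm x)) (at x)"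
    using has_derivative_norm[OF x] by (simp add: sgn_div_norm inner_commute divide_inverse mult.commute)
  have q: "((\<lambda>s. G s / s) has_real_derivative (k * norm x - G (norm x)) / (norm x * norm x)) (at (norm x))"
    using DERIV_divide[OF G DERIV_ident] x by simp
  have "((\<lambda>y. G (norm y) / norm y) has_derivative (\<lambda>v. x \<bullet> v / norm x * ((k * norm x - G (norm x)) / (norm x * norm x)))) (at x)"
    by (rule DERIV_compose_FDERIV[OF q n])
  then have "((\<lambda>y. (G (norm y) / norm y) *\<^sub>R y) has_derivative
     (\<lambda>v. (G (norm x) / norm x) *\<^sub>R v + (x \<bullet> v / norm x * ((k * norm x - G (norm x)) / (norm x * norm x))) *\<^sub>R x)) (at x)"
    by (rule has_derivative_scaleR[OF _ has_derivative_ident])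
  moreover have "x \<bullet> v / norm x * ((k * norm x - G (norm x)) / (norm x * norm x)) = (k - G (norm x) / norm x) * (x \<bullet> v) / (norm x)\<^sup>2" for v
    using x by (simp add: field_simps power2_eq_square)
  moreover have "(\<lambda>y. (G (norm y) / norm y) *\<^sub>R y) = radial_map G"
    by (simp add: fun_eq_iff radial_map_def divide_inverse)
  ultimately show ?thesis
    unfolding radial_matrix_mult by (simp only:)
qed

lemma power_mult_powr: "0 < (a::real) \<Longrightarrow> (a ^ n) powr p = (a powr p) ^ n"
  by (simp add: powr_realpow[symmetric] powr_powr mult.commute)

text \<open>On the dyadic shell between the radii \<open>R / 2 ^ Suc n\<close> and \<open>R / 2 ^ n\<close> the integrand is at most
  \<open>(R / 2 ^ Suc n) powr (- p)\<close> while the area is of order \<open>4 ^ (- n)\<close>. The resulting geometric series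
  has ratio \<open>2 powr p / 4\<close>, which is where \<open>p < 2\<close> is used.\<close>

lemma integral_norm_powr_finite:
  assumes R: "0 < R" and p: "p < 2" "0 \<le> p"
  shows "(\<integral>\<^sup>+x\<in>ball (0::real^2) R. ennreal (norm x powr (- p)) \<partial>lborel) < \<infinity>"
proof -
  define c where "c n = (R / 2 ^ Suc n) powr (- p)" for n :: nat
  have c: "0 \<le> c n" for n by (simp add: c_def)
  have pt: "indicator (ball 0 R) x * ennreal (norm x powr (- p)) \<le> (\<Sum>n. ennreal (c n) * indicator (cball 0 (R / 2 ^ n)) x)"
    if "norm x < R" "x \<noteq> 0" for x :: "real^2"
  proof -
    have ex: "\<exists>m. (1/2) ^ m < norm x / R"
      using real_arch_pow_inv[of "norm x / R" "1/2"] that R by simp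
    define m where "m = (LEAST m. (1/2::real) ^ m < norm x / R)"
    have m: "(1/2) ^ m < norm x / R" unfolding m_def by (rule LeastI_ex[OF ex])
    have "m \<noteq> 0" using m that R by (intro notI) (simp add: less_divide_eq)
    then obtain n where n: "m = Suc n" by (cases m) auto
    have "\<not> (1/2) ^ n < norm x / R" using not_less_Least[of n "\<lambda>m. (1/2::real) ^ m < norm x / R"] n unfolding m_def by simp
    then have x1: "x \<in> cball 0 (R / 2 ^ n)" using R by (simp add: power_one_over not_less field_simps)
    have x2: "R / 2 ^ Suc n \<le> norm x" using m n R by (simp add: power_one_over field_simps)
    have "norm x powr (- p) \<le> c n"
      unfolding c_def using x2 R p by (intro powr_mono2') auto
    then have "indicator (ball 0 R) x * ennreal (norm x powr (- p)) \<le> ennreal (c n) * indicator (cball 0 (R / 2 ^ n)) x"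
      using x1 by (auto simp: indicator_def intro: ennreal_leI)
    also have "\<dots> \<le> (\<Sum>n. ennreal (c n) * indicator (cball 0 (R / 2 ^ n)) x)"
    proof -
      define f where "f n = ennreal (c n) * indicator (cball 0 (R / 2 ^ n)) x" for n
      have "sum f {n} \<le> suminf f" by (intro sum_le_suminf summableI) auto
      then have "f n \<le> suminf f" by simp
      then show ?thesis unfolding f_def .
    qed
    finally show ?thesis .
  qed
  have [measurable]: "cball (0::real^2) s \<in> sets borel" for s by simp
  have "(\<integral>\<^sup>+x\<in>ball (0::real^2) R. ennreal (norm x powr (- p)) \<partial>lborel) \<le> (\<integral>\<^sup>+x. (\<Sum>n. ennreal (c n) * indicator (cball 0 (R / 2 ^ n)) (x::real^2)) \<partial>lborel)"
  proof (rule nn_integral_mono)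
    fix x :: "real^2"
    show "ennreal (norm x powr (- p)) * indicator (ball 0 R) x \<le> (\<Sum>n. ennreal (c n) * indicator (cball 0 (R / 2 ^ n)) x)"
      using pt[of x] by (cases "x \<in> ball 0 R \<and> x \<noteq> 0") (auto simp: mult.commute)
  qed
  also have "\<dots> = (\<Sum>n. (\<integral>\<^sup>+x. ennreal (c n) * indicator (cball 0 (R / 2 ^ n)) (x::real^2) \<partial>lborel))"
    by (rule nn_integral_suminf) measurable
  also have "\<dots> = (\<Sum>n. ennreal (c n * (unit_ball_vol 2 * (R / 2 ^ n)\<^sup>2)))"
    using R by (simp add: nn_integral_cmult_indicator emeasure_cball ennreal_mult c)
  also have "\<dots> < \<infinity>"
  proof -
    have "c n * (unit_ball_vol 2 * (R / 2 ^ n)\<^sup>2) = (R powr (-p) * 2 powr p * unit_ball_vol 2 * R\<^sup>2) * ((2 powr p) / 4) ^ n" for n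
    proof -
      have "c n = R powr (-p) * (2 powr p) ^ Suc n"
        using R by (simp add: c_def powr_divide powr_minus_divide power_mult_powr del: power_Suc)
      moreover have "(R / 2 ^ n)\<^sup>2 = R\<^sup>2 * (1 / 4) ^ n"
        by (simp add: power_divide power_one_over power2_eq_square flip: power_mult_distrib)
      moreover have "(2 ^ n :: real)\<^sup>2 = (2\<^sup>2) ^ n" by (simp only: power_mult[symmetric] mult.commute)
      ultimately show ?thesis by (simp add: power_divide)
    qed
    moreover have "2 powr p < 2 powr (2::real)" using p by (intro powr_less_mono) auto
    then have "\<bar>(2 powr p) / 4\<bar> < 1" by simp
    then have "summable (\<lambda>n. (R powr (-p) * 2 powr p * unit_ball_vol 2 * R\<^sup>2) * ((2 powr p) / 4) ^ n)"
      by (intro summable_mult summable_geometric) simp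
    ultimately have s: "summable (\<lambda>n. c n * (unit_ball_vol 2 * (R / 2 ^ n)\<^sup>2))" by (simp only:)
    have "(\<Sum>n. ennreal (c n * (unit_ball_vol 2 * (R / 2 ^ n)\<^sup>2))) \<noteq> top"
      by (rule ennreal_suminf_neq_top[OF s]) (simp add: c)
    then show ?thesis by (simp add: less_top)
  qed
  finally show ?thesis .
qed

lemma winding_number_homotopy:
  fixes h :: "real \<times> real \<Rightarrow> real^2"
  assumes cont: "continuous_on ({0..1} \<times> {0..1}) h"
    and ne: "\<And>s t. s \<in> {0..1} \<Longrightarrow> t \<in> {0..1} \<Longrightarrow> h (s, t) \<noteq> 0"
    and loop: "\<And>s. s \<in> {0..1} \<Longrightarrow> h (s, 1) = h (s, 0)"
  shows "winding_number (\<lambda>t. to_complex (h (0, t))) 0 = winding_number (\<lambda>t. to_complex (h (1, t))) 0"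
proof (rule winding_number_homotopic_loops)
  show "homotopic_loops (- {0}) (\<lambda>t. to_complex (h (0, t))) (\<lambda>t. to_complex (h (1, t)))"
    unfolding homotopic_loops
  proof (intro exI[of _ "\<lambda>z. to_complex (h z)"] conjI ballI)
    show "continuous_on ({0..1} \<times> {0..1}) (\<lambda>z. to_complex (h z))"
      by (rule bounded_linear.continuous_on[OF bounded_linear_to_complex cont])
    have "to_complex (h z) \<noteq> 0" if "z \<in> {0..1} \<times> {0..1}" for z
    proof -
      have "norm (h z) \<noteq> 0" using ne[of "fst z" "snd z"] that by auto
      then show ?thesis by (metis norm_to_complex norm_zero)
    qed
    then show "(\<lambda>z. to_complex (h z)) \<in> {0..1} \<times> {0..1} \<rightarrow> - {0}" by blast
    show "pathfinish ((\<lambda>z. to_complex (h z)) \<circ> Pair s) = pathstart ((\<lambda>z. to_complex (h z)) \<circ> Pair s)" if "s \<in> {0..1}" for s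
      using loop[OF that] by (simp add: pathfinish_def pathstart_def)
  qed auto
qed

lemma to_complex_circ: "to_complex (\<rho> *\<^sub>R circ t) = circlepath 0 \<rho> t"
proof -
  have "exp (2 * of_real pi * \<i> * of_real t) = cis (2 * pi * t)"
    by (simp add: cis_conv_exp mult_ac)
  then show ?thesis
    unfolding circlepath by (simp add: to_complex_def circ_nth complex_eq_iff)
qed

lemma circ_one: "circ 1 = circ 0"
  by (simp add: circ_def)

lemma open_annulus: "open (annulus r R)"
  unfolding annulus_def by (intro open_Collect_conj open_Collect_less continuous_intros)

text \<open>The value at the outer radius belongs to the profile, so that \<open>radial_map\<close> also describes the
  continuous extension to the outer circle.\<close>

locale radial_profile =
  fixes r R r' R' :: real and G :: "real \<Rightarrow> real"
  assumes radii: "0 \<le> r" "r < R" "0 \<le> r'"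
    and G_cont: "continuous_on {r<..R} G"
    and G_strict_mono: "\<And>s t. r < s \<Longrightarrow> s < t \<Longrightarrow> t \<le> R \<Longrightarrow> G s < G t"
    and G_inner: "(G \<longlongrightarrow> r') (at_right r)"
    and G_outer: "G R = R'"
begin

lemma profile_gt_inner:
  assumes s: "r < s" "s \<le> R"
  shows "r' < G s"
proof -
  define m where "m = (r + s) / 2"
  have m: "r < m" "m < s" using s by (auto simp: m_def)
  have "\<forall>\<^sub>F u in at_right r. G u \<le> G m"
    using eventually_at_right_less[of r] eventually_at_right_field[of "\<lambda>u. u < m" r] m
    by (auto simp: eventually_at_right_field intro!: exI[of _ m] less_imp_le G_strict_mono order_trans[OF less_imp_le s(2)])
  then have "r' \<le> G m"
    by (intro tendsto_upperbound[OF G_inner]) auto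
  also have "G m < G s" using m s by (intro G_strict_mono) auto
  finally show ?thesis .
qed

lemma profile_lt_outer: "r < s \<Longrightarrow> s < R \<Longrightarrow> G s < R'"
  using G_strict_mono[of s R] G_outer by simp

lemma radial_map_continuous: "continuous_on (annulus r R \<union> sphere 0 R) (radial_map G)"
proof -
  have "continuous_on (annulus r R \<union> sphere 0 R) (\<lambda>x. G (norm x))"
    by (rule continuous_on_compose2[OF G_cont]) (use radii in \<open>auto simp: annulus_def intro!: continuous_intros\<close>)
  then show ?thesis
    unfolding radial_map_def[abs_def] using radii
    by (intro continuous_intros) (auto simp: annulus_def)
qed

lemma norm_radial_map_profile:
  assumes "x \<in> annulus r R"
  shows "norm (radial_map G x) = G (norm x)" "x \<noteq> 0"
proof -
  show "x \<noteq> 0" using assms radii by (auto simp: annulus_def)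
  then show "norm (radial_map G x) = G (norm x)"
    using profile_gt_inner[of "norm x"] assms radii by (simp add: norm_radial_map annulus_def)
qed

lemma radial_map_inj: "inj_on (radial_map G) (annulus r R)"
proof (rule inj_onI)
  fix x y assume xy: "x \<in> annulus r R" "y \<in> annulus r R" "radial_map G x = radial_map G y"
  then have "G (norm x) = G (norm y)" using norm_radial_map_profile by metis
  moreover have "r < norm x" "norm x \<le> R" "r < norm y" "norm y \<le> R" using xy by (auto simp: annulus_def)
  ultimately have n: "norm x = norm y"
    using G_strict_mono[of "norm x" "norm y"] G_strict_mono[of "norm y" "norm x"] by (metis less_irrefl linorder_neqE_linordered_idom)
  have "G (norm x) \<noteq> 0" "norm x \<noteq> 0" using profile_gt_inner[of "norm x"] xy radii by (auto simp: annulus_def)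
  then show "x = y" using xy(3) unfolding radial_map_def n by simp
qed

lemma radial_map_image: "radial_map G ` annulus r R = annulus r' R'"
proof
  show "radial_map G ` annulus r R \<subseteq> annulus r' R'"
    using norm_radial_map_profile(1) profile_gt_inner profile_lt_outer by (auto simp: annulus_def less_imp_le)
  show "annulus r' R' \<subseteq> radial_map G ` annulus r R"
  proof
    fix y assume y: "y \<in> annulus r' R'"
    then have y0: "y \<noteq> 0" "r' < norm y" "norm y < R'" using radii by (auto simp: annulus_def)
    have "\<forall>\<^sub>F u in at_right r. G u < norm y" using order_tendstoD(2)[OF G_inner y0(2)] .
    then obtain b where b: "b > r" "\<And>u. r < u \<Longrightarrow> u < b \<Longrightarrow> G u < norm y"
      unfolding eventually_at_right_field by auto
    define u where "u = (r + min b R) / 2"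
    have u: "r < u" "u < b" "u < R" using b(1) radii by (auto simp: u_def)
    have "\<exists>s\<ge>u. s \<le> R \<and> G s = norm y"
      using b(2)[OF u(1,2)] y0 G_outer u
      by (intro IVT' continuous_on_subset[OF G_cont]) auto
    then obtain s where s: "u \<le> s" "s \<le> R" "G s = norm y" by blast
    then have "s \<noteq> R" using G_outer y0 by auto
    define x where "x = s *\<^sub>R (y /\<^sub>R norm y)"
    have nx: "norm x = s" using y0 s u radii by (simp add: x_def)
    then have "x \<in> annulus r R" using s u \<open>s \<noteq> R\<close> by (simp add: annulus_def)
    moreover have "radial_map G x = y"
    proof -
      have "s \<noteq> 0" using s(1) u(1) radii by simp
      then have "x /\<^sub>R s = y /\<^sub>R norm y" by (simp add: x_def)
      then show ?thesis unfolding radial_map_def nx s(3) using y0(1) by simp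
    qed
    ultimately show "y \<in> radial_map G ` annulus r R" by blast
  qed
qed

lemma radial_map_homeomorphism: "\<exists>g. homeomorphism (annulus r R) (annulus r' R') (radial_map G) g"
proof -
  have "continuous_on (annulus r R) (radial_map G)"
    using radial_map_continuous continuous_on_subset by blast
  then obtain g where "homeomorphism (annulus r R) (radial_map G ` annulus r R) (radial_map G) g"
    using invariance_of_domain_homeomorphism[OF open_annulus _ _ radial_map_inj] by blast
  then show ?thesis unfolding radial_map_image by blast
qed

lemma radial_map_boundary:
  "((\<lambda>x. norm (radial_map G x)) \<longlongrightarrow> r') (filtercomap norm (at_right r))"
  "((\<lambda>x. norm (radial_map G x)) \<longlongrightarrow> R') (filtercomap norm (at_left R))"
proof -
  have "((\<lambda>x. G (norm x)) \<longlongrightarrow> r') (filtercomap norm (at_right r))" for x :: "real^2"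
    by (rule filterlim_compose[OF G_inner filterlim_filtercomap])
  moreover have "\<forall>\<^sub>F x::real^2 in filtercomap norm (at_right r). norm (radial_map G x) = G (norm x)"
    unfolding eventually_filtercomap
  proof (intro exI[of _ "\<lambda>s. r < s \<and> s < R"] conjI allI impI)
    show "\<forall>\<^sub>F s in at_right r. r < s \<and> s < R" using radii by (auto simp: eventually_at_right_field)
  qed (use norm_radial_map_profile in \<open>simp add: annulus_def\<close>)
  ultimately show "((\<lambda>x. norm (radial_map G x)) \<longlongrightarrow> r') (filtercomap norm (at_right r))"
    using tendsto_cong by force
  have "continuous_on {(r + R) / 2..R} G"
    using G_cont radii by (auto elim: continuous_on_subset)
  then have "(G \<longlongrightarrow> G R) (at R within {(r + R) / 2..R})"
    using radii by (auto simp: continuous_on_def)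
  then have "(G \<longlongrightarrow> R') (at_left R)"
    using radii by (simp add: at_within_Icc_at_left G_outer)
  then have "((\<lambda>x. G (norm x)) \<longlongrightarrow> R') (filtercomap norm (at_left R))" for x :: "real^2"
    by (rule filterlim_compose[OF _ filterlim_filtercomap])
  moreover have "\<forall>\<^sub>F x::real^2 in filtercomap norm (at_left R). norm (radial_map G x) = G (norm x)"
    unfolding eventually_filtercomap
  proof (intro exI[of _ "\<lambda>s. r < s \<and> s < R"] conjI allI impI)
    show "\<forall>\<^sub>F s in at_left R. r < s \<and> s < R" using radii by (auto simp: eventually_at_left_field)
  qed (use norm_radial_map_profile in \<open>simp add: annulus_def\<close>)
  ultimately show "((\<lambda>x. norm (radial_map G x)) \<longlongrightarrow> R') (filtercomap norm (at_left R))"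
    using tendsto_cong by force
qed

text \<open>The maps \<open>(1 - s) *\<^sub>R x + s *\<^sub>R radial_map G x\<close> are again radial with strictly increasing positive
  profiles, hence injective. So the image of a circle around \<open>a\<close> never meets the image of \<open>a\<close> along this
  homotopy from the identity, and the winding number stays \<open>1\<close>.\<close>

lemma radial_map_orientation: "orientation_preserving_on (annulus r R) (radial_map G)"
  unfolding orientation_preserving_on_def circ_def[symmetric]
proof (intro ballI allI impI)
  fix a \<rho> assume a: "a \<in> annulus r R" and \<rho>: "(0::real) < \<rho>" and sub: "cball a \<rho> \<subseteq> annulus r R"
  have on: "a + \<rho> *\<^sub>R circ t \<in> annulus r R" for t
    using sub \<rho> by (auto simp: dist_norm)
  define k where "k s x = (1 - s) *\<^sub>R x + s *\<^sub>R radial_map G x" for s x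
  have k_radial: "k s x = radial_map (\<lambda>u. (1 - s) * u + s * G u) x" if "x \<in> annulus r R" for s x
  proof -
    have "norm x * inverse (norm x) = 1" using norm_radial_map_profile(2)[OF that] by simp
    then have "((1 - s) * norm x + s * G (norm x)) * inverse (norm x) = (1 - s) + s * (G (norm x) * inverse (norm x))"
      by (simp add: distrib_right mult.assoc)
    then show ?thesis by (simp add: k_def radial_map_def scaleR_left_distrib)
  qed
  have k_inj: "k s (a + \<rho> *\<^sub>R circ t) \<noteq> k s a" if s: "0 \<le> s" "s \<le> 1" for s t
  proof
    assume eq: "k s (a + \<rho> *\<^sub>R circ t) = k s a"
    define F where "F u = (1 - s) * u + s * G u" for u
    have F_pos: "0 < F u" if "r < u" "u \<le> R" for u
    proof -
      have "0 < u" "0 < G u" using that radii profile_gt_inner[OF that] by auto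
      then show ?thesis unfolding F_def using s
        by (cases "s = 0") (auto intro!: add_nonneg_pos)
    qed
    have F_mono: "F u < F v" if "r < u" "u < v" "v \<le> R" for u v
    proof (cases "s = 0")
      case False
      have "(1 - s) * u \<le> (1 - s) * v" "s * G u < s * G v"
        using s that False by (auto intro!: mult_left_mono G_strict_mono)
      then show ?thesis by (simp add: F_def)
    qed (use that in \<open>simp add: F_def\<close>)
    let ?b = "a + \<rho> *\<^sub>R circ t"
    have nb: "r < norm ?b" "norm ?b \<le> R" "?b \<noteq> 0" and na: "r < norm a" "norm a \<le> R" "a \<noteq> 0"
      using on[of t] a radii by (auto simp: annulus_def)
    have eqF: "radial_map F ?b = radial_map F a"
      using eq k_radial[OF on] k_radial[OF a] unfolding F_def by simp
    then have "F (norm ?b) = F (norm a)"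
      using norm_radial_map[OF nb(3), of F] norm_radial_map[OF na(3), of F] F_pos[OF nb(1,2)] F_pos[OF na(1,2)] by simp
    then have n: "norm ?b = norm a"
      using F_mono[of "norm ?b" "norm a"] F_mono[of "norm a" "norm ?b"] na nb by (metis less_irrefl linorder_neqE_linordered_idom)
    have "?b = a" using eqF F_pos[OF na(1,2)] na(3) unfolding radial_map_def n by simp
    then show False using \<rho> norm_circ[of t] by (metis add_cancel_right_right norm_zero scaleR_eq_0_iff less_irrefl zero_neq_one)
  qed
  define h where "h z = k (fst z) (a + \<rho> *\<^sub>R circ (snd z)) - k (fst z) a" for z
  have "winding_number (\<lambda>t. to_complex (h (0, t))) 0 = winding_number (\<lambda>t. to_complex (h (1, t))) 0"
  proof (rule winding_number_homotopy)
    have "continuous_on ({0..1} \<times> {0..1}) (\<lambda>z. radial_map G (a + \<rho> *\<^sub>R circ (snd z)))"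
      by (rule continuous_on_compose2[OF radial_map_continuous])
        (use on in \<open>auto intro!: continuous_intros continuous_on_compose2[OF continuous_on_circ(1)[of UNIV]]\<close>)
    then show "continuous_on ({0..1} \<times> {0..1}) h"
      unfolding h_def k_def
      by (intro continuous_intros continuous_on_compose2[OF continuous_on_circ(1)[of UNIV]]) auto
  qed (use k_inj in \<open>auto simp: h_def circ_one\<close>)
  moreover have "(\<lambda>t. to_complex (h (0, t))) = circlepath 0 \<rho>"
    by (simp add: fun_eq_iff h_def k_def to_complex_circ)
  moreover have "winding_number (circlepath 0 \<rho>) 0 = 1"
    using \<rho> by (rule winding_number_circlepath_centre)
  moreover have "(\<lambda>t. to_complex (h (1, t))) = (\<lambda>t. to_complex (radial_map G (a + \<rho> *\<^sub>R circ t)) - to_complex (radial_map G a))"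
    using bounded_linear.linear[OF bounded_linear_to_complex]
    by (simp add: h_def k_def linear_diff)
  ultimately show "winding_number (\<lambda>t. to_complex (radial_map G (a + \<rho> *\<^sub>R circ t))) (to_complex (radial_map G a)) = 1"
    by (subst winding_number_offset) simp
qed

lemma radial_map_in_classes:
  assumes "radial_map G \<in> Sobolev_W1 p (annulus r R)"
  shows "radial_map G \<in> Sobolev_homeos_Id p r R r' R'" and "radial_map G \<in> radial_Sobolev_homeos p r R r' R'"
proof -
  have h: "radial_map G \<in> Sobolev_homeos p r R r' R'"
    unfolding Sobolev_homeos_def
    using radial_map_homeomorphism radial_map_orientation radial_map_boundary assms by blast
  have "radial_map G x = (R' / R) *\<^sub>R x" if "x \<in> sphere 0 R" for x
    using that by (simp add: radial_map_def G_outer divide_inverse)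
  then show "radial_map G \<in> Sobolev_homeos_Id p r R r' R'"
    unfolding Sobolev_homeos_Id_def using h radial_map_continuous by blast
  show "radial_map G \<in> radial_Sobolev_homeos p r R r' R'"
    unfolding radial_Sobolev_homeos_def using h radial_map_def by blast
qed

end

section \<open>Energy of radial maps\<close>

lemma hs_norm_eq_norm: "hs_norm M = norm M"
proof -
  have "trace (transpose M ** M) = (norm M)\<^sup>2"
    unfolding norm_mat2 by (simp add: trace_def matrix_matrix_mult_def transpose_def sum_2 power2_eq_square)
  then show ?thesis by (simp add: hs_norm_def)
qed

lemma p_energy_eq:
  assumes \<Omega>: "open \<Omega>" and D: "has_weak_differential \<Omega> h D"
  shows "p_energy p \<Omega> h = (\<integral>\<^sup>+x\<in>\<Omega>. ennreal (norm (D x) powr p) \<partial>lebesgue)"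
proof -
  have "has_weak_differential \<Omega> h (weak_differential \<Omega> h)"
    unfolding weak_differential_def by (rule someI[of "has_weak_differential \<Omega> h", OF D])
  then have "AE x in lebesgue. x \<in> \<Omega> \<longrightarrow> weak_differential \<Omega> h x = D x"
    using weak_differential_unique[OF \<Omega> _ D] by blast
  then show ?thesis
    unfolding p_energy_def hs_norm_eq_norm
    by (intro nn_integral_cong_AE) (auto elim!: eventually_mono simp: indicator_def)
qed

lemma Lp_on_annulus_if_norm_le:
  fixes g :: "real^2 \<Rightarrow> 'a::euclidean_space"
  assumes r: "0 \<le> r" "r < R" and p: "1 \<le> p" "p < 2"
    and meas: "(\<lambda>x. indicator (annulus r R) x *\<^sub>R g x) \<in> borel_measurable lebesgue"
    and le: "\<And>x. x \<in> annulus r R \<Longrightarrow> norm (g x) \<le> c / norm x" and c: "0 \<le> c"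
  shows "Lp_on p (annulus r R) g"
  unfolding Lp_on_def set_borel_measurable_def set_integrable_def
proof
  show "(\<lambda>x. indicator (annulus r R) x *\<^sub>R g x) \<in> borel_measurable lebesgue" by fact
  have eq: "indicator (annulus r R) x *\<^sub>R (norm (g x) powr p) = norm (indicator (annulus r R) x *\<^sub>R g x) powr p" for x
    by (simp add: indicator_def)
  show "integrable lebesgue (\<lambda>x. indicator (annulus r R) x *\<^sub>R (norm (g x) powr p))"
  proof (rule integrableI_bounded)
    show "(\<lambda>x. indicator (annulus r R) x *\<^sub>R (norm (g x) powr p)) \<in> borel_measurable lebesgue"
      unfolding eq using meas by measurable
    have "(\<integral>\<^sup>+x. ennreal (norm (indicator (annulus r R) x *\<^sub>R (norm (g x) powr p))) \<partial>lebesgue) \<le>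
       (\<integral>\<^sup>+x. ennreal (c powr p) * (ennreal (norm (x::real^2) powr (- p)) * indicator (ball 0 R) x) \<partial>lebesgue)"
    proof (rule nn_integral_mono)
      fix x :: "real^2"
      show "ennreal (norm (indicator (annulus r R) x *\<^sub>R (norm (g x) powr p))) \<le> ennreal (c powr p) * (ennreal (norm x powr (- p)) * indicator (ball 0 R) x)"
      proof (cases "x \<in> annulus r R")
        case True
        then have x: "0 < norm x" "norm x < R" using r by (auto simp: annulus_def)
        have "norm (g x) powr p \<le> (c / norm x) powr p"
          using le[OF True] p by (intro powr_mono2) auto
        also have "\<dots> = c powr p * norm x powr (- p)"
          using c x by (simp add: powr_divide powr_minus_divide)
        finally show ?thesis using True x by (simp add: ennreal_mult[symmetric] ennreal_leI)
      qed simp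
    qed
    also have "\<dots> = ennreal (c powr p) * (\<integral>\<^sup>+x\<in>ball 0 R. ennreal (norm (x::real^2) powr (- p)) \<partial>lborel)"
    proof -
      have [measurable]: "ball (0::real^2) R \<in> sets borel" by simp
      show ?thesis by (subst nn_integral_completion, subst nn_integral_cmult) simp_all
    qed
    also have "\<dots> < \<infinity>"
      using integral_norm_powr_finite[of R p] r p by (simp add: ennreal_mult_less_top)
    finally show "(\<integral>\<^sup>+x. ennreal (norm (indicator (annulus r R) x *\<^sub>R (norm (g x) powr p))) \<partial>lebesgue) < \<infinity>" .
  qed
qed

text \<open>The exceptional set of radii is countable, so the map is differentiable off countably many circles,
  a null set; away from the origin it is Lipschitz. Integrability follows from the bound
  \<open>(L * R + B) / norm x\<close> on the differential, where \<open>B\<close> bounds \<open>K\<close> on the interval from \<open>0\<close> to \<open>R\<close>.\<close>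

lemma radial_map_weak_differential:
  fixes K k :: "real \<Rightarrow> real"
  assumes r: "0 \<le> r" "r < R" and p: "1 \<le> p" "p < 2"
    and lip: "\<And>s t. \<bar>K s - K t\<bar> \<le> L * \<bar>s - t\<bar>"
    and N: "countable N" and deriv: "\<And>s. r < s \<Longrightarrow> s < R \<Longrightarrow> s \<notin> N \<Longrightarrow> (K has_real_derivative k s) (at s)"
    and k: "\<And>s. r < s \<Longrightarrow> s < R \<Longrightarrow> \<bar>k s\<bar> \<le> L"
  shows "has_weak_differential (annulus r R) (radial_map K) (\<lambda>x. radial_matrix (k (norm x)) (K (norm x) / norm x) x)"
    and "radial_map K \<in> Sobolev_W1 p (annulus r R)"
proof -
  let ?\<Omega> = "annulus r R"
  define D where "D x = radial_matrix (k (norm x)) (K (norm x) / norm x) x" for x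
  define E where "E = {x::real^2. norm x \<in> N}"
  have L: "0 \<le> L" using order_trans[OF abs_ge_zero lip[of 0 1]] by simp
  define B where "B = \<bar>K 0\<bar> + L * R"
  have K_bdd: "\<bar>K s\<bar> \<le> B" if "0 \<le> s" "s \<le> R" for s
  proof -
    have "L * \<bar>s - 0\<bar> \<le> L * R" using that L by (intro mult_left_mono) auto
    then show ?thesis using lip[of s 0] by (simp add: B_def)
  qed
  have B: "0 \<le> B" using K_bdd[of 0] r by simp
  have x0: "x \<noteq> 0" "r < norm x" "norm x < R" if "x \<in> ?\<Omega>" for x
    using that r by (auto simp: annulus_def)
  have "E = (\<Union>s\<in>N. sphere 0 s)" by (auto simp: E_def)
  moreover have "negligible (\<Union>s\<in>N. sphere (0::real^2) s)"
    by (intro negligible_countable_Union countable_image N) (auto simp: negligible_sphere)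
  ultimately have E_null: "E \<in> null_sets lebesgue" by (simp add: negligible_iff_null_sets)
  have D_deriv: "(radial_map K has_derivative (\<lambda>v. D x *v v)) (at x)" if "x \<in> ?\<Omega> - E" for x
    unfolding D_def using that x0[of x] by (intro radial_map_has_derivative deriv) (auto simp: E_def)
  have \<Omega>_leb: "?\<Omega> \<in> sets lebesgue" using open_annulus by auto
  have D_meas: "(\<lambda>x. indicator ?\<Omega> x *\<^sub>R D x) \<in> borel_measurable lebesgue"
  proof -
    have S: "?\<Omega> - E \<in> sets lebesgue" using \<Omega>_leb E_null by auto
    have "(\<lambda>x. matrix (\<lambda>v. D x *v v) $ i $ j) \<in> borel_measurable (lebesgue_on (?\<Omega> - E))" for i j
      by (rule borel_measurable_partial_derivatives[OF S, of "radial_map K"])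
        (use D_deriv has_derivative_at_withinI in blast)
    then have comp: "(\<lambda>x. indicator (?\<Omega> - E) x *\<^sub>R (D x $ i $ j)) \<in> borel_measurable lebesgue" for i j
      using S by (simp add: borel_measurable_restrict_space_iff mult.commute)
    have "(\<lambda>x. indicator (?\<Omega> - E) x *\<^sub>R D x) \<in> borel_measurable lebesgue"
      unfolding borel_measurable_euclidean_space[of "\<lambda>x. indicator (?\<Omega> - E) x *\<^sub>R D x"]
    proof
      fix b :: "real^2^2" assume "b \<in> Basis"
      then obtain i j where "b = axis i (axis j 1)" by (auto simp: Basis_vec_def)
      then show "(\<lambda>x. (indicator (?\<Omega> - E) x *\<^sub>R D x) \<bullet> b) \<in> borel_measurable lebesgue"
        using comp[of i j] by (simp add: inner_axis)
    qed
    then show ?thesis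
    proof (rule borel_measurable_AE)
      show "AE x in lebesgue. indicator (?\<Omega> - E) x *\<^sub>R D x = indicator ?\<Omega> x *\<^sub>R D x"
        using AE_not_in[OF E_null] by eventually_elim (simp add: indicator_def)
    qed
  qed
  have D_norm: "norm (D x) \<le> (L * R + B) / norm x" if x: "x \<in> ?\<Omega>" for x
  proof -
    have "norm (D x) \<le> \<bar>k (norm x)\<bar> + \<bar>K (norm x) / norm x\<bar>"
      unfolding D_def norm_radial_matrix[OF x0(1)[OF x]] by (rule sqrt_sum_squares_le_sum_abs)
    also have "\<dots> \<le> L + B / norm x"
      using x0[OF x] k[of "norm x"] K_bdd[of "norm x"] by (intro add_mono) (auto simp: divide_right_mono)
    also have "L \<le> L * R / norm x"
      using x0[OF x] L by (simp add: pos_le_divide_eq mult_left_mono)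
    finally show ?thesis by (simp add: add_divide_distrib)
  qed
  show weak: "has_weak_differential ?\<Omega> (radial_map K) (\<lambda>x. radial_matrix (k (norm x)) (K (norm x) / norm x) x)"
    unfolding D_def[symmetric]
  proof (rule has_weak_differential_if_locally_lipschitz[OF open_annulus _ _ D_meas])
    show "AE x in lebesgue. x \<in> ?\<Omega> \<longrightarrow> (radial_map K has_derivative (\<lambda>v. D x *v v)) (at x)"
      using AE_not_in[OF E_null] by eventually_elim (use D_deriv in blast)
    fix C assume C: "compact C" "C \<subseteq> ?\<Omega>"
    obtain d where d: "d > 0" "\<And>x. x \<in> C \<Longrightarrow> d \<le> norm x"
    proof (cases "C = {}")
      case False
      obtain x where "x \<in> C" "\<forall>y\<in>C. norm x \<le> norm y"
        using continuous_attains_inf[OF C(1) False, of norm] continuous_on_norm_id by blast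
      then show ?thesis using that[of "norm x"] x0(1) C(2) by auto
    qed (use that[of 1] in auto)
    show "\<exists>B. \<forall>x\<in>C. norm (D x) \<le> B"
    proof (intro exI ballI)
      fix x assume "x \<in> C"
      then have "norm (D x) \<le> (L * R + B) / norm x" "d \<le> norm x" using D_norm C(2) d(2) by auto
      moreover have "0 < norm x" using \<open>d \<le> norm x\<close> d(1) by linarith
      then have "(L * R + B) / norm x \<le> (L * R + B) / d"
        using \<open>d \<le> norm x\<close> d(1) L B r by (intro divide_left_mono mult_pos_pos) auto
      ultimately show "norm (D x) \<le> (L * R + B) / d" by linarith
    qed
    show "\<exists>\<delta>>0. \<exists>L\<ge>0. \<forall>x\<in>C. \<forall>y. norm (y - x) \<le> \<delta> \<longrightarrow> norm (radial_map K y - radial_map K x) \<le> L * norm (y - x)"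
    proof (rule exI[of _ "d / 2"], intro conjI exI[of _ "L + 4 * B / d"] ballI allI impI)
      fix x y assume x: "x \<in> C" and y: "norm (y - x) \<le> d / 2"
      have nx: "d \<le> norm x" "norm x < R" using d(2) x x0 C(2) by auto
      have ny: "d / 2 \<le> norm y" using norm_triangle_ineq2[of x y] y nx by (simp add: norm_minus_commute)
      have ny0: "0 < norm y" "0 < norm x" using ny nx d(1) by linarith+
      have eq: "radial_map K y - radial_map K x = (K (norm y) - K (norm x)) *\<^sub>R (y /\<^sub>R norm y) + K (norm x) *\<^sub>R (y /\<^sub>R norm y - x /\<^sub>R norm x)"
        unfolding radial_map_def by (simp add: algebra_simps)
      have unit: "norm (y /\<^sub>R norm y - x /\<^sub>R norm x) \<le> 2 * norm (y - x) / norm y"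
      proof -
        have "y /\<^sub>R norm y - x /\<^sub>R norm x = (1 / norm y) *\<^sub>R ((y - x) + ((norm x - norm y) / norm x) *\<^sub>R x)"
          using ny0 by (simp add: divide_inverse algebra_simps)
        also have "norm \<dots> \<le> (1 / norm y) * (norm (y - x) + \<bar>norm x - norm y\<bar>)"
          using norm_triangle_ineq[of "y - x" "((norm x - norm y) / norm x) *\<^sub>R x"] ny0
          by (simp add: divide_right_mono)
        also have "\<dots> \<le> (1 / norm y) * (norm (y - x) + norm (y - x))"
          using norm_triangle_ineq3[of x y] by (intro mult_left_mono add_mono) (auto simp: norm_minus_commute)
        finally show ?thesis by simp
      qed
      have "norm (radial_map K y - radial_map K x) \<le> \<bar>K (norm y) - K (norm x)\<bar> + \<bar>K (norm x)\<bar> * norm (y /\<^sub>R norm y - x /\<^sub>R norm x)"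
        unfolding eq by (rule order_trans[OF norm_triangle_ineq]) (use ny0 in \<open>simp add: abs_mult mult.assoc\<close>)
      also have "\<dots> \<le> L * norm (y - x) + B * (2 * norm (y - x) / (d / 2))"
      proof (intro add_mono mult_mono)
        have "L * \<bar>norm y - norm x\<bar> \<le> L * norm (y - x)" using L norm_triangle_ineq3[of y x] by (intro mult_left_mono) auto
        then show "\<bar>K (norm y) - K (norm x)\<bar> \<le> L * norm (y - x)" using lip[of "norm y" "norm x"] by linarith
        show "\<bar>K (norm x)\<bar> \<le> B" using K_bdd nx by simp
        have "2 * norm (y - x) / norm y \<le> 2 * norm (y - x) / (d / 2)"
          using ny ny0 d(1) by (intro divide_left_mono mult_pos_pos) auto
        then show "norm (y /\<^sub>R norm y - x /\<^sub>R norm x) \<le> 2 * norm (y - x) / (d / 2)" using unit by linarith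
      qed (use B in auto)
      also have "\<dots> = (L + 4 * B / d) * norm (y - x)" using d(1) by (simp add: field_simps)
      finally show "norm (radial_map K y - radial_map K x) \<le> (L + 4 * B / d) * norm (y - x)" .
    qed (use d(1) L B in auto)
  qed
  have "L-lipschitz_on UNIV K"
    using lip L by (auto intro!: lipschitz_onI simp: dist_real_def)
  then have K_cont: "continuous_on UNIV K" by (rule lipschitz_on_continuous_on)
  have "continuous_on ?\<Omega> (radial_map K)"
    unfolding radial_map_def[abs_def] using x0(1)
    by (intro continuous_intros continuous_on_compose2[OF K_cont]) auto
  then have "(\<lambda>x. indicator ?\<Omega> x *\<^sub>R radial_map K x) \<in> borel_measurable lborel"
    using borel_measurable_continuous_on_indicator[of ?\<Omega>] open_annulus by simp
  then have h_meas: "(\<lambda>x. indicator ?\<Omega> x *\<^sub>R radial_map K x) \<in> borel_measurable lebesgue"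
    by (rule measurable_completion)
  have "Lp_on p ?\<Omega> (radial_map K)"
  proof (rule Lp_on_annulus_if_norm_le[OF r p h_meas])
    fix x assume x: "x \<in> ?\<Omega>"
    have "\<bar>K (norm x)\<bar> * norm x \<le> B * R"
      using K_bdd[of "norm x"] x0[OF x] B by (intro mult_mono) auto
    then show "norm (radial_map K x) \<le> (B * R) / norm x"
      using x0[OF x] by (simp add: norm_radial_map pos_le_divide_eq)
  qed (use B r in auto)
  moreover have "Lp_on p ?\<Omega> D"
    by (rule Lp_on_annulus_if_norm_le[OF r p D_meas D_norm]) (use L B r in auto)
  ultimately show "radial_map K \<in> Sobolev_W1 p ?\<Omega>"
    unfolding Sobolev_W1_def using weak unfolding D_def[symmetric, abs_def] by blast
qed

section \<open>Averaging over rotations\<close>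

definition rotation :: "real \<Rightarrow> real^2 \<Rightarrow> real^2" where
  "rotation t x = x $ 1 *\<^sub>R circ t + x $ 2 *\<^sub>R circ_perp t"

lemma rotation_nth: "rotation t x $ 1 = x $ 1 * cos (2 * pi * t) - x $ 2 * sin (2 * pi * t)"
    "rotation t x $ 2 = x $ 1 * sin (2 * pi * t) + x $ 2 * cos (2 * pi * t)"
  by (simp_all add: rotation_def circ_nth)

lemma vec2_eq_iff: "(x::real^2) = y \<longleftrightarrow> x $ 1 = y $ 1 \<and> x $ 2 = y $ 2"
  by (simp add: vec_eq_iff forall_2)

lemma rotation_inverse: "rotation (- t) (rotation t x) = x" "rotation t (rotation (- t) x) = x"
proof -
  define c s where "c = cos (2 * pi * t)" and "s = sin (2 * pi * t)"
  have "c * c + s * s = 1" using sin_cos_squared_add2[of "2 * pi * t"] by (simp add: c_def s_def power2_eq_square)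
  then have "a * (c * c) + a * (s * s) = a" for a by (metis distrib_left mult.right_neutral)
  from this[of "x $ 1"] this[of "x $ 2"]
  have "c * (c * x $ 1) + s * (s * x $ 1) = x $ 1" "c * (c * x $ 2) + s * (s * x $ 2) = x $ 2"
    by (simp_all add: mult_ac)
  moreover have "cos (2 * pi * - t) = c" "sin (2 * pi * - t) = - s" by (simp_all add: c_def s_def)
  ultimately show "rotation (- t) (rotation t x) = x" "rotation t (rotation (- t) x) = x"
    unfolding vec2_eq_iff rotation_nth by (simp_all add: c_def[symmetric] s_def[symmetric] algebra_simps)
qed

lemma orthogonal_rotation: "orthogonal_transformation (rotation t)"
  unfolding orthogonal_transformation
proof
  show "linear (rotation t)"
    by (rule linearI) (simp_all add: vec2_eq_iff rotation_nth algebra_simps)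
  define c s where "c = cos (2 * pi * t)" and "s = sin (2 * pi * t)"
  have cs: "c * c + s * s = 1" using sin_cos_squared_add2[of "2 * pi * t"] by (simp add: c_def s_def power2_eq_square)
  have "(a * c - b * s)\<^sup>2 + (a * s + b * c)\<^sup>2 = (a\<^sup>2 + b\<^sup>2) * (c * c + s * s)" for a b
    by (simp add: power2_eq_square algebra_simps)
  then show "\<forall>v. norm (rotation t v) = norm v"
    by (simp add: norm_vec2 rotation_nth c_def[symmetric] s_def[symmetric] cs)
qed

lemma norm_rotation [simp]: "norm (rotation t x) = norm x"
  using orthogonal_rotation by (simp add: orthogonal_transformation)

lemma rotation_circ: "rotation t (\<rho> *\<^sub>R circ s) = \<rho> *\<^sub>R circ (t + s)"
  by (simp add: vec2_eq_iff rotation_nth circ_nth distrib_left cos_add sin_add algebra_simps)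

lemma continuous_rotation: "continuous_on UNIV (\<lambda>(t, x). rotation t x)"
  unfolding rotation_def split_beta
  by (intro continuous_intros continuous_on_compose2[OF continuous_on_circ(1)[of UNIV]]
      continuous_on_compose2[OF continuous_on_circ(2)[of UNIV]]) auto

lemma rotation_measurable [measurable]: "rotation t \<in> borel_measurable borel"
  by (intro borel_measurable_continuous_onI linear_continuous_on)
    (use orthogonal_rotation in \<open>simp add: orthogonal_transformation linear_conv_bounded_linear\<close>)

lemma distr_rotation: "distr lborel borel (rotation t) = (lborel :: (real^2) measure)"
proof (rule lborel_eqI[symmetric])
  fix l u :: "real^2" assume le: "\<And>b. b \<in> Basis \<Longrightarrow> l \<bullet> b \<le> u \<bullet> b"
  have "rotation t -` box l u = rotation (- t) ` box l u"
    using rotation_inverse by (auto simp: image_iff) metis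
  then have "emeasure (distr lborel borel (rotation t)) (box l u) = emeasure lborel (rotation (- t) ` box l u)"
    by (simp add: emeasure_distr)
  also have "\<dots> = emeasure lebesgue (rotation (- t) ` box l u)"
  proof -
    have "rotation (- t) ` box l u \<in> sets borel"
      using \<open>rotation t -` box l u = _\<close> measurable_sets[OF rotation_measurable[of t], of "box l u"] by simp
    then show ?thesis by simp
  qed
  also have "\<dots> = ennreal (measure lebesgue (rotation (- t) ` box l u))"
    by (intro emeasure_eq_measure2 measurable_orthogonal_image[OF orthogonal_rotation]) simp
  also have "measure lebesgue (rotation (- t) ` box l u) = measure lebesgue (box l u)"
    by (rule measure_orthogonal_image[OF orthogonal_rotation]) simp
  also have "\<dots> = prod ((\<bullet>) (u - l)) Basis"
    using le by (simp add: measure_lborel_box_eq)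
  finally show "emeasure (distr lborel borel (rotation t)) (box l u) = ennreal (prod ((\<bullet>) (u - l)) Basis)" .
qed simp

text \<open>Lebesgue measure is rotation invariant, so by Tonelli's theorem the plane integral of \<open>f\<close> equals that
  of its means over circles around the origin. This turns pointwise estimates by circle means into estimates of
  energies.\<close>

lemma nn_integral_rotation_average:
  fixes f F :: "real^2 \<Rightarrow> ennreal"
  assumes f[measurable]: "f \<in> borel_measurable borel"
    and le: "\<And>x. F x \<le> (\<integral>\<^sup>+t\<in>{0..1}. f (rotation t x) \<partial>lborel)"
  shows "(\<integral>\<^sup>+x. F x \<partial>lborel) \<le> (\<integral>\<^sup>+x. f x \<partial>lborel)"
proof -
  have rot: "(\<lambda>z. rotation (fst z) (snd z)) \<in> borel_measurable (borel \<Otimes>\<^sub>M borel)"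
    using borel_measurable_continuous_onI[OF continuous_rotation] by (simp add: borel_prod case_prod_beta')
  have m: "(\<lambda>(x, t). f (rotation t x) * indicator {0..1} t) \<in> borel_measurable (lborel \<Otimes>\<^sub>M lborel)"
  proof -
    have "(\<lambda>(x, t). rotation t x) \<in> borel_measurable (lborel \<Otimes>\<^sub>M lborel)"
      using measurable_compose[OF measurable_Pair[OF measurable_snd measurable_fst] rot]
      by (simp add: split_beta cong: measurable_cong_sets)
    then show ?thesis by measurable
  qed
  have "(\<integral>\<^sup>+x. F x \<partial>lborel) \<le> (\<integral>\<^sup>+x. (\<integral>\<^sup>+t. f (rotation t x) * indicator {0..1} t \<partial>lborel) \<partial>lborel)"
    by (rule nn_integral_mono) (rule le)
  also have "\<dots> = (\<integral>\<^sup>+t. (\<integral>\<^sup>+x. f (rotation t x) * indicator {0..1} t \<partial>lborel) \<partial>lborel)"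
    by (rule lborel_pair.Fubini'[OF m, symmetric])
  also have "\<dots> = (\<integral>\<^sup>+t. (\<integral>\<^sup>+x. f x \<partial>lborel) * indicator {0..1} (t::real) \<partial>lborel)"
  proof (rule nn_integral_cong)
    fix t :: real
    have "(\<integral>\<^sup>+x. f x \<partial>lborel) = (\<integral>\<^sup>+x. f x \<partial>distr lborel borel (rotation t))" by (simp add: distr_rotation)
    also have "\<dots> = (\<integral>\<^sup>+x. f (rotation t x) \<partial>lborel)" by (rule nn_integral_distr) simp_all
    finally show "(\<integral>\<^sup>+x. f (rotation t x) * indicator {0..1} t \<partial>lborel) = (\<integral>\<^sup>+x. f x \<partial>lborel) * indicator {0..1} t"
      by (simp add: nn_integral_multc)
  qed
  also have "\<dots> = (\<integral>\<^sup>+x. f x \<partial>lborel)"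
    by (simp add: nn_integral_cmult)
  finally show ?thesis .
qed

lemma circ_periodic: "circ (t + 1) = circ t"
  by (simp add: vec2_eq_iff circ_nth distrib_left)

lemma exists_circ: "\<exists>s\<in>{0..1}. x = norm x *\<^sub>R circ s"
proof (cases "x = 0")
  case False
  have "(x $ 1 / norm x)\<^sup>2 + (x $ 2 / norm x)\<^sup>2 = ((x $ 1)\<^sup>2 + (x $ 2)\<^sup>2) / (norm x)\<^sup>2"
    by (simp add: power_divide add_divide_distrib)
  also have "(x $ 1)\<^sup>2 + (x $ 2)\<^sup>2 = (norm x)\<^sup>2" by (simp add: norm_vec2)
  also have "(norm x)\<^sup>2 / (norm x)\<^sup>2 = 1" using False by simp
  finally obtain \<theta> where \<theta>: "0 \<le> \<theta>" "\<theta> \<le> 2 * pi" "x $ 1 / norm x = cos \<theta>" "x $ 2 / norm x = sin \<theta>"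
    using sincos_total_2pi_le by blast
  have "x = norm x *\<^sub>R circ (\<theta> / (2 * pi))"
    using False by (simp add: vec2_eq_iff circ_nth \<theta>(3,4)[symmetric])
  moreover have "\<theta> / (2 * pi) \<in> {0..1}" using \<theta> by (simp add: divide_le_eq)
  ultimately show ?thesis by blast
qed (auto intro: bexI[of _ 0])

lemma integral_periodic_shift:
  fixes g :: "real \<Rightarrow> real"
  assumes g: "continuous_on UNIV g" and per: "\<And>t. g (t + 1) = g t" and s: "s \<in> {0..1}"
  shows "integral {0..1} (\<lambda>t. g (t + s)) = integral {0..1} g"
proof -
  have i: "g integrable_on {a..b}" for a b
    by (intro integrable_continuous_real continuous_on_subset[OF g]) simp
  have shift: "integral {a..b} (\<lambda>t. g (t + c)) = integral {a + c..b + c} g" for a b c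
    using integral_shift_Icc_real[of a b g c] by (simp add: o_def add.commute)
  have "integral {0..1} (\<lambda>t. g (t + s)) = integral {s..1 + s} g" using shift[of 0 1 s] by simp
  also have "\<dots> = integral {s..1} g + integral {1..1 + s} g"
    using s by (intro Henstock_Kurzweil_Integration.integral_combine[symmetric] i) auto
  also have "integral {1..1 + s} g = integral {0..s} g"
    using shift[of 0 s 1] by (simp add: per add.commute)
  also have "integral {s..1} g + integral {0..s} g = integral {0..1} g"
    using Henstock_Kurzweil_Integration.integral_combine[of 0 s 1 g] s i by simp
  finally show ?thesis .
qed

context C1_map
begin

lemma circle_norm_nonneg: "0 \<le> circle_norm \<rho>"
  unfolding circle_norm_def by (intro integral_nonneg integrable_continuous_real cont_intros) auto

lemma continuous_circle_norm: "continuous_on UNIV circle_norm"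
proof -
  have "continuous_on UNIV (\<lambda>\<rho>. integral (cbox 0 1) (\<lambda>t. norm (M (\<rho> *\<^sub>R circ t))))"
    by (rule integral_continuous_on_param, unfold split_beta) (intro cont_intros)
  then show ?thesis unfolding circle_norm_def[abs_def] by simp
qed

lemma continuous_circle_mean_deriv: "continuous_on UNIV circle_mean_deriv"
proof -
  have "continuous_on UNIV (\<lambda>\<rho>. integral (cbox 0 1) (\<lambda>t. (M (\<rho> *\<^sub>R circ t) *v circ t) \<bullet> circ t))"
    by (rule integral_continuous_on_param, unfold split_beta) (intro cont_intros)
  then show ?thesis unfolding circle_mean_deriv_def[abs_def] by simp
qed

lemma circle_norm_eq_rotation_average:
  "circle_norm (norm x) = integral {0..1} (\<lambda>t. norm (M (rotation t x)))"
proof -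
  obtain s where s: "s \<in> {0..1}" "x = norm x *\<^sub>R circ s" using exists_circ[of x] by blast
  have "integral {0..1} (\<lambda>t. norm (M (rotation t x))) = integral {0..1} (\<lambda>t. norm (M (norm x *\<^sub>R circ (t + s))))"
    by (subst s(2), subst rotation_circ) simp
  also have "\<dots> = integral {0..1} (\<lambda>t. norm (M (norm x *\<^sub>R circ t)))"
    by (rule integral_periodic_shift[OF _ _ s(1), of "\<lambda>t. norm (M (norm x *\<^sub>R circ t))"])
      (auto simp: circ_periodic intro!: cont_intros)
  finally show ?thesis unfolding circle_norm_def by simp
qed

text \<open>Jensen's inequality for the uniform distribution on the circle through \<open>x\<close>.\<close>

lemma circle_norm_powr_le:
  assumes p: "1 \<le> p"
  shows "ennreal (circle_norm (norm x) powr p) \<le> (\<integral>\<^sup>+t\<in>{0..1}. ennreal (norm (M (rotation t x)) powr p) \<partial>lborel)"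
proof -
  define N where "N = restrict_space lborel {0..1::real}"
  have N: "prob_space N"
    by (rule prob_spaceI) (simp add: N_def space_restrict_space emeasure_restrict_space)
  define f where "f t = norm (M (rotation t x))" for t
  have f: "continuous_on UNIV f"
    unfolding f_def rotation_def by (intro cont_intros)
  have si: "set_integrable lborel {0..1} f"
    by (intro borel_integrable_atLeastAtMost' continuous_on_subset[OF f]) simp
  then have int: "integrable N f"
    unfolding N_def set_integrable_def by (subst integrable_restrict_space) auto
  have "(\<integral>t. f t \<partial>N) = (LINT t:{0..1}|lborel. f t)"
    unfolding N_def set_lebesgue_integral_def by (subst integral_restrict_space) auto
  also have "\<dots> = circle_norm (norm x)"
    unfolding circle_norm_eq_rotation_average f_def[symmetric] by (rule set_borel_integral_eq_integral(2)[OF si])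
  finally have "ennreal (circle_norm (norm x) powr p) \<le> (\<integral>\<^sup>+t. ennreal (f t powr p) \<partial>N)"
    using powr_integral_le[OF N int _ p] by (simp add: f_def)
  also have "\<dots> = (\<integral>\<^sup>+t\<in>{0..1}. ennreal (f t powr p) \<partial>lborel)"
    unfolding N_def by (subst nn_integral_restrict_space) auto
  finally show ?thesis unfolding f_def .
qed

lemma nn_integral_circle_norm_le:
  assumes p: "1 \<le> p"
  shows "(\<integral>\<^sup>+x\<in>{x::real^2. a \<le> norm x \<and> norm x \<le> b}. ennreal (circle_norm (norm x) powr p) \<partial>lborel) \<le>
     (\<integral>\<^sup>+x\<in>{x. a \<le> norm x \<and> norm x \<le> b}. ennreal (norm (M x) powr p) \<partial>lborel)"
proof (rule nn_integral_rotation_average)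
  have [measurable]: "M \<in> borel_measurable borel" by (rule borel_measurable_continuous_onI[OF cont_M])
  show "(\<lambda>x. ennreal (norm (M x) powr p) * indicator {x. a \<le> norm x \<and> norm x \<le> b} x) \<in> borel_measurable borel"
    by measurable
  fix x :: "real^2"
  show "ennreal (circle_norm (norm x) powr p) * indicator {x. a \<le> norm x \<and> norm x \<le> b} x
      \<le> (\<integral>\<^sup>+t\<in>{0..1}. (ennreal (norm (M (rotation t x)) powr p) * indicator {x. a \<le> norm x \<and> norm x \<le> b} (rotation t x)) \<partial>lborel)"
    using circle_norm_powr_le[OF p, of x] by (cases "a \<le> norm x \<and> norm x \<le> b") auto
qed

end

section \<open>Comparison with a monotone radial profile\<close>

text \<open>A linear homotopy moves \<open>v\<close> to \<open>g\<close> on the circle of radius \<open>\<rho>\<close>; then the radius grows to \<open>R\<close>, where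
  \<open>g\<close> is a multiple of the identity. Neither homotopy passes through \<open>0\<close>.\<close>

lemma winding_number_circle_image:
  fixes g v :: "real^2 \<Rightarrow> real^2"
  assumes g: "continuous_on (annulus r R \<union> sphere 0 R) g" and r: "0 \<le> r" and \<rho>: "r < \<rho>" "\<rho> < R"
    and g_id: "\<And>x. x \<in> sphere 0 R \<Longrightarrow> g x = (R' / R) *\<^sub>R x" and R': "0 < R'"
    and g_ne: "\<And>x. x \<in> annulus r R \<Longrightarrow> g x \<noteq> 0"
    and v: "continuous_on UNIV v" and close: "\<And>t. norm (v (\<rho> *\<^sub>R circ t) - g (\<rho> *\<^sub>R circ t)) < norm (g (\<rho> *\<^sub>R circ t))"
  shows "winding_number (\<lambda>t. to_complex (v (\<rho> *\<^sub>R circ t))) 0 = 1"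
proof -
  have R: "0 < R" using r \<rho> by simp
  have cc: "continuous_on S (\<lambda>z. circ (snd z))" for S :: "(real \<times> real) set"
    by (rule continuous_on_compose2[OF continuous_on_circ(1)[of UNIV]]) (auto intro: continuous_intros)
  define p where "p s = \<rho> + s * (R - \<rho>)" for s
  have p: "r < p s" "p s \<le> R" "p s = R \<or> p s < R" if "s \<in> {0..1}" for s
  proof -
    have "s * (R - \<rho>) \<le> 1 * (R - \<rho>)" "0 \<le> s * (R - \<rho>)" using that \<rho> by (auto intro: mult_right_mono)
    moreover have "r < \<rho> + q" "\<rho> + q \<le> R" if "q \<le> 1 * (R - \<rho>)" "0 \<le> q" for q
      using that \<rho> by simp_all
    ultimately show "r < p s" "p s \<le> R" unfolding p_def by blast+
    then show "p s = R \<or> p s < R" by auto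
  qed
  have mem: "p s *\<^sub>R circ t \<in> annulus r R \<union> sphere 0 R" if "s \<in> {0..1}" for s t
    using p[OF that] r by (auto simp: annulus_def)
  have ne: "g x \<noteq> 0" if "x \<in> annulus r R \<union> sphere 0 R" for x
    using that g_ne[of x] g_id[of x] R R' by auto
  define h1 where "h1 z = g (p (fst z) *\<^sub>R circ (snd z))" for z
  have "winding_number (\<lambda>t. to_complex (h1 (0, t))) 0 = winding_number (\<lambda>t. to_complex (h1 (1, t))) 0"
  proof (rule winding_number_homotopy)
    show "continuous_on ({0..1} \<times> {0..1}) h1"
      unfolding h1_def
    proof (rule continuous_on_compose2[OF g])
      show "continuous_on ({0..1} \<times> {0..1}) (\<lambda>z::real\<times>real. p (fst z) *\<^sub>R circ (snd z))"
        unfolding p_def by (intro continuous_intros cc)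
    qed (intro image_subsetI mem, auto)
  qed (use mem ne in \<open>auto simp: h1_def circ_one\<close>)
  moreover have "(\<lambda>t. to_complex (h1 (1, t))) = circlepath 0 R'"
  proof
    fix t
    have "h1 (1, t) = R' *\<^sub>R circ t" using g_id[of "R *\<^sub>R circ t"] R by (simp add: h1_def p_def)
    then show "to_complex (h1 (1, t)) = circlepath 0 R' t" by (simp add: to_complex_circ)
  qed
  ultimately have 1: "winding_number (\<lambda>t. to_complex (h1 (0, t))) 0 = 1"
    using winding_number_circlepath_centre[OF R'] by simp
  have mem\<rho>: "\<rho> *\<^sub>R circ t \<in> annulus r R \<union> sphere 0 R" for t using mem[of 0 t] by (simp add: p_def)
  define h2 where "h2 z = (1 - fst z) *\<^sub>R v (\<rho> *\<^sub>R circ (snd z)) + fst z *\<^sub>R g (\<rho> *\<^sub>R circ (snd z))" for z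
  have "winding_number (\<lambda>t. to_complex (h2 (0, t))) 0 = winding_number (\<lambda>t. to_complex (h2 (1, t))) 0"
  proof (rule winding_number_homotopy)
    have "continuous_on ({0..1} \<times> {0..1}) (\<lambda>z::real\<times>real. g (\<rho> *\<^sub>R circ (snd z)))"
      by (rule continuous_on_compose2[OF g]) (use mem\<rho> in \<open>auto intro!: continuous_intros cc\<close>)
    moreover have "continuous_on ({0..1} \<times> {0..1}) (\<lambda>z::real\<times>real. v (\<rho> *\<^sub>R circ (snd z)))"
      by (rule continuous_on_compose2[OF v]) (auto intro!: continuous_intros cc)
    ultimately show "continuous_on ({0..1} \<times> {0..1}) h2"
      unfolding h2_def by (intro continuous_intros)
    fix s t :: real assume s: "s \<in> {0..1}"
    let ?g = "g (\<rho> *\<^sub>R circ t)" and ?v = "v (\<rho> *\<^sub>R circ t)"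
    have "norm ((1 - s) *\<^sub>R (?v - ?g)) \<le> 1 * norm (?v - ?g)"
      unfolding norm_scaleR using s by (intro mult_right_mono) auto
    then have "norm ((1 - s) *\<^sub>R (?v - ?g)) < norm ?g" using close[of t] by simp
    moreover have "h2 (s, t) = ?g + (1 - s) *\<^sub>R (?v - ?g)" by (simp add: h2_def algebra_simps)
    ultimately show "h2 (s, t) \<noteq> 0"
      by (metis add_eq_0_iff less_irrefl norm_minus_cancel)
  qed (auto simp: h2_def circ_one)
  then show ?thesis using 1 by (simp add: h1_def h2_def p_def)
qed

text \<open>The collars shrink to the empty set, and \<open>norm x powr (- p)\<close> is integrable.\<close>

lemma norm_powr_integral_collar:
  assumes r: "0 \<le> r" "r < R" and p: "1 \<le> p" "p < 2" and \<eta>: "0 < (\<eta>::real)"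
  shows "\<exists>\<delta>>0. \<forall>a b. a \<le> r + \<delta> \<longrightarrow> R - \<delta> \<le> b \<longrightarrow>
    (\<integral>\<^sup>+x\<in>annulus r R - {x. a \<le> norm x \<and> norm x \<le> b}. ennreal (norm x powr (- p)) \<partial>lborel) \<le> ennreal \<eta>"
proof -
  define \<mu> where "\<mu> = density lborel (\<lambda>x::real^2. ennreal (norm x powr (- p)))"
  define S where "S n = {x \<in> annulus r R. norm x < r + 1 / real (Suc n) \<or> R - 1 / real (Suc n) < norm x}" for n
  have ann[measurable]: "annulus r R \<in> sets borel" using open_annulus by simp
  have S_sets: "S n \<in> sets borel" for n
  proof -
    have "S n = annulus r R \<inter> {x. norm x < r + 1 / real (Suc n) \<or> R - 1 / real (Suc n) < norm x}"
      by (auto simp: S_def)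
    also have "\<dots> \<in> sets borel" by measurable
    finally show ?thesis .
  qed
  have em: "emeasure \<mu> A = (\<integral>\<^sup>+x\<in>A. ennreal (norm x powr (- p)) \<partial>lborel)" if "A \<in> sets borel" for A
    unfolding \<mu>_def using that by (subst emeasure_density) auto
  have fin: "emeasure \<mu> (S n) \<noteq> \<infinity>" for n
  proof -
    have "emeasure \<mu> (S n) \<le> (\<integral>\<^sup>+x\<in>ball (0::real^2) R. ennreal (norm x powr (- p)) \<partial>lborel)"
      unfolding em[OF S_sets] by (intro nn_integral_mono) (auto simp: S_def annulus_def indicator_def)
    also have "\<dots> < \<infinity>" using integral_norm_powr_finite[of R p] r p by simp
    finally show ?thesis by simp
  qed
  have "(\<lambda>n. emeasure \<mu> (S n)) \<longlonglongrightarrow> emeasure \<mu> (\<Inter>n. S n)"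
  proof (rule Lim_emeasure_decseq[OF _ _ fin])
    show "range S \<subseteq> sets \<mu>" using S_sets by (auto simp: \<mu>_def)
    have "S n \<subseteq> S m" if "m \<le> n" for m n
    proof -
      have "1 / real (Suc n) \<le> 1 / real (Suc m)" using that by (simp add: frac_le)
      then show ?thesis by (auto simp: S_def)
    qed
    then show "decseq S" by (simp add: decseq_def)
  qed
  moreover have "(\<Inter>n. S n) = {}"
  proof (rule ccontr)
    assume "(\<Inter>n. S n) \<noteq> {}"
    then obtain x where x: "x \<in> S n" for n by blast
    have "r < norm x" "norm x < R" using x[of 0] by (auto simp: S_def annulus_def)
    then obtain n where n: "1 / real (Suc n) < min (norm x - r) (R - norm x)"
      using reals_Archimedean[of "min (norm x - r) (R - norm x)"] by (auto simp: divide_inverse)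
    then show False using x[of n] by (auto simp: S_def)
  qed
  ultimately have "(\<lambda>n. emeasure \<mu> (S n)) \<longlonglongrightarrow> 0" by simp
  then have "\<forall>\<^sub>F n in sequentially. emeasure \<mu> (S n) < ennreal \<eta>"
    by (rule order_tendstoD) (use \<eta> in simp)
  then obtain n where n: "emeasure \<mu> (S n) < ennreal \<eta>"
    using eventually_happens'[OF sequentially_bot] by blast
  define \<delta> where "\<delta> = 1 / (2 * real (Suc n))"
  show ?thesis
  proof (intro exI[of _ \<delta>] conjI allI impI)
    show "0 < \<delta>" by (simp add: \<delta>_def)
    fix a b assume ab: "a \<le> r + \<delta>" "R - \<delta> \<le> b"
    have "\<delta> < 1 / real (Suc n)" by (simp add: \<delta>_def field_simps)
    then have "annulus r R - {x. a \<le> norm x \<and> norm x \<le> b} \<subseteq> S n"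
      using ab by (auto simp: S_def)
    then have "(\<integral>\<^sup>+x\<in>annulus r R - {x. a \<le> norm x \<and> norm x \<le> b}. ennreal (norm x powr (- p)) \<partial>lborel) \<le> emeasure \<mu> (S n)"
      unfolding em[OF S_sets] by (intro nn_integral_mono) (auto simp: indicator_def)
    then show "(\<integral>\<^sup>+x\<in>annulus r R - {x. a \<le> norm x \<and> norm x \<le> b}. ennreal (norm x powr (- p)) \<partial>lborel) \<le> ennreal \<eta>"
      using n by simp
  qed
qed

text \<open>The profile is the monotone minorant of \<open>circle_mean\<close>, cut off below at \<open>c\<close>. Where it follows
  the circle mean, its differential is bounded by the mean of the differential of \<open>v\<close>; where it is
  constant, its value is at most the circle mean or \<open>c\<close>, and the length estimate covers the second
  case.\<close>

lemma (in C1_map) monotone_radial_comparison: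
  assumes a: "0 < a" "a \<le> b" and c: "0 \<le> c"
    and length: "\<And>\<rho>. \<rho> \<in> {a..b} \<Longrightarrow> 0 < c \<Longrightarrow> c / \<rho> \<le> circle_norm \<rho>"
  obtains G g N L where "mono G" "\<And>s t. \<bar>G s - G t\<bar> \<le> L * \<bar>s - t\<bar>" "\<And>s. \<bar>g s\<bar> \<le> L"
    "\<And>s. s \<le> a \<Longrightarrow> G s = G a" "\<And>s. b \<le> s \<Longrightarrow> G s = max (circle_mean b) c"
    "G a \<le> max (circle_mean a) c" "\<And>s. c \<le> G s" "countable N"
    "\<And>s. s \<notin> N \<Longrightarrow> (G has_real_derivative g s) (at s)"
    "\<And>s. s < a \<or> b < s \<Longrightarrow> g s = 0"
    "\<And>s. a < s \<Longrightarrow> s < b \<Longrightarrow> s \<notin> N \<Longrightarrow> sqrt ((g s)\<^sup>2 + (G s / s)\<^sup>2) \<le> circle_norm s"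
proof -
  have "bounded (circle_mean_deriv ` {a..b})"
    by (intro compact_imp_bounded compact_continuous_image continuous_on_subset[OF continuous_circle_mean_deriv]) auto
  then obtain L where "\<forall>\<rho>\<in>{a..b}. \<bar>circle_mean_deriv \<rho>\<bar> \<le> L"
    by (auto simp: bounded_iff)
  then have L: "\<And>\<rho>. \<rho> \<in> {a..b} \<Longrightarrow> \<bar>circle_mean_deriv \<rho>\<bar> \<le> L" by blast
  have L0: "0 \<le> L" using L[of a] a by force
  show thesis
  proof (rule monotone_minorant[OF a(2) circle_mean_has_derivative L, where c = c], assumption)
    fix G N assume G: "mono G" "\<And>s t. \<bar>G s - G t\<bar> \<le> L * \<bar>s - t\<bar>"
      "\<And>\<rho>. \<rho> \<le> a \<Longrightarrow> G \<rho> = G a" "\<And>\<rho>. b \<le> \<rho> \<Longrightarrow> G \<rho> = max (circle_mean b) c"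
      "G a \<le> max (circle_mean a) c" "\<And>\<rho>. c \<le> G \<rho>" "countable N"
      and d: "\<And>\<rho>. a < \<rho> \<Longrightarrow> \<rho> < b \<Longrightarrow> \<rho> \<notin> N \<Longrightarrow>
         \<exists>g. (G has_real_derivative g) (at \<rho>) \<and> (g = 0 \<and> G \<rho> \<le> max (circle_mean \<rho>) c \<or> g = circle_mean_deriv \<rho> \<and> G \<rho> = circle_mean \<rho>)"
    have ex: "\<exists>g. \<bar>g\<bar> \<le> L \<and> (s \<notin> N \<union> {a, b} \<longrightarrow> (G has_real_derivative g) (at s)) \<and> (s < a \<or> b < s \<longrightarrow> g = 0) \<and>
        (a < s \<longrightarrow> s < b \<longrightarrow> s \<notin> N \<union> {a, b} \<longrightarrow> sqrt (g\<^sup>2 + (G s / s)\<^sup>2) \<le> circle_norm s)" for s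
    proof -
      consider "s \<in> N \<union> {a, b}" | "s < a" | "b < s" | "a < s" "s < b" "s \<notin> N \<union> {a, b}" by fastforce
      then show ?thesis
      proof cases
        case 1
        then show ?thesis using L0 a by (intro exI[of _ 0]) auto
      next
        case 2
        have "(G has_real_derivative 0) (at s)"
        proof (rule has_field_derivative_transform_within_open[OF DERIV_const[of "G a"], where S = "{..<a}"])
          show "G a = G y" if "y \<in> {..<a}" for y using G(3)[of y] that by simp
        qed (use 2 in auto)
        then show ?thesis using L0 2 a by (intro exI[of _ 0]) auto
      next
        case 3
        have "(G has_real_derivative 0) (at s)"
        proof (rule has_field_derivative_transform_within_open[OF DERIV_const[of "max (circle_mean b) c"], where S = "{b<..}"])
          show "max (circle_mean b) c = G y" if "y \<in> {b<..}" for y using G(4)[of y] that by simp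
        qed (use 3 in auto)
        then show ?thesis using L0 3 a by (intro exI[of _ 0]) auto
      next
        case 4
        then obtain g where g: "(G has_real_derivative g) (at s)" "g = 0 \<and> G s \<le> max (circle_mean s) c \<or> g = circle_mean_deriv s \<and> G s = circle_mean s"
          using d by blast
        have s: "0 < s" using 4 a by simp
        have "sqrt (g\<^sup>2 + (G s / s)\<^sup>2) \<le> circle_norm s" "\<bar>g\<bar> \<le> L"
        proof -
          from g(2) show "sqrt (g\<^sup>2 + (G s / s)\<^sup>2) \<le> circle_norm s"
          proof
            assume "g = 0 \<and> G s \<le> max (circle_mean s) c"
            moreover have "circle_mean s / s \<le> circle_norm s"
              using order_trans[OF real_sqrt_sum_squares_ge2 circle_norm_ge_radial[OF s]] .
            moreover have "c / s \<le> circle_norm s"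
              using length[of s] 4 c circle_norm_nonneg[of s] by (cases "c = 0") auto
            moreover have "0 \<le> G s" using G(6)[of s] c by linarith
            moreover have "max (circle_mean s) c / s = max (circle_mean s / s) (c / s)"
              using s by (auto simp: max_def divide_le_cancel)
            ultimately have "G s / s \<le> circle_norm s" "0 \<le> G s / s" "g = 0"
              using s divide_right_mono[of "G s" "max (circle_mean s) c" s] by auto
            then show ?thesis by simp
          next
            assume "g = circle_mean_deriv s \<and> G s = circle_mean s"
            then show ?thesis using circle_norm_ge_radial[OF s] by simp
          qed
          show "\<bar>g\<bar> \<le> L" using g(2) L[of s] L0 4 by auto
        qed
        then show ?thesis using g(1) 4 by auto
      qed
    qed
    then obtain g where g: "\<And>s. \<bar>g s\<bar> \<le> L" "\<And>s. s \<notin> N \<union> {a, b} \<Longrightarrow> (G has_real_derivative g s) (at s)" "\<And>s. s < a \<or> b < s \<Longrightarrow> g s = 0"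
        "\<And>s. a < s \<Longrightarrow> s < b \<Longrightarrow> s \<notin> N \<union> {a, b} \<Longrightarrow> sqrt ((g s)\<^sup>2 + (G s / s)\<^sup>2) \<le> circle_norm s"
      by metis
    show thesis
    proof (rule that[of G L g "N \<union> {a, b}"])
      show "countable (N \<union> {a, b})" using G(7) by simp
    qed (fact G g)+
  qed
qed

lemma powr_convex_combination:
  assumes t: "0 \<le> t" "t \<le> 1" and XY: "0 \<le> X" "0 \<le> Y" and p: "1 \<le> (p::real)"
  shows "((1 - t) * X + t * Y) powr p \<le> (1 - t) * X powr p + t * Y powr p"
proof -
  define A where "A = (1 - t) * X + t * Y"
  define c where "c = p * A powr (p - 1)"
  have A: "0 \<le> A" using t XY by (simp add: A_def)
  have "(1 - t) * (A powr p + c * (X - A)) + t * (A powr p + c * (Y - A)) \<le> (1 - t) * X powr p + t * Y powr p"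
    unfolding c_def using t XY A p by (intro add_mono mult_left_mono powr_above_tangent) auto
  moreover have "(1 - t) * (A powr p + c * (X - A)) + t * (A powr p + c * (Y - A)) = A powr p + c * (((1 - t) * X + t * Y) - A)"
    by (simp add: algebra_simps)
  ultimately show ?thesis by (simp add: A_def)
qed

lemma sqrt_convex_combination:
  assumes t: "0 \<le> t" "t \<le> 1"
  shows "sqrt (((1 - t) * x + t * y)\<^sup>2 + ((1 - t) * u + t * w)\<^sup>2) \<le> (1 - t) * sqrt (x\<^sup>2 + u\<^sup>2) + t * sqrt (y\<^sup>2 + w\<^sup>2)"
proof -
  have "cmod (of_real (1 - t) * Complex x u + of_real t * Complex y w) \<le> \<bar>1 - t\<bar> * cmod (Complex x u) + \<bar>t\<bar> * cmod (Complex y w)"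
    using norm_triangle_ineq[of "of_real (1 - t) * Complex x u" "of_real t * Complex y w"] by (simp only: norm_mult norm_of_real)
  then show ?thesis using t by (simp add: cmod_def)
qed

section \<open>Radial homeomorphisms up to sign\<close>

lemma has_weak_differential_scaleR_cong:
  assumes D: "has_weak_differential \<Omega> h D" and k: "\<And>x. x \<in> \<Omega> \<Longrightarrow> k x = \<sigma> *\<^sub>R h x"
  shows "has_weak_differential \<Omega> k (\<lambda>x. \<sigma> *\<^sub>R D x)"
  unfolding has_weak_differential_def
proof (intro conjI ballI allI)
  show "locally_integrable_on \<Omega> k"
    unfolding locally_integrable_on_def set_integrable_def
  proof (intro allI impI)
    fix K assume K: "compact K \<and> K \<subseteq> \<Omega>"
    then have "integrable lebesgue (\<lambda>x. \<sigma> *\<^sub>R (indicator K x *\<^sub>R h x))"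
      using D unfolding has_weak_differential_def locally_integrable_on_def set_integrable_def
      by (intro integrable_scaleR_right) blast
    moreover have "\<sigma> *\<^sub>R (indicator K x *\<^sub>R h x) = indicator K x *\<^sub>R k x" for x
      using K k by (auto simp: indicator_def)
    ultimately show "integrable lebesgue (\<lambda>x. indicator K x *\<^sub>R k x)" by (simp only:)
  qed
  show "locally_integrable_on \<Omega> (\<lambda>x. \<sigma> *\<^sub>R D x)"
    using D unfolding has_weak_differential_def locally_integrable_on_def by (auto intro: set_integrable_scaleR_right)
  fix \<phi> i j assume \<phi>: "\<phi> \<in> test_functions \<Omega>"
  have "(LINT x:\<Omega>|lebesgue. k x $ i * partial_deriv j \<phi> x) = (LINT x|lebesgue. \<sigma> * (indicator \<Omega> x *\<^sub>R (h x $ i * partial_deriv j \<phi> x)))"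
    unfolding set_lebesgue_integral_def
    by (intro Bochner_Integration.integral_cong) (auto simp: k indicator_def)
  also have "\<dots> = \<sigma> * (LINT x:\<Omega>|lebesgue. h x $ i * partial_deriv j \<phi> x)"
    unfolding set_lebesgue_integral_def by simp
  also have "\<dots> = - (\<sigma> * (LINT x:\<Omega>|lebesgue. D x $ i $ j * \<phi> x))"
    using D \<phi> unfolding has_weak_differential_def by simp
  also have "\<dots> = - (LINT x|lebesgue. \<sigma> * (indicator \<Omega> x *\<^sub>R (D x $ i $ j * \<phi> x)))"
    unfolding set_lebesgue_integral_def by simp
  also have "\<dots> = - (LINT x:\<Omega>|lebesgue. (\<sigma> *\<^sub>R D x) $ i $ j * \<phi> x)"
    unfolding set_lebesgue_integral_def
    by (intro arg_cong[where f = uminus] Bochner_Integration.integral_cong) (auto simp: indicator_def)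
  finally show "(LINT x:\<Omega>|lebesgue. k x $ i * partial_deriv j \<phi> x) = - (LINT x:\<Omega>|lebesgue. (\<sigma> *\<^sub>R D x) $ i $ j * \<phi> x)" .
qed

lemma Lp_on_scaleR_cong:
  assumes h: "Lp_on p \<Omega> h" and k: "\<And>x. x \<in> \<Omega> \<Longrightarrow> k x = \<sigma> *\<^sub>R h x" and \<sigma>: "\<bar>\<sigma>\<bar> = 1"
  shows "Lp_on p \<Omega> k"
proof -
  have "\<sigma> *\<^sub>R (indicator \<Omega> x *\<^sub>R h x) = indicator \<Omega> x *\<^sub>R k x" for x
    using k by (auto simp: indicator_def)
  moreover have "(\<lambda>x. indicator \<Omega> x *\<^sub>R h x) \<in> borel_measurable lebesgue"
    using h unfolding Lp_on_def set_borel_measurable_def by blast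
  then have "(\<lambda>x. \<sigma> *\<^sub>R (indicator \<Omega> x *\<^sub>R h x)) \<in> borel_measurable lebesgue"
    by (rule borel_measurable_scaleR[OF borel_measurable_const])
  moreover have "indicator \<Omega> x *\<^sub>R (norm (k x) powr p) = indicator \<Omega> x *\<^sub>R (norm (h x) powr p)" for x
    using k \<sigma> by (auto simp: indicator_def)
  ultimately show ?thesis
    using h unfolding Lp_on_def set_borel_measurable_def set_integrable_def by (simp only:)
qed

text \<open>The factor \<open>H\<close> of a radial homeomorphism has no zero and hence a constant sign \<open>\<sigma>\<close>; its modulus is
  injective and continuous with limits \<open>r'\<close> and \<open>R'\<close>, hence strictly increasing.\<close>

lemma radial_homeo_eq_profile:
  assumes radii: "0 \<le> r" "r < R" "0 \<le> r'" and h: "h \<in> radial_Sobolev_homeos p r R r' R'"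
  obtains G \<sigma> where "radial_profile r R r' R' G" "\<bar>\<sigma>\<bar> = 1"
    "\<And>x. x \<in> annulus r R \<Longrightarrow> radial_map G x = \<sigma> *\<^sub>R h x"
proof -
  obtain f where hom: "homeomorphism (annulus r R) (annulus r' R') h f"
    and lims: "((\<lambda>x. norm (h x)) \<longlongrightarrow> r') (filtercomap norm (at_right r))"
      "((\<lambda>x. norm (h x)) \<longlongrightarrow> R') (filtercomap norm (at_left R))"
    using h unfolding radial_Sobolev_homeos_def Sobolev_homeos_def by blast
  obtain H where H: "\<And>x. x \<in> annulus r R \<Longrightarrow> h x = H (norm x) *\<^sub>R (x /\<^sub>R norm x)"
    using h unfolding radial_Sobolev_homeos_def by blast
  define e :: "real^2" where "e = axis 1 1"
  have e: "norm e = 1" "e $ 1 = 1" by (simp_all add: e_def)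
  define F where "F s = h (s *\<^sub>R e) $ 1" for s
  have mem: "s *\<^sub>R e \<in> annulus r R" if "s \<in> {r<..<R}" for s
    using that radii e by (simp add: annulus_def)
  have he: "h (s *\<^sub>R e) = H s *\<^sub>R e" if "s \<in> {r<..<R}" for s
    using H[OF mem[OF that]] that radii e by simp
  have FH: "F s = H s" if "s \<in> {r<..<R}" for s
    using he[OF that] by (simp add: F_def e)
  have h_cont: "continuous_on (annulus r R) h" and h_img: "h ` annulus r R = annulus r' R'"
    using hom by (auto simp: homeomorphism_def)
  have h_inj: "x = y" if "x \<in> annulus r R" "y \<in> annulus r R" "h x = h y" for x y
    using that hom by (metis homeomorphism_apply1)
  have F_cont: "continuous_on {r<..<R} F"
    unfolding F_def by (intro continuous_intros continuous_on_compose2[OF h_cont]) (use mem in auto)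
  have absF: "\<bar>F s\<bar> = norm (h (s *\<^sub>R e))" if "s \<in> {r<..<R}" for s
    using he[OF that] FH[OF that] e by simp
  have range: "r' < \<bar>F s\<bar>" "\<bar>F s\<bar> < R'" if "s \<in> {r<..<R}" for s
    using absF[OF that] h_img mem[OF that] by (auto simp: annulus_def)
  have F0: "F s \<noteq> 0" if "s \<in> {r<..<R}" for s using range(1)[OF that] radii by auto
  define \<sigma> where "\<sigma> = sgn (F ((r + R) / 2))"
  have mid: "(r + R) / 2 \<in> {r<..<R}" using radii by simp
  have F\<sigma>: "\<bar>F s\<bar> = \<sigma> * F s" if s: "s \<in> {r<..<R}" for s
  proof -
    have conn: "connected (F ` {r<..<R})" by (intro connected_continuous_image F_cont connected_Ioo)
    have "0 \<notin> F ` {r<..<R}" using F0 by force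
    moreover note connectedD_interval[OF conn imageI[OF s] imageI[OF mid], of 0]
      connectedD_interval[OF conn imageI[OF mid] imageI[OF s], of 0]
    ultimately have "\<not> (F s < 0 \<and> 0 < F ((r + R) / 2))" "\<not> (0 < F s \<and> F ((r + R) / 2) < 0)"
      by auto
    then show ?thesis using F0[OF s] F0[OF mid] by (auto simp: \<sigma>_def sgn_if)
  qed
  have \<sigma>: "\<bar>\<sigma>\<bar> = 1" using F0[OF mid] by (simp add: \<sigma>_def abs_sgn_eq)
  have inj: "s = u" if su: "s \<in> {r<..<R}" "u \<in> {r<..<R}" "\<bar>F s\<bar> = \<bar>F u\<bar>" for s u
  proof -
    have "\<sigma> * F s = \<sigma> * F u" using F\<sigma> su by metis
    then have "F s = F u" using \<sigma> by auto
    then have "h (s *\<^sub>R e) = h (u *\<^sub>R e)" using he su FH by simp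
    then have "s *\<^sub>R e = u *\<^sub>R e" using h_inj mem su by blast
    then show ?thesis using e by (metis norm_zero scaleR_cancel_right zero_neq_one)
  qed
  have along: "filterlim (\<lambda>s. s *\<^sub>R e) (filtercomap norm (at_right r)) (at_right r)"
    "filterlim (\<lambda>s. s *\<^sub>R e) (filtercomap norm (at_left R)) (at_left R)"
  proof -
    have "filterlim (\<lambda>s. norm (s *\<^sub>R e)) (at_right r) (at_right r)"
      by (rule filterlim_cong[THEN iffD1, OF refl refl _ filterlim_ident])
        (use radii e in \<open>auto simp: eventually_at_right_field intro!: exI[of _ R]\<close>)
    then show "filterlim (\<lambda>s. s *\<^sub>R e) (filtercomap norm (at_right r)) (at_right r)"
      by (simp add: filterlim_filtercomap_iff o_def)
    have "filterlim (\<lambda>s. norm (s *\<^sub>R e)) (at_left R) (at_left R)"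
      by (rule filterlim_cong[THEN iffD1, OF refl refl _ filterlim_ident])
        (use radii e in \<open>auto simp: eventually_at_left_field intro!: exI[of _ r]\<close>)
    then show "filterlim (\<lambda>s. s *\<^sub>R e) (filtercomap norm (at_left R)) (at_left R)"
      by (simp add: filterlim_filtercomap_iff o_def)
  qed
  define G where "G s = (if s < R then \<bar>F s\<bar> else R')" for s
  have G_lims: "(G \<longlongrightarrow> r') (at_right r)" "(G \<longlongrightarrow> R') (at_left R)"
  proof -
    have "((\<lambda>s. norm (h (s *\<^sub>R e))) \<longlongrightarrow> r') (at_right r)"
      by (rule filterlim_compose[OF lims(1) along(1)])
    moreover have "\<forall>\<^sub>F s in at_right r. norm (h (s *\<^sub>R e)) = G s"
      unfolding eventually_at_right_field using absF radii by (auto simp: G_def intro!: exI[of _ R])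
    ultimately show "(G \<longlongrightarrow> r') (at_right r)" by (rule Lim_transform_eventually)
    have "((\<lambda>s. norm (h (s *\<^sub>R e))) \<longlongrightarrow> R') (at_left R)"
      by (rule filterlim_compose[OF lims(2) along(2)])
    moreover have "\<forall>\<^sub>F s in at_left R. norm (h (s *\<^sub>R e)) = G s"
      unfolding eventually_at_left_field using absF radii by (auto simp: G_def intro!: exI[of _ r])
    ultimately show "(G \<longlongrightarrow> R') (at_left R)" by (rule Lim_transform_eventually)
  qed
  have G_cont_open: "continuous_on {r<..<R} G"
  proof -
    have "continuous_on {r<..<R} (\<lambda>s. \<bar>F s\<bar>)" by (intro continuous_intros F_cont)
    then show ?thesis by (rule continuous_on_eq) (simp add: G_def)
  qed
  have G_cont: "continuous_on {r<..R} G"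
    unfolding continuous_on_def
  proof
    fix s assume s: "s \<in> {r<..R}"
    show "(G \<longlongrightarrow> G s) (at s within {r<..R})"
    proof (cases "s = R")
      case True
      have "at R within {r<..R} = at_left R"
        by (rule at_within_nhd[of _ "{r<..}"]) (use radii in auto)
      then show ?thesis using True G_lims(2) by (simp add: G_def)
    next
      case False
      then have "isCont G s"
        using G_cont_open s by (simp add: continuous_on_eq_continuous_at)
      then show ?thesis by (simp add: isCont_def tendsto_within_subset[of _ _ _ UNIV])
    qed
  qed
  have mono: "G s < G u" if su: "r < s" "s < u" "u \<le> R" for s u
  proof (cases "u = R")
    case True
    then show ?thesis using range(2)[of s] su by (simp add: G_def)
  next
    case False
    then have s: "s \<in> {r<..<R}" "u \<in> {r<..<R}" using su by auto
    have "r' < G u" using range(1)[OF s(2)] s by (simp add: G_def)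
    then have "\<forall>\<^sub>F w in at_right r. G w < G u" by (rule order_tendstoD(2)[OF G_lims(1)])
    then obtain b where b: "b > r" "\<And>w. r < w \<Longrightarrow> w < b \<Longrightarrow> G w < G u"
      unfolding eventually_at_right_field by auto
    define w where "w = (r + min b s) / 2"
    have w: "r < w" "w < b" "w < s" using b(1) su by (auto simp: w_def)
    have "continuous_on {w..u} G" by (rule continuous_on_subset[OF G_cont_open]) (use w s in auto)
    moreover have "inj_on G {w..u}"
      by (rule inj_onI) (use inj w s in \<open>auto simp: G_def\<close>)
    ultimately have "G w < G s \<and> G s < G u \<or> G u < G s \<and> G s < G w"
      using continuous_inj_imp_mono[of w s u G] w su by auto
    then show ?thesis using b(2)[OF w(1,2)] by auto
  qed
  have "radial_profile r R r' R' G"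
    by standard (use radii G_cont mono G_lims in \<open>auto simp: G_def\<close>)
  moreover have "radial_map G x = \<sigma> *\<^sub>R h x" if x: "x \<in> annulus r R" for x
  proof -
    have s: "norm x \<in> {r<..<R}" using x by (simp add: annulus_def)
    then have "G (norm x) = \<sigma> * H (norm x)" using F\<sigma>[OF s] FH[OF s] by (simp add: G_def)
    then show ?thesis using H[OF x] by (simp add: radial_map_def)
  qed
  ultimately show ?thesis using that \<sigma> by blast
qed

lemma radial_homeo_energy_attained_in_Id:
  assumes radii: "0 \<le> r" "r < R" "0 \<le> r'" and h: "h \<in> radial_Sobolev_homeos p r R r' R'"
  shows "\<exists>k \<in> Sobolev_homeos_Id p r R r' R'. p_energy p (annulus r R) k = p_energy p (annulus r R) h"
proof -
  obtain G \<sigma> where G: "radial_profile r R r' R' G" and \<sigma>: "\<bar>\<sigma>\<bar> = 1"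
    and k: "\<And>x. x \<in> annulus r R \<Longrightarrow> radial_map G x = \<sigma> *\<^sub>R h x"
    using radial_homeo_eq_profile[OF radii h] by metis
  have "h \<in> Sobolev_W1 p (annulus r R)"
    using h unfolding radial_Sobolev_homeos_def Sobolev_homeos_def by blast
  then obtain D where hLp: "Lp_on p (annulus r R) h" and D: "has_weak_differential (annulus r R) h D" and DLp: "Lp_on p (annulus r R) D"
    unfolding Sobolev_W1_def by blast
  note kD = has_weak_differential_scaleR_cong[OF D k]
  have "radial_map G \<in> Sobolev_W1 p (annulus r R)"
    unfolding Sobolev_W1_def
    using kD Lp_on_scaleR_cong[OF hLp k \<sigma>] Lp_on_scaleR_cong[OF DLp refl \<sigma>] by blast
  then have "radial_map G \<in> Sobolev_homeos_Id p r R r' R'"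
    by (rule radial_profile.radial_map_in_classes(1)[OF G])
  moreover have "p_energy p (annulus r R) (radial_map G) = p_energy p (annulus r R) h"
    by (simp add: p_energy_eq[OF open_annulus kD] p_energy_eq[OF open_annulus D] \<sigma>)
  ultimately show ?thesis by blast
qed

section \<open>Radial approximation\<close>

lemma (in C1_map) circle_mean_le:
  assumes "\<And>t. v (\<rho> *\<^sub>R circ t) \<bullet> circ t \<le> u"
  shows "circle_mean \<rho> \<le> u"
proof -
  have "circle_mean \<rho> \<le> integral {0..1} (\<lambda>t::real. u)"
    unfolding circle_mean_def by (intro integral_le integrable_continuous_real cont_intros) (use assms in auto)
  then show ?thesis by simp
qed

lemma (in C1_map) circle_mean_ge:
  assumes "\<And>t. u \<le> v (\<rho> *\<^sub>R circ t) \<bullet> circ t"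
  shows "u \<le> circle_mean \<rho>"
proof -
  have "integral {0..1} (\<lambda>t::real. u) \<le> circle_mean \<rho>"
    unfolding circle_mean_def by (intro integral_le integrable_continuous_real cont_intros) (use assms in auto)
  then show ?thesis by simp
qed

text \<open>The boundary values are attained uniformly, by uniform continuity on a compact collar.\<close>

lemma outer_boundary_uniform:
  fixes g :: "real^2 \<Rightarrow> real^2"
  assumes r: "0 \<le> r" "r < R" and g: "continuous_on (annulus r R \<union> sphere 0 R) g"
    and g_id: "\<And>x. x \<in> sphere 0 R \<Longrightarrow> g x = c *\<^sub>R x" and \<kappa>: "0 < \<kappa>"
  obtains \<delta> where "0 < \<delta>" "\<And>x. R - \<delta> < norm x \<Longrightarrow> norm x < R \<Longrightarrow> norm (g x - c *\<^sub>R x) \<le> \<kappa>"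
proof -
  define m where "m = (r + R) / 2"
  have m: "r < m" "m < R" "0 < m" using r by (auto simp: m_def)
  define C where "C = {x::real^2. m \<le> norm x \<and> norm x \<le> R}"
  have "C = cball 0 R \<inter> - ball 0 m" by (auto simp: C_def)
  then have C: "compact C" by (simp only:) (intro compact_Int_closed compact_cball closed_Compl open_ball)
  have "continuous_on C (\<lambda>x. g x - c *\<^sub>R x)"
    by (intro continuous_intros continuous_on_subset[OF g]) (use m in \<open>auto simp: C_def annulus_def\<close>)
  then have "uniformly_continuous_on C (\<lambda>x. g x - c *\<^sub>R x)" using C by (rule compact_uniformly_continuous)
  then obtain d where d: "d > 0" "\<And>x y. x \<in> C \<Longrightarrow> y \<in> C \<Longrightarrow> dist y x < d \<Longrightarrow> dist (g y - c *\<^sub>R y) (g x - c *\<^sub>R x) < \<kappa>"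
    using \<kappa> unfolding uniformly_continuous_on_def by meson
  show ?thesis
  proof (rule that[of "min d (R - m)"])
    show "0 < min d (R - m)" using d(1) m by simp
    fix x :: "real^2" assume x: "R - min d (R - m) < norm x" "norm x < R"
    define y where "y = (R / norm x) *\<^sub>R x"
    have nx: "0 < norm x" "m < norm x" using x m by auto
    have ny: "norm y = R" using nx m by (simp add: y_def)
    have "y - x = ((R - norm x) / norm x) *\<^sub>R x"
      using nx by (simp add: y_def diff_divide_distrib scaleR_diff_left)
    then have "dist y x = R - norm x" using nx x by (simp add: dist_norm)
    then have "dist (g y - c *\<^sub>R y) (g x - c *\<^sub>R x) < \<kappa>"
      using x nx ny m by (intro d(2)) (auto simp: C_def)
    moreover have "g y - c *\<^sub>R y = 0" using g_id[of y] ny by simp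
    ultimately show "norm (g x - c *\<^sub>R x) \<le> \<kappa>" by (simp add: dist_norm norm_minus_commute)
  qed
qed

text \<open>The comparison profile \<open>G\<close> of a mollification of \<open>h\<close> on a closed subannulus is extended by constants.
  It is only nondecreasing, and its end values are only close to \<open>r'\<close> and \<open>R'\<close>. Both defects are
  repaired by the convex combination with weight \<open>t\<close> of an increasing affine function \<open>B\<close>, which
  costs little since the energy density is a convex function of the profile and its derivative.\<close>

lemma radial_approximation:
  assumes radii: "0 \<le> r" "r < R" "0 \<le> r'" "r' < R'" and p: "1 \<le> p" "p < 2"
    and h: "h \<in> Sobolev_homeos_Id p r R r' R'" and e: "0 < (e::real)"
  shows "\<exists>k \<in> radial_Sobolev_homeos p r R r' R'. p_energy p (annulus r R) k \<le> p_energy p (annulus r R) h + ennreal e"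
proof -
  let ?\<Omega> = "annulus r R"
  have R: "0 < R" "0 < R'" using radii by auto
  obtain f where hom: "homeomorphism ?\<Omega> (annulus r' R') h f"
    and W1: "h \<in> Sobolev_W1 p ?\<Omega>"
    and lim: "((\<lambda>x. norm (h x)) \<longlongrightarrow> r') (filtercomap norm (at_right r))"
    using h unfolding Sobolev_homeos_Id_def Sobolev_homeos_def by blast
  obtain g0 where g0: "continuous_on (?\<Omega> \<union> sphere 0 R) g0" "\<And>x. x \<in> ?\<Omega> \<Longrightarrow> g0 x = h x"
      "\<And>x. x \<in> sphere 0 R \<Longrightarrow> g0 x = (R' / R) *\<^sub>R x"
    using h unfolding Sobolev_homeos_Id_def by blast
  have h_cont: "continuous_on ?\<Omega> h" and h_img: "h ` ?\<Omega> = annulus r' R'"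
    using hom by (auto simp: homeomorphism_def)
  have h_norm: "r' < norm (h x)" "norm (h x) < R'" if "x \<in> ?\<Omega>" for x
    using h_img that by (auto simp: annulus_def)
  define D where "D = weak_differential ?\<Omega> h"
  obtain D' where "has_weak_differential ?\<Omega> h D'" using W1 unfolding Sobolev_W1_def by blast
  then have D: "has_weak_differential ?\<Omega> h D"
    unfolding D_def weak_differential_def by (rule someI[of "has_weak_differential ?\<Omega> h"])
  have energy: "p_energy p ?\<Omega> h = (\<integral>\<^sup>+x\<in>?\<Omega>. ennreal (norm (D x) powr p) \<partial>lebesgue)"
    unfolding p_energy_def D_def hs_norm_eq_norm ..

  define m where "m = (R' - r') / 4"
  have m: "0 < m" "R' - r' = 4 * m" using radii by (auto simp: m_def)
  (* A bound for norm x times the norm of the differential of the radial map with profile B: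
     the end values of B below differ from r' and R' by at most m, so its slope is at most
     6 m / (R - r) and its values are at most R' + m. *)
  define cB where "cB = 6 * m / (R - r) * R + (R' + m)"
  have cB: "0 \<le> cB" using m radii R by (auto simp: cB_def intro!: add_nonneg_nonneg)
  have "(\<integral>\<^sup>+x\<in>ball (0::real^2) R. ennreal (norm x powr (- p)) \<partial>lborel) < \<infinity>"
    using integral_norm_powr_finite[of R p] R p by simp
  then obtain W where W: "0 \<le> W" "(\<integral>\<^sup>+x\<in>ball (0::real^2) R. ennreal (norm x powr (- p)) \<partial>lborel) = ennreal W"
    using less_top_ennreal by auto
  define t where "t = min (1 / 2) (e / (3 * (cB powr p * W + 1)))"
  have cW: "0 < cB powr p * W + 1" using W by (intro add_nonneg_pos mult_nonneg_nonneg) auto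
  have t: "0 < t" "t < 1" using e cW by (auto simp: t_def)
  have tW: "t * cB powr p * W \<le> e / 3"
  proof -
    have "t * (cB powr p * W) \<le> (e / (3 * (cB powr p * W + 1))) * (cB powr p * W + 1)"
      using W e cW by (intro mult_mono) (auto simp: t_def)
    also have "\<dots> = e / 3"
    proof -
      have "e / (3 * q) * q = e / 3" if "0 < q" for q using that by simp
      then show ?thesis using cW .
    qed
    finally show ?thesis by (simp add: mult.assoc)
  qed
  (* The end values of G will be off by at most 3 kappa = t m; after division by the weight t
     this becomes an error of at most m in the end values of B. *)
  define \<kappa> where "\<kappa> = t * m / 3"
  have \<kappa>: "0 < \<kappa>" "3 * \<kappa> = t * m" "3 * \<kappa> \<le> m"
    using t m by (auto simp: \<kappa>_def mult_left_le_one_le)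

  have "\<forall>\<^sub>F x in filtercomap norm (at_right r). norm (h x) < r' + \<kappa>"
    by (rule order_tendstoD(2)[OF lim]) (use \<kappa> in simp)
  then obtain Q where Q: "eventually Q (at_right r)" "\<And>x. Q (norm x) \<Longrightarrow> norm (h x) < r' + \<kappa>"
    unfolding eventually_filtercomap by blast
  then obtain b1 where b1: "b1 > r" "\<And>s. r < s \<Longrightarrow> s < b1 \<Longrightarrow> Q s"
    unfolding eventually_at_right_field by auto
  obtain \<delta>2 where \<delta>2: "0 < \<delta>2" "\<And>x. R - \<delta>2 < norm x \<Longrightarrow> norm x < R \<Longrightarrow> norm (g0 x - (R' / R) *\<^sub>R x) \<le> \<kappa>"
    by (rule outer_boundary_uniform[OF radii(1,2) g0(1,3) \<kappa>(1)], assumption) (rule that)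
  define \<eta> where "\<eta> = e / (3 * (R' + m) powr p)"
  have \<eta>: "0 < \<eta>" "(R' + m) powr p * \<eta> = e / 3" using e R m by (auto simp: \<eta>_def)
  obtain \<delta>3 where \<delta>3: "0 < \<delta>3" "\<forall>a b. a \<le> r + \<delta>3 \<longrightarrow> R - \<delta>3 \<le> b \<longrightarrow>
    (\<integral>\<^sup>+x\<in>?\<Omega> - {x. a \<le> norm x \<and> norm x \<le> b}. ennreal (norm x powr (- p)) \<partial>lborel) \<le> ennreal \<eta>"
    using norm_powr_integral_collar[OF radii(1,2) p \<eta>(1)] by blast
  define d where "d = Min {b1 - r, \<delta>2, \<delta>3, \<kappa> * R / R', (R - r) / 2} / 2"
  have d: "0 < d" "d < b1 - r" "d < \<delta>2" "d \<le> \<delta>3" "d \<le> \<kappa> * R / R'" "d < (R - r) / 2"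
  proof -
    let ?S = "{b1 - r, \<delta>2, \<delta>3, \<kappa> * R / R', (R - r) / 2}"
    have pos: "0 < Min ?S" using b1(1) \<delta>2(1) \<delta>3(1) \<kappa>(1) R radii by simp
    then have "d < Min ?S" "0 < d" unfolding d_def by linarith+
    moreover have "Min ?S \<le> b1 - r" "Min ?S \<le> \<delta>2" "Min ?S \<le> \<delta>3" "Min ?S \<le> \<kappa> * R / R'" "Min ?S \<le> (R - r) / 2"
      by (intro Min_le; simp)+
    ultimately show "0 < d" "d < b1 - r" "d < \<delta>2" "d \<le> \<delta>3" "d \<le> \<kappa> * R / R'" "d < (R - r) / 2"
      by linarith+
  qed
  define a b where "a = r + d" and "b = R - d"
  have ab: "r < a" "a < b" "b < R" "0 < a" using d radii by (auto simp: a_def b_def)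
  define K where "K = {x::real^2. a \<le> norm x \<and> norm x \<le> b}"
  have "K = cball 0 b \<inter> - ball 0 a" by (auto simp: K_def)
  then have K: "compact K" by (simp only:) (intro compact_Int_closed compact_cball closed_Compl open_ball)
  have K_sub: "K \<subseteq> ?\<Omega>" using ab by (auto simp: K_def annulus_def)
  have circ_K: "\<rho> *\<^sub>R circ s \<in> K" if "\<rho> \<in> {a..b}" for \<rho> s
    using that ab by (simp add: K_def)
  have K_ne: "K \<noteq> {}" using circ_K[of a 0] ab by auto
  obtain v M where vM: "C1_map v M" and close: "\<And>x. x \<in> K \<Longrightarrow> norm (v x - h x) \<le> \<kappa>"
    and M_le: "(\<integral>\<^sup>+x\<in>K. ennreal (norm (M x) powr p) \<partial>lborel) \<le> (\<integral>\<^sup>+x\<in>?\<Omega>. ennreal (norm (D x) powr p) \<partial>lebesgue)"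
    by (rule mollification[OF open_annulus h_cont D K K_sub K_ne \<kappa>(1) p(1)]) (rule that)
  interpret C1_map v M by fact
  define c where "c = max (r' - \<kappa>) 0"
  have c: "0 \<le> c" "r' - \<kappa> \<le> c" "c \<le> r'" using \<kappa> radii by (auto simp: c_def)
  have length: "c / \<rho> \<le> circle_norm \<rho>" if \<rho>: "\<rho> \<in> {a..b}" and "0 < c" for \<rho>
  proof (rule circle_norm_ge_length)
    show "0 < \<rho>" "0 < c" using that ab by auto
    have cr: "c = r' - \<kappa>" using \<open>0 < c\<close> by (auto simp: c_def max_def split: if_splits)
    have in_\<Omega>: "\<rho> *\<^sub>R circ s \<in> ?\<Omega>" for s using circ_K[OF \<rho>] K_sub by blast
    show "c \<le> norm (v (\<rho> *\<^sub>R circ s))" for s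
      using close[OF circ_K[OF \<rho>, of s]] h_norm(1)[OF in_\<Omega>[of s]] cr
        norm_triangle_ineq2[of "h (\<rho> *\<^sub>R circ s)" "h (\<rho> *\<^sub>R circ s) - v (\<rho> *\<^sub>R circ s)"]
      by (simp add: norm_minus_commute)
    show "winding_number (\<lambda>t. to_complex (v (\<rho> *\<^sub>R circ t))) 0 = 1"
    proof (rule winding_number_circle_image[OF g0(1) radii(1) _ _ g0(3) R(2)])
      show "r < \<rho>" "\<rho> < R" using \<rho> ab by auto
      show "g0 x \<noteq> 0" if "x \<in> ?\<Omega>" for x using h_norm(1)[OF that] g0(2)[OF that] radii by auto
      show "continuous_on UNIV v" by (rule cont_v)
      show "norm (v (\<rho> *\<^sub>R circ s) - g0 (\<rho> *\<^sub>R circ s)) < norm (g0 (\<rho> *\<^sub>R circ s))" for s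
        using close[OF circ_K[OF \<rho>, of s]] h_norm(1)[OF in_\<Omega>[of s]] g0(2)[OF in_\<Omega>[of s]] cr \<open>0 < c\<close> by simp
    qed
  qed
  have v_norm: "norm (v x) \<le> norm (h x) + \<kappa>" if "x \<in> K" for x
    using close[OF that] norm_triangle_ineq2[of "v x" "h x"] by simp
  have radial_le: "x \<bullet> circ s \<le> norm x" "- norm x \<le> x \<bullet> circ s" for x s
    using Cauchy_Schwarz_ineq2[of x "circ s"] by auto
  have mean_a: "circle_mean a \<le> r' + 2 * \<kappa>"
  proof (rule circle_mean_le)
    fix s
    have x: "a *\<^sub>R circ s \<in> K" using circ_K ab by simp
    have "norm (h (a *\<^sub>R circ s)) < r' + \<kappa>"
      using ab d(2) by (intro Q(2) b1(2)) (auto simp: a_def)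
    then show "v (a *\<^sub>R circ s) \<bullet> circ s \<le> r' + 2 * \<kappa>"
      using v_norm[OF x] radial_le(1)[of "v (a *\<^sub>R circ s)" s] by linarith
  qed
  have mean_b_le: "circle_mean b \<le> R' + \<kappa>"
  proof (rule circle_mean_le)
    fix s
    have x: "b *\<^sub>R circ s \<in> K" using circ_K ab by simp
    then show "v (b *\<^sub>R circ s) \<bullet> circ s \<le> R' + \<kappa>"
      using v_norm[OF x] h_norm(2)[of "b *\<^sub>R circ s"] K_sub radial_le(1)[of "v (b *\<^sub>R circ s)" s] by fastforce
  qed
  have mean_b_ge: "R' - 3 * \<kappa> \<le> circle_mean b"
  proof (rule circle_mean_ge)
    fix s
    let ?x = "b *\<^sub>R circ s"
    have x: "?x \<in> K" using circ_K ab by simp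
    have "norm (g0 ?x - (R' / R) *\<^sub>R ?x) \<le> \<kappa>"
      using ab d(3) by (intro \<delta>2(2)) (auto simp: b_def)
    then have "norm (h ?x - (R' / R) *\<^sub>R ?x) \<le> \<kappa>" using g0(2) x K_sub by auto
    then have "norm (v ?x - (R' / R) *\<^sub>R ?x) \<le> 2 * \<kappa>"
      using close[OF x] norm_triangle_ineq[of "v ?x - h ?x" "h ?x - (R' / R) *\<^sub>R ?x"] by simp
    then have "- (2 * \<kappa>) \<le> (v ?x - (R' / R) *\<^sub>R ?x) \<bullet> circ s"
      using radial_le(2)[of "v ?x - (R' / R) *\<^sub>R ?x" s] by linarith
    moreover have "((R' / R) *\<^sub>R ?x) \<bullet> circ s = R' / R * b"
    proof -
      have "circ s \<bullet> circ s = 1" by (simp add: dot_square_norm)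
      then show ?thesis by simp
    qed
    moreover have "R' - \<kappa> \<le> R' / R * b"
    proof -
      have "R' / R * d \<le> R' / R * (\<kappa> * R / R')" using d(5) R by (intro mult_left_mono) auto
      then show ?thesis using R by (simp add: b_def right_diff_distrib)
    qed
    ultimately show "R' - 3 * \<kappa> \<le> v ?x \<bullet> circ s" unfolding inner_diff_left by linarith
  qed

  obtain G g N L where G: "mono G" "\<And>s t. \<bar>G s - G t\<bar> \<le> L * \<bar>s - t\<bar>" and gL: "\<And>s. \<bar>g s\<bar> \<le> L"
    and Ga: "\<And>s. s \<le> a \<Longrightarrow> G s = G a" and Gb: "\<And>s. b \<le> s \<Longrightarrow> G s = max (circle_mean b) c"
    and Ga_le: "G a \<le> max (circle_mean a) c" and G_ge: "\<And>s. c \<le> G s" and N: "countable N"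
    and G_deriv: "\<And>s. s \<notin> N \<Longrightarrow> (G has_real_derivative g s) (at s)"
    and g_outside: "\<And>s. s < a \<or> b < s \<Longrightarrow> g s = 0"
    and g_inside: "\<And>s. a < s \<Longrightarrow> s < b \<Longrightarrow> s \<notin> N \<Longrightarrow> sqrt ((g s)\<^sup>2 + (G s / s)\<^sup>2) \<le> circle_norm s"
    by (rule monotone_radial_comparison[OF ab(4) less_imp_le[OF ab(2)] c(1) length], assumption+) (rule that)
  have Ga_near: "\<bar>r' - G a\<bar> \<le> 3 * \<kappa>" using Ga_le G_ge[of a] mean_a c \<kappa>(1) by linarith
  have Gb_near: "\<bar>R' - G b\<bar> \<le> 3 * \<kappa>" using Gb[of b] mean_b_le mean_b_ge c \<kappa>(1) radii by linarith
  (* The end values of B that give the convex combination the end values r' and R'. *)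
  define B1 B2 where "B1 = (r' - (1 - t) * G a) / t" and "B2 = (R' - (1 - t) * G b) / t"
  have near: "\<bar>(q - (1 - t) * w) / t - q\<bar> \<le> m" if "\<bar>q - w\<bar> \<le> 3 * \<kappa>" for q w
  proof -
    have "(q - (1 - t) * w) / t - q = (1 - t) * (q - w) / t" using t by (simp add: field_simps)
    also have "\<bar>\<dots>\<bar> = (1 - t) * \<bar>q - w\<bar> / t" using t by (simp add: abs_mult)
    also have "\<dots> \<le> 1 * (3 * \<kappa>) / t" using t that \<kappa> by (intro divide_right_mono mult_mono) auto
    also have "\<dots> = m" using t \<kappa>(2) by simp
    finally show ?thesis .
  qed
  have B12: "\<bar>B1 - r'\<bar> \<le> m" "\<bar>B2 - R'\<bar> \<le> m"
    unfolding B1_def B2_def using near Ga_near Gb_near by blast+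
  define \<beta> where "\<beta> = (B2 - B1) / (R - r)"
  have \<beta>: "0 < \<beta>" "\<beta> \<le> 6 * m / (R - r)"
    using B12 m radii by (auto simp: \<beta>_def intro!: divide_pos_pos divide_right_mono)
  define B where "B s = B1 + \<beta> * (s - r)" for s
  have B_ends: "B r = B1" "B R = B2" using radii by (auto simp: B_def \<beta>_def)
  have B_bdd: "\<bar>B s\<bar> \<le> R' + m" if "s \<in> {r..R}" for s
  proof -
    have "B1 \<le> B s" using that \<beta> by (simp add: B_def)
    moreover have "\<beta> * (s - r) \<le> \<beta> * (R - r)" using that \<beta> by (intro mult_left_mono) auto
    then have "B s \<le> B2" using B_ends(2) by (simp add: B_def)
    ultimately show ?thesis using B12 m radii by linarith
  qed
  define Kf where "Kf s = (1 - t) * G s + t * B s" for s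
  define kf where "kf s = (1 - t) * g s + t * \<beta>" for s
  have L: "0 \<le> L" using order_trans[OF abs_ge_zero gL] .
  have Kf_lip: "\<bar>Kf s - Kf u\<bar> \<le> (L + \<beta>) * \<bar>s - u\<bar>" for s u
  proof -
    have "Kf s - Kf u = (1 - t) * (G s - G u) + t * (\<beta> * (s - u))"
      by (simp add: Kf_def B_def algebra_simps)
    then have "\<bar>Kf s - Kf u\<bar> \<le> (1 - t) * \<bar>G s - G u\<bar> + t * (\<beta> * \<bar>s - u\<bar>)"
      using abs_triangle_ineq[of "(1 - t) * (G s - G u)" "t * (\<beta> * (s - u))"] t \<beta> by (simp add: abs_mult)
    also have "\<dots> \<le> 1 * (L * \<bar>s - u\<bar>) + 1 * (\<beta> * \<bar>s - u\<bar>)"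
      using t \<beta> G(2)[of s u] L by (intro add_mono mult_mono) auto
    finally show ?thesis by (simp add: algebra_simps)
  qed
  have kf_bdd: "\<bar>kf s\<bar> \<le> L + \<beta>" for s
  proof -
    have "\<bar>kf s\<bar> \<le> (1 - t) * \<bar>g s\<bar> + t * \<beta>"
      unfolding kf_def using abs_triangle_ineq[of "(1 - t) * g s" "t * \<beta>"] t \<beta> by (simp add: abs_mult)
    also have "\<dots> \<le> 1 * L + 1 * \<beta>" using t \<beta> gL[of s] L by (intro add_mono mult_mono) auto
    finally show ?thesis by simp
  qed
  have Kf_deriv: "(Kf has_real_derivative kf s) (at s)" if "s \<notin> N" for s
    unfolding Kf_def[abs_def] kf_def B_def by (auto intro!: derivative_eq_intros G_deriv[OF that])
  have Kf_cont: "continuous_on UNIV Kf"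
  proof -
    have "(L + \<beta>)-lipschitz_on UNIV Kf"
      using Kf_lip L \<beta> by (auto intro!: lipschitz_onI simp: dist_real_def)
    then show ?thesis by (rule lipschitz_on_continuous_on)
  qed
  have Kf_ends: "Kf r = r'" "Kf R = R'"
  proof -
    show "Kf r = r'" using Ga[of r] ab t by (simp add: Kf_def B_ends B1_def)
    show "Kf R = R'" using Gb[of R] Gb[of b] ab t by (simp add: Kf_def B_ends B2_def)
  qed
  have profile: "radial_profile r R r' R' Kf"
  proof
    show "continuous_on {r<..R} Kf" using Kf_cont continuous_on_subset by blast
    show "Kf s < Kf u" if "s < u" for s u
    proof -
      have "(1 - t) * G s \<le> (1 - t) * G u" using G(1) that t by (intro mult_left_mono) (auto simp: monoD)
      moreover have "t * B s < t * B u" using that t \<beta> by (simp add: B_def)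
      ultimately show ?thesis by (simp add: Kf_def)
    qed
    have "isCont Kf r" using Kf_cont by (simp add: continuous_on_eq_continuous_at)
    then show "(Kf \<longlongrightarrow> r') (at_right r)"
      using Kf_ends(1) by (auto simp: isCont_def intro: tendsto_within_subset[of _ _ _ UNIV])
  qed (use radii Kf_ends in auto)
  note wd = radial_map_weak_differential[OF radii(1,2) p Kf_lip N Kf_deriv kf_bdd]
  have radial: "radial_map Kf \<in> radial_Sobolev_homeos p r R r' R'"
    by (rule radial_profile.radial_map_in_classes(2)[OF profile wd(2)])

  define E where "E = {x::real^2. norm x \<in> N \<union> {a, b}}"
  have "E = (\<Union>s\<in>N \<union> {a, b}. sphere 0 s)" by (auto simp: E_def)
  moreover have "negligible (\<Union>s\<in>N \<union> {a, b}. sphere (0::real^2) s)"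
    by (intro negligible_countable_Union countable_image) (use N in \<open>auto simp: negligible_sphere\<close>)
  ultimately have E_null: "E \<in> null_sets lebesgue" by (simp add: negligible_iff_null_sets)

  (* F1 dominates the energy of G inside the closed subannulus, F2 its energy in the two
     collars, and F3 the contribution of B. *)
  define F1 where "F1 x = ennreal (circle_norm (norm x) powr p) * indicator K x" for x
  define F2 where "F2 x = ennreal ((R' + m) powr p) * (ennreal (norm x powr (- p)) * indicator (?\<Omega> - K) x)" for x
  define F3 where "F3 x = ennreal (t * cB powr p) * (ennreal (norm x powr (- p)) * indicator (ball 0 R) x)" for x :: "real^2"
  have pointwise: "ennreal (norm (radial_matrix (kf (norm x)) (Kf (norm x) / norm x) x) powr p) \<le> F1 x + F2 x + F3 x"
    if x: "x \<in> ?\<Omega>" "x \<notin> E" for x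
  proof -
    define s where "s = norm x"
    have s: "r < s" "s < R" "s \<notin> N" "s \<noteq> a" "s \<noteq> b" "0 < s" and x0: "x \<noteq> 0"
      using x radii by (auto simp: s_def E_def annulus_def)
    define X where "X = sqrt ((g s)\<^sup>2 + (G s / s)\<^sup>2)"
    define Y where "Y = sqrt (\<beta>\<^sup>2 + (B s / s)\<^sup>2)"
    have XY0: "0 \<le> X" "0 \<le> Y" by (simp_all add: X_def Y_def)
    have "norm (radial_matrix (kf s) (Kf s / s) x) = sqrt (((1 - t) * g s + t * \<beta>)\<^sup>2 + ((1 - t) * (G s / s) + t * (B s / s))\<^sup>2)"
      unfolding norm_radial_matrix[OF x0] by (simp add: kf_def Kf_def add_divide_distrib)
    also have "\<dots> \<le> (1 - t) * X + t * Y"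
      unfolding X_def Y_def using t by (intro sqrt_convex_combination) auto
    finally have "norm (radial_matrix (kf s) (Kf s / s) x) powr p \<le> ((1 - t) * X + t * Y) powr p"
      using p by (intro powr_mono2) auto
    also have "\<dots> \<le> (1 - t) * X powr p + t * Y powr p"
      using t XY0 p by (intro powr_convex_combination) auto
    also have "\<dots> \<le> X powr p + t * (cB powr p * s powr (- p))"
    proof (intro add_mono mult_left_mono)
      show "(1 - t) * X powr p \<le> X powr p" using t by (simp add: mult_left_le_one_le)
      have "Y \<le> \<bar>\<beta>\<bar> + \<bar>B s / s\<bar>" unfolding Y_def by (rule sqrt_sum_squares_le_sum_abs)
      also have "\<dots> \<le> 6 * m / (R - r) * R / s + (R' + m) / s"
      proof (intro add_mono)
        have "6 * m / (R - r) * 1 \<le> 6 * m / (R - r) * (R / s)"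
          using s m radii by (intro mult_left_mono) auto
        then show "\<bar>\<beta>\<bar> \<le> 6 * m / (R - r) * R / s" using \<beta> by simp
        show "\<bar>B s / s\<bar> \<le> (R' + m) / s" using B_bdd[of s] s by (simp add: divide_right_mono)
      qed
      also have "\<dots> = cB / s" by (simp add: cB_def add_divide_distrib)
      finally have "Y powr p \<le> (cB / s) powr p" using XY0 p by (intro powr_mono2) auto
      then show "Y powr p \<le> cB powr p * s powr (- p)"
        using cB s by (simp add: powr_divide powr_minus_divide)
    qed (use t in auto)
    finally have 1: "ennreal (norm (radial_matrix (kf s) (Kf s / s) x) powr p) \<le> ennreal (X powr p) + F3 x"
      using x s cB t unfolding F3_def s_def[symmetric]
      by (simp add: ennreal_plus[symmetric] ennreal_mult[symmetric] mult.assoc annulus_def s_def del: ennreal_plus)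
    have 2: "ennreal (X powr p) \<le> F1 x + F2 x"
    proof (cases "x \<in> K")
      case True
      then have "a < s" "s < b" using s by (auto simp: K_def s_def)
      then have "X powr p \<le> circle_norm s powr p"
        unfolding X_def using g_inside s p by (intro powr_mono2) auto
      then show ?thesis using True by (simp add: F1_def F2_def s_def ennreal_leI)
    next
      case False
      then have "s < a \<or> b < s" using s by (auto simp: K_def s_def)
      then have g0: "g s = 0" using g_outside by blast
      have "G s \<le> G R" using G(1) s by (simp add: monoD)
      also have "G R = G b" using Gb[of R] Gb[of b] ab by simp
      also have "G b \<le> R' + m" using Gb_near \<kappa>(3) by linarith
      finally have "G s / s \<le> (R' + m) / s" using s by (simp add: divide_right_mono)
      moreover have "0 \<le> G s / s" using G_ge[of s] c s by simp
      ultimately have "X \<le> (R' + m) / s" by (simp add: X_def g0)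
      then have "X powr p \<le> ((R' + m) / s) powr p" using XY0 p by (intro powr_mono2) auto
      also have "\<dots> = (R' + m) powr p * s powr (- p)"
        using R m s by (simp add: powr_divide powr_minus_divide)
      finally have "ennreal (X powr p) \<le> F2 x"
        using False x by (simp add: F2_def s_def ennreal_mult[symmetric] ennreal_leI)
      then show ?thesis by (simp add: add_increasing)
    qed
    have "ennreal (norm (radial_matrix (kf s) (Kf s / s) x) powr p) \<le> (F1 x + F2 x) + F3 x"
      using 1 2 by (meson add_right_mono order_trans)
    then show ?thesis by (simp add: s_def)
  qed
  have [measurable]: "K \<in> sets borel" "?\<Omega> \<in> sets borel" "ball (0::real^2) R \<in> sets borel"
    using K open_annulus by (auto intro: borel_compact)
  have [measurable]: "circle_norm \<in> borel_measurable borel"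
    by (rule borel_measurable_continuous_onI[OF continuous_circle_norm])
  have [measurable]: "F1 \<in> borel_measurable borel" "F2 \<in> borel_measurable borel" "F3 \<in> borel_measurable borel"
    unfolding F1_def F2_def F3_def by measurable
  have "p_energy p ?\<Omega> (radial_map Kf) = (\<integral>\<^sup>+x\<in>?\<Omega>. ennreal (norm (radial_matrix (kf (norm x)) (Kf (norm x) / norm x) x) powr p) \<partial>lebesgue)"
    by (rule p_energy_eq[OF open_annulus wd(1)])
  also have "\<dots> \<le> (\<integral>\<^sup>+x. F1 x + F2 x + F3 x \<partial>lebesgue)"
  proof (rule nn_integral_mono_AE)
    show "AE x in lebesgue. ennreal (norm (radial_matrix (kf (norm x)) (Kf (norm x) / norm x) x) powr p) * indicator ?\<Omega> x \<le> F1 x + F2 x + F3 x"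
      using AE_not_in[OF E_null] by eventually_elim (use pointwise in \<open>auto simp: indicator_def\<close>)
  qed
  also have "\<dots> = (\<integral>\<^sup>+x. F1 x \<partial>lborel) + (\<integral>\<^sup>+x. F2 x \<partial>lborel) + (\<integral>\<^sup>+x. F3 x \<partial>lborel)"
    by (simp add: nn_integral_completion nn_integral_add)
  also have "\<dots> \<le> p_energy p ?\<Omega> h + ennreal (e / 3) + ennreal (e / 3)"
  proof (intro add_mono)
    have "(\<integral>\<^sup>+x. F1 x \<partial>lborel) \<le> (\<integral>\<^sup>+x\<in>K. ennreal (norm (M x) powr p) \<partial>lborel)"
      unfolding F1_def K_def by (rule nn_integral_circle_norm_le[OF p(1)])
    then show "(\<integral>\<^sup>+x. F1 x \<partial>lborel) \<le> p_energy p ?\<Omega> h" unfolding energy using M_le by (rule order_trans)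
    have "(\<integral>\<^sup>+x. F2 x \<partial>lborel) = ennreal ((R' + m) powr p) * (\<integral>\<^sup>+x\<in>?\<Omega> - K. ennreal (norm x powr (- p)) \<partial>lborel)"
      unfolding F2_def by (rule nn_integral_cmult) measurable
    also have "\<dots> \<le> ennreal ((R' + m) powr p) * ennreal \<eta>"
      unfolding K_def using d by (intro mult_left_mono \<delta>3(2)[rule_format]) (auto simp: a_def b_def)
    also have "\<dots> = ennreal ((R' + m) powr p * \<eta>)" using \<eta>(1) by (intro ennreal_mult[symmetric]) auto
    also have "\<dots> = ennreal (e / 3)" unfolding \<eta>(2) ..
    finally show "(\<integral>\<^sup>+x. F2 x \<partial>lborel) \<le> ennreal (e / 3)" .
    have "(\<integral>\<^sup>+x. F3 x \<partial>lborel) = ennreal (t * cB powr p) * ennreal W"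
      unfolding F3_def W(2)[symmetric] by (rule nn_integral_cmult) measurable
    also have "\<dots> \<le> ennreal (e / 3)"
      using tW W(1) t by (simp add: ennreal_mult[symmetric] ennreal_leI)
    finally show "(\<integral>\<^sup>+x. F3 x \<partial>lborel) \<le> ennreal (e / 3)" .
  qed
  also have "\<dots> = p_energy p ?\<Omega> h + ennreal (e / 3 + e / 3)"
    using e by (simp add: ennreal_plus[symmetric] add.assoc del: ennreal_plus)
  also have "\<dots> \<le> p_energy p ?\<Omega> h + ennreal e"
    using e by (intro add_left_mono ennreal_leI) simp
  finally show ?thesis using radial by blast
qed

theorem theorem1p3:
  fixes r R r' R' p :: real
  assumes "0 \<le> r" and "r < R" and "0 \<le> r'" and "r' < R'"
    and "1 \<le> p" and "p < 2"
  shows "(INF h \<in> Sobolev_homeos_Id p r R r' R'. p_energy p (annulus r R) h) =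
         (INF h \<in> radial_Sobolev_homeos p r R r' R'. p_energy p (annulus r R) h)"
proof (rule antisym)
  show "(INF h \<in> Sobolev_homeos_Id p r R r' R'. p_energy p (annulus r R) h) \<le>
         (INF h \<in> radial_Sobolev_homeos p r R r' R'. p_energy p (annulus r R) h)"
  proof (rule INF_greatest)
    fix h assume "h \<in> radial_Sobolev_homeos p r R r' R'"
    then obtain k where "k \<in> Sobolev_homeos_Id p r R r' R'" "p_energy p (annulus r R) k = p_energy p (annulus r R) h"
      using radial_homeo_energy_attained_in_Id assms by blast
    then show "(INF h \<in> Sobolev_homeos_Id p r R r' R'. p_energy p (annulus r R) h) \<le> p_energy p (annulus r R) h"
      by (metis INF_lower)
  qed
  show "(INF h \<in> radial_Sobolev_homeos p r R r' R'. p_energy p (annulus r R) h) \<le>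
         (INF h \<in> Sobolev_homeos_Id p r R r' R'. p_energy p (annulus r R) h)"
  proof (rule INF_greatest, rule ennreal_le_epsilon)
    fix h and e :: real assume h: "h \<in> Sobolev_homeos_Id p r R r' R'" and e: "0 < e"
    obtain k where k: "k \<in> radial_Sobolev_homeos p r R r' R'" "p_energy p (annulus r R) k \<le> p_energy p (annulus r R) h + ennreal e"
      using radial_approximation[OF assms h e] by blast
    have "(INF h \<in> radial_Sobolev_homeos p r R r' R'. p_energy p (annulus r R) h) \<le> p_energy p (annulus r R) k"
      using k(1) by (rule INF_lower)
    then show "(INF h \<in> radial_Sobolev_homeos p r R r' R'. p_energy p (annulus r R) h) \<le> p_energy p (annulus r R) h + ennreal e"
      using k(2) by (rule order_trans)
  qed
qed

end
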